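(* Let $T,N\in\mathbb N$, $t\in[T]$, $\ell_1,\dots,\ell_T>0$, and let $\boldsymbol\pi_{T,D}=\pi_T^{\otimes D}$ be as in the context. Assume that the density $\pi_T$ is twice continuously differentiable and that for all $s,u\in[T]$ the function $\partial_s\partial_u\log\pi_T$ is Lipschitz-continuous and bounded and $\pi_T(|\partial_u\log\pi_T|^4)<\infty$. Let $\tilde\alpha^N_{T,D,\mathbf x_{1:T}}(t)$ be the probability of $\{K_t\ne0\}$ under one RW-EHMM update started from $\mathbf x_{1:T}$, and $\tilde\alpha^N_T(t)$ the probability of $\{K_t\neq0\}$ under the limiting law $\widetilde{\mathbb P}^N_T$. Then there is a family of Borel sets $\mathbf F_{T,D}\subseteq(\mathbb R^D)^T$ (not depending on $t$) with $\lim_{D\to\infty}\boldsymbol\pi_{T,D}(\mathbf F_{T,D})=1$, along which the law of $K_{1:T}$ under the RW-EHMM update converges in total variation to its law under $\widetilde{\mathbb P}^N_T$ uniformly in $\mathbf x_{1:T}\in\mathbf F_{T,D}$ as $D\to\infty$, and for which $$\lim_{D\to\infty}\ \sup_{\mathbf x_{1:T}\in\mathbf F_{T,D}}\bigl|\tilde\alpha^N_{T,D,\mathbf x_{1:T}}(t)-\tilde\alpha^N_T(t)\bigr|=0 .$$ Moreover, $$\tilde\alpha^N_T(t)\ \ge\ \Bigl(1+\frac{\exp(\ell_t\mathcal I_{t|T})}{N}\Bigr)^{-1}>0,\qquad \mathcal I_{t|T}:=\pi_T([\partial_t\log\pi_T]^2).$$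
   Context: Notation: $[n]=\{1,\dots,n\}$, $[n]_0=\{0,\dots,n\}$; $\partial_t$ is the derivative with respect to $x_t$; $\pi_T(\varphi)=\int\varphi\,\pi_T$; $\mathbf 1_N$ is the all-ones vector and $I_N$ the identity. Quantities with time index $0$ are ignored. Model. $M_1$ is a probability measure on $\mathbb R$ with Lebesgue density $m_1$; for $t\ge2$, $M_t$ is a Markov kernel on $\mathbb R$ with transition density $m_t(x,y)$; $G_t:\mathbb R\to(0,\infty)$ is measurable. $\pi_T$ is the probability measure (and its density) on $\mathbb R^T$ given by $\pi_T(x_{1:T})\propto m_1(x_1)G_1(x_1)\prod_{t=2}^T m_t(x_{t-1},x_t)G_t(x_t)$. For $D\in\mathbb N$, $\mathbf x_t=(x_{t,1},\dots,x_{t,D})\in\mathbb R^D$, the target is $\boldsymbol\pi_{T,D}(\mathbf x_{1:T})=\prod_{d=1}^D\pi_T(x_{1,d},\dots,x_{T,d})$ on $(\mathbb R^D)^T$. Let $\Sigma=\tfrac12(I_N+\mathbf 1_N\mathbf 1_N^{\mathsf T})$. One RW-EHMM update from $\mathbf x_{1:T}$: set $\mathbf Z_t^0=\mathbf x_t$; independently for all $t\in[T]$, $d\in[D]$ sample $U_{t,d}^{1:N}\sim \mathrm N(0,\Sigma)$ and set $Z_{t,d}^n=x_{t,d}+\sqrt{\ell_t/D}\,U_{t,d}^n$, $\mathbf Z_t^n=(Z_{t,1}^n,\dots,Z_{t,D}^n)$ for $n\in[N]$. Then sample $K_{1:T}=k_{1:T}\in[N]_0^T$ with probability $\boldsymbol\pi_{T,D}(\mathbf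 Z_1^{k_1},\dots,\mathbf Z_T^{k_T})\big/\sum_{l_{1:T}\in[N]_0^T}\boldsymbol\pi_{T,D}(\mathbf Z_1^{l_1},\dots,\mathbf Z_T^{l_T})$. The new state is $(\mathbf Z_1^{K_1},\dots,\mathbf Z_T^{K_T})$. Limiting law $\widetilde{\mathbb P}^N_T$. Let $\mathcal I_{t|T}=\pi_T([\partial_t\log\pi_T]^2)=-\pi_T(\partial_t^2\log\pi_T)$. Sample independently for $t\in[T]$ vectors $V_t=(V_t^1,\dots,V_t^N)\sim \mathrm N(-\tfrac12\ell_t\mathcal I_{t|T}\mathbf 1_N,\ \ell_t\mathcal I_{t|T}\Sigma)$, and given these sample $K_1,\dots,K_T$ conditionally independently with $K_t=k\in[N]_0$ having probability $\Psi^k(\{V_t^m\}_{m=1}^N)$, where $\Psi^k(\{h^m\}_{m=1}^N)=e^{h^k}/(1+\sum_{m=1}^N e^{h^m})$ with $h^0:=0$. *)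

theory Defs
  imports "HOL-Probability.Probability"
begin

section \<open>Calculus on real Euclidean space with coordinates indexed by 1, ..., T\<close>

text \<open>A point of \<open>\<real>\<^sup>T\<close> is an extensional function on \<open>{1..T}\<close>, so that \<open>\<real>\<^sup>T\<close> is the space of
  the product measure \<open>\<Pi>\<^sub>M t\<in>{1..T}. lborel\<close>; it carries the subspace topology of the product
  topology on \<^typ>\<open>nat \<Rightarrow> real\<close>.\<close>

definition Rn :: "nat \<Rightarrow> (nat \<Rightarrow> real) set" where
  "Rn T = ({1..T} \<rightarrow>\<^sub>E UNIV)"

definition pderiv_at :: "nat \<Rightarrow> ((nat \<Rightarrow> real) \<Rightarrow> real) \<Rightarrow> (nat \<Rightarrow> real) \<Rightarrow> real" where
  "pderiv_at u f x = deriv (\<lambda>s. f (x(u := s))) (x u)"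

fun C_k :: "nat \<Rightarrow> nat \<Rightarrow> ((nat \<Rightarrow> real) \<Rightarrow> real) \<Rightarrow> bool" where
  "C_k T 0 f \<longleftrightarrow> continuous_on (Rn T) f"
| "C_k T (Suc k) f \<longleftrightarrow> continuous_on (Rn T) f \<and>
     (\<forall>u\<in>{1..T}. (\<forall>x\<in>Rn T. (\<lambda>s. f (x(u := s))) field_differentiable at (x u)) \<and>
                 C_k T k (pderiv_at u f))"

definition Lipschitz_Rn :: "nat \<Rightarrow> (nat \<Rightarrow> real) set \<Rightarrow> ((nat \<Rightarrow> real) \<Rightarrow> real) \<Rightarrow> bool" where
  "Lipschitz_Rn T S f \<longleftrightarrow>
     (\<exists>L. \<forall>x\<in>S. \<forall>y\<in>S. \<bar>f x - f y\<bar> \<le> L * L2_set (\<lambda>i. x i - y i) {1..T})"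


section \<open>Multivariate normal distributions\<close>

definition psd_on :: "'i set \<Rightarrow> ('i \<Rightarrow> 'i \<Rightarrow> real) \<Rightarrow> bool" where
  "psd_on I B \<longleftrightarrow> (\<forall>i\<in>I. \<forall>j\<in>I. B i j = B j i) \<and>
     (\<forall>v. 0 \<le> (\<Sum>i\<in>I. \<Sum>j\<in>I. v i * B i j * v j))"

text \<open>For finite \<open>I\<close> and positive semidefinite \<open>C\<close> such a root exists and is unique on \<open>I \<times> I\<close>.\<close>

definition psd_sqrt :: "'i set \<Rightarrow> ('i \<Rightarrow> 'i \<Rightarrow> real) \<Rightarrow> 'i \<Rightarrow> 'i \<Rightarrow> real" where
  "psd_sqrt I C = (SOME B. psd_on I B \<and> (\<forall>i\<in>I. \<forall>j\<in>I. (\<Sum>k\<in>I. B i k * B k j) = C i j))"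

text \<open>\<open>N(\<mu>, C)\<close> is the law of \<open>\<mu> + C\<^sup>1\<^sup>/\<^sup>2 W\<close> for a vector \<open>W\<close> of independent standard normal
  variables; \<open>C\<close> may be singular.\<close>

definition mvnormal :: "'i set \<Rightarrow> ('i \<Rightarrow> real) \<Rightarrow> ('i \<Rightarrow> 'i \<Rightarrow> real) \<Rightarrow> ('i \<Rightarrow> real) measure" where
  "mvnormal I \<mu> C =
     distr (\<Pi>\<^sub>M i\<in>I. density lborel (\<lambda>w. ennreal (std_normal_density w))) (\<Pi>\<^sub>M i\<in>I. borel)
       (\<lambda>w. \<lambda>i\<in>I. \<mu> i + (\<Sum>j\<in>I. psd_sqrt I C i j * w j))"

definition Sigma_mat :: "nat \<Rightarrow> nat \<Rightarrow> real" where
  "Sigma_mat i j = ((if i = j then 1 else 0) + 1) / 2"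


section \<open>The model and its target\<close>

text \<open>\<open>m1\<close> is the initial density, \<open>m t\<close> the transition density from time \<open>t - 1\<close> to time \<open>t\<close>.\<close>

definition fk_model ::
  "nat \<Rightarrow> (real \<Rightarrow> real) \<Rightarrow> (nat \<Rightarrow> real \<Rightarrow> real \<Rightarrow> real) \<Rightarrow> (nat \<Rightarrow> real \<Rightarrow> real) \<Rightarrow> bool" where
  "fk_model T m1 m G \<longleftrightarrow>
     m1 \<in> borel_measurable borel \<and> (\<forall>x. 0 \<le> m1 x) \<and>
     prob_space (density lborel (\<lambda>x. ennreal (m1 x))) \<and>
     (\<forall>t\<in>{2..T}. (\<lambda>(x, y). m t x y) \<in> borel_measurable (borel \<Otimes>\<^sub>M borel) \<and>
        (\<forall>x y. 0 \<le> m t x y) \<and>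
        (\<forall>x. prob_space (density lborel (\<lambda>y. ennreal (m t x y))))) \<and>
     (\<forall>t\<in>{1..T}. G t \<in> borel_measurable borel \<and> (\<forall>x. 0 < G t x))"

definition fk_unnorm ::
  "nat \<Rightarrow> (real \<Rightarrow> real) \<Rightarrow> (nat \<Rightarrow> real \<Rightarrow> real \<Rightarrow> real) \<Rightarrow> (nat \<Rightarrow> real \<Rightarrow> real) \<Rightarrow> (nat \<Rightarrow> real) \<Rightarrow> real"
  where "fk_unnorm T m1 m G x =
     m1 (x 1) * G 1 (x 1) * (\<Prod>t\<in>{2..T}. m t (x (t - 1)) (x t) * G t (x t))"

definition fk_density ::
  "nat \<Rightarrow> (real \<Rightarrow> real) \<Rightarrow> (nat \<Rightarrow> real \<Rightarrow> real \<Rightarrow> real) \<Rightarrow> (nat \<Rightarrow> real \<Rightarrow> real) \<Rightarrow> (nat \<Rightarrow> real) \<Rightarrow> real"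
  where "fk_density T m1 m G x =
     fk_unnorm T m1 m G x / (\<integral>y. fk_unnorm T m1 m G y \<partial>(\<Pi>\<^sub>M t\<in>{1..T}. lborel))"

text \<open>From here on \<open>p\<close> is the density \<open>\<pi>\<^sub>T\<close> on \<open>\<real>\<^sup>T\<close>; elements \<open>x\<close> of \<open>(\<real>\<^sup>D)\<^sup>T\<close> are written
  \<open>x t d\<close>.\<close>

definition pi_measure :: "nat \<Rightarrow> ((nat \<Rightarrow> real) \<Rightarrow> real) \<Rightarrow> (nat \<Rightarrow> real) measure" where
  "pi_measure T p = density (\<Pi>\<^sub>M t\<in>{1..T}. lborel) (\<lambda>x. ennreal (p x))"

definition target_density ::
  "nat \<Rightarrow> nat \<Rightarrow> ((nat \<Rightarrow> real) \<Rightarrow> real) \<Rightarrow> (nat \<Rightarrow> nat \<Rightarrow> real) \<Rightarrow> real" where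
  "target_density T D p x = (\<Prod>d\<in>{1..D}. p (\<lambda>t\<in>{1..T}. x t d))"

definition target_measure ::
  "nat \<Rightarrow> nat \<Rightarrow> ((nat \<Rightarrow> real) \<Rightarrow> real) \<Rightarrow> (nat \<Rightarrow> nat \<Rightarrow> real) measure" where
  "target_measure T D p =
     density (\<Pi>\<^sub>M t\<in>{1..T}. \<Pi>\<^sub>M d\<in>{1..D}. lborel) (\<lambda>x. ennreal (target_density T D p x))"

definition log_p :: "((nat \<Rightarrow> real) \<Rightarrow> real) \<Rightarrow> (nat \<Rightarrow> real) \<Rightarrow> real" where
  "log_p p x = ln (p x)"

definition fisher :: "nat \<Rightarrow> ((nat \<Rightarrow> real) \<Rightarrow> real) \<Rightarrow> nat \<Rightarrow> real" where
  "fisher T p t = (\<integral>x. (pderiv_at t (log_p p) x)\<^sup>2 \<partial>pi_measure T p)"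


section \<open>One update and its limiting law\<close>

definition indices :: "nat \<Rightarrow> nat \<Rightarrow> (nat \<Rightarrow> nat) set" where
  "indices T N = ({1..T} \<rightarrow>\<^sub>E {0..N})"

text \<open>The law on pairs \<open>(\<omega>, k)\<close> in which \<open>\<omega>\<close> has law \<open>P\<close> and, given \<open>\<omega>\<close>, the index vector
  equals \<open>k\<close> with probability \<open>q \<omega> k\<close>.\<close>

definition select_law ::
  "nat \<Rightarrow> nat \<Rightarrow> 'w measure \<Rightarrow> ('w \<Rightarrow> (nat \<Rightarrow> nat) \<Rightarrow> real) \<Rightarrow> ('w \<times> (nat \<Rightarrow> nat)) measure" where
  "select_law T N P q =
     density (P \<Otimes>\<^sub>M count_space (indices T N)) (\<lambda>(\<omega>, k). ennreal (q \<omega> k))"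

definition K_law :: "nat \<Rightarrow> nat \<Rightarrow> ('w \<times> (nat \<Rightarrow> nat)) measure \<Rightarrow> (nat \<Rightarrow> nat) measure" where
  "K_law T N Q = distr Q (count_space (indices T N)) snd"

text \<open>\<open>U t d n\<close> is the noise for time \<open>t\<close>, component \<open>d\<close>, proposal \<open>n\<close>.\<close>

definition noise_law :: "nat \<Rightarrow> nat \<Rightarrow> nat \<Rightarrow> (nat \<Rightarrow> nat \<Rightarrow> nat \<Rightarrow> real) measure" where
  "noise_law T D N =
     (\<Pi>\<^sub>M t\<in>{1..T}. \<Pi>\<^sub>M d\<in>{1..D}. mvnormal {1..N} (\<lambda>_. 0) Sigma_mat)"

definition proposal ::
  "nat \<Rightarrow> (nat \<Rightarrow> real) \<Rightarrow> (nat \<Rightarrow> nat \<Rightarrow> real) \<Rightarrow> (nat \<Rightarrow> nat \<Rightarrow> nat \<Rightarrow> real) \<Rightarrow> nat \<Rightarrow> nat \<Rightarrow> nat \<Rightarrow> real"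
  where "proposal D ell x U n t d =
     (if n = 0 then x t d else x t d + sqrt (ell t / real D) * U t d n)"

definition ehmm_select ::
  "nat \<Rightarrow> nat \<Rightarrow> nat \<Rightarrow> (nat \<Rightarrow> real) \<Rightarrow> ((nat \<Rightarrow> real) \<Rightarrow> real) \<Rightarrow> (nat \<Rightarrow> nat \<Rightarrow> real) \<Rightarrow>
     (nat \<Rightarrow> nat \<Rightarrow> nat \<Rightarrow> real) \<Rightarrow> (nat \<Rightarrow> nat) \<Rightarrow> real" where
  "ehmm_select T D N ell p x U k =
     target_density T D p (\<lambda>t. proposal D ell x U (k t) t) /
     (\<Sum>l\<in>indices T N. target_density T D p (\<lambda>t. proposal D ell x U (l t) t))"

definition rw_ehmm ::
  "nat \<Rightarrow> nat \<Rightarrow> nat \<Rightarrow> (nat \<Rightarrow> real) \<Rightarrow> ((nat \<Rightarrow> real) \<Rightarrow> real) \<Rightarrow> (nat \<Rightarrow> nat \<Rightarrow> real) \<Rightarrow>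
     ((nat \<Rightarrow> nat \<Rightarrow> nat \<Rightarrow> real) \<times> (nat \<Rightarrow> nat)) measure" where
  "rw_ehmm T D N ell p x = select_law T N (noise_law T D N) (ehmm_select T D N ell p x)"

definition Psi :: "nat \<Rightarrow> nat \<Rightarrow> (nat \<Rightarrow> real) \<Rightarrow> real" where
  "Psi N k h = (if k = 0 then exp 0 else exp (h k)) / (1 + (\<Sum>m\<in>{1..N}. exp (h m)))"

definition limit_noise_law ::
  "nat \<Rightarrow> nat \<Rightarrow> (nat \<Rightarrow> real) \<Rightarrow> ((nat \<Rightarrow> real) \<Rightarrow> real) \<Rightarrow> (nat \<Rightarrow> nat \<Rightarrow> real) measure" where
  "limit_noise_law T N ell p =
     (\<Pi>\<^sub>M t\<in>{1..T}. mvnormal {1..N} (\<lambda>_. - (1 / 2) * ell t * fisher T p t)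
                              (\<lambda>i j. ell t * fisher T p t * Sigma_mat i j))"

definition limit_ehmm ::
  "nat \<Rightarrow> nat \<Rightarrow> (nat \<Rightarrow> real) \<Rightarrow> ((nat \<Rightarrow> real) \<Rightarrow> real) \<Rightarrow>
     ((nat \<Rightarrow> nat \<Rightarrow> real) \<times> (nat \<Rightarrow> nat)) measure" where
  "limit_ehmm T N ell p =
     select_law T N (limit_noise_law T N ell p) (\<lambda>V k. \<Prod>t\<in>{1..T}. Psi N (k t) (V t))"

definition accept_prob :: "('w \<times> (nat \<Rightarrow> nat)) measure \<Rightarrow> nat \<Rightarrow> real" where
  "accept_prob Q t = measure Q {z \<in> space Q. snd z t \<noteq> 0}"

definition tv_dist :: "'a measure \<Rightarrow> 'a measure \<Rightarrow> real" where
  "tv_dist M M' = (SUP A\<in>sets M. \<bar>measure M A - measure M' A\<bar>)"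

end

theory Submission
  imports Defs
begin

text \<open>Write \<open>H(l)\<close> for the logarithm of the target density at the path selected by \<open>l\<close>, relative to the
  current state. The selection probabilities are the softmax of \<open>H\<close>, and the softmax is Lipschitz, so
  it suffices to approximate each \<open>H(l)\<close> in \<open>L\<^sup>1\<close>. In a Taylor expansion the linear term is, for fixed
  \<open>x\<close>, exactly Gaussian with covariance \<open>\<ell>\<^sub>t \<Sigma>\<close> times the empirical mean of \<open>[\<partial>\<^sub>t log \<pi>]\<^sup>2\<close> over the
  components, because a linear combination with unit coefficient vector of independent copies of
  \<open>N(0, \<Sigma>)\<close> is again \<open>N(0, \<Sigma>)\<close>. Hence the limiting vector \<open>V\<close> can be realised on the same noise
  space. The quadratic terms concentrate at rate \<open>D\<^sup>-\<^sup>1\<^sup>/\<^sup>2\<close>, and the remainder is of the same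
  order. The sets \<open>F\<close> are those on which the empirical means of \<open>[\<partial>\<^sub>t log \<pi>]\<^sup>2\<close> and \<open>\<partial>\<^sub>t\<^sup>2 log \<pi>\<close>
  are within \<open>D\<^sup>-\<^sup>1\<^sup>/\<^sup>4\<close> of \<open>I\<^sub>t\<close> and \<open>- I\<^sub>t\<close>; Chebyshev's inequality shows that their probability
  tends to \<open>1\<close>. The lower bound is Jensen's inequality combined with the inequality between the
  harmonic and the arithmetic mean.\<close>

section \<open>Product measures\<close>

text \<open>The coefficients of the linear Taylor term are the normalised scores, so the coupled
  Gaussian vector depends on the current state \<open>x\<close> while its law does not; update and
  limit become two expectations on one noise space, and every error is a moment bound whose constant
  is free of \<open>x\<close>. As \<pi>_T is not assumed positive, the derivatives of
  \<open>log_p\<close> are at first meaningful only where \<open>p > 0\<close>, and a Taylor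
  expansion along a path leaving that set would be void; boundedness of the second derivatives of
  the logarithm turns out to exclude zeros. That the diagonal quadratic terms concentrate around
  minus half the variance of the linear term rests on the identity between the mean of
  \<open>hess t t\<close> and \<open>- fisher T p t\<close>, which is derived by integrating the
  second derivative of \<open>p\<close>. The covariance roots are given by a choice operator, so a
  concrete root can be used only after uniqueness. The linear term contains the root of an empirical
  mean whose limit may be 0; the tolerance therefore enters through its square root, and the final
  rate is D^(-1/8).\<close>

lemma measurable_PiM_component2:
  "j \<in> J \<Longrightarrow> i \<in> I \<Longrightarrow> (\<lambda>x. x j i) \<in> measurable (\<Pi>\<^sub>M j\<in>J. \<Pi>\<^sub>M i\<in>I. N j i) (N j i)"
  by (rule measurable_compose[OF measurable_component_singleton[of j J] measurable_component_singleton])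

text \<open>Tonelli by induction on \<open>J\<close>: peeling off row \<open>j\<close> leaves an
  inner integral over all \<open>I\<close>-coordinates of that row, which factors over
  \<open>i\<close>. The partial integrals are again functions of one column each, hence
  \<open>f\<close> is generalised.\<close>

lemma nn_integral_PiM_swap:
  fixes M :: "'a measure" and I :: "'i set" and J :: "'j set"
  assumes M: "sigma_finite_measure M" and I: "finite I" and J: "finite J"
    and f: "\<And>i. i \<in> I \<Longrightarrow> f i \<in> borel_measurable (\<Pi>\<^sub>M j\<in>J. M)"
  shows "(\<integral>\<^sup>+x. (\<Prod>i\<in>I. f i (\<lambda>j\<in>J. x j i)) \<partial>(\<Pi>\<^sub>M j\<in>J. \<Pi>\<^sub>M i\<in>I. M))
    = (\<Prod>i\<in>I. \<integral>\<^sup>+v. f i v \<partial>(\<Pi>\<^sub>M j\<in>J. M))"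
  using J f
proof (induction J arbitrary: f rule: finite_induct)
  case empty
  interpret P: product_sigma_finite "\<lambda>_::'j. M" using M by (simp add: product_sigma_finite_def)
  interpret PI: product_sigma_finite "\<lambda>_::'i. M" using M by (simp add: product_sigma_finite_def)
  interpret Q: product_sigma_finite "\<lambda>_::'j. \<Pi>\<^sub>M i\<in>I. M"
    using PI.sigma_finite[OF I] by (simp add: product_sigma_finite_def)
  show ?case by (simp add: PiM_empty nn_integral_count_space_finite)
next
  case (insert j J)
  interpret P: product_sigma_finite "\<lambda>_::'j. M" using M by (simp add: product_sigma_finite_def)
  interpret PI: product_sigma_finite "\<lambda>_::'i. M" using M by (simp add: product_sigma_finite_def)
  interpret Q: product_sigma_finite "\<lambda>_::'j. \<Pi>\<^sub>M i\<in>I. M"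
    using PI.sigma_finite[OF I] by (simp add: product_sigma_finite_def)
  note insert.prems[measurable]
  have fm: "(\<lambda>(v, y). f i (v(j := y))) \<in> borel_measurable ((\<Pi>\<^sub>M j\<in>J. M) \<Otimes>\<^sub>M M)" if i: "i \<in> I" for i
    using measurable_compose[OF measurable_add_dim insert.prems[OF i]] by (simp add: split_def fun_upd_def)
  have rw: "(\<lambda>k\<in>insert j J. (x(j := y)) k i) = (\<lambda>k\<in>J. x k i)(j := y i)" for x y i
    using insert.hyps by (auto simp: fun_eq_iff)
  have meas: "(\<lambda>x. \<Prod>i\<in>I. f i (\<lambda>k\<in>insert j J. x k i)) \<in> borel_measurable (\<Pi>\<^sub>M j\<in>insert j J. \<Pi>\<^sub>M i\<in>I. M)"
    by (intro borel_measurable_prod_ennreal measurable_compose[OF _ insert.prems]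
          measurable_restrict measurable_PiM_component2)
  have m2: "(\<lambda>y. f i (v(j := y))) \<in> borel_measurable M" if "i \<in> I" "v \<in> space (\<Pi>\<^sub>M j\<in>J. M)" for i v
    using measurable_compose_Pair1[OF that(2) fm[OF that(1)]] by simp
  have "(\<integral>\<^sup>+x. (\<Prod>i\<in>I. f i (\<lambda>j\<in>insert j J. x j i)) \<partial>(\<Pi>\<^sub>M j\<in>insert j J. \<Pi>\<^sub>M i\<in>I. M))
     = (\<integral>\<^sup>+x. (\<integral>\<^sup>+y. (\<Prod>i\<in>I. f i ((\<lambda>k\<in>J. x k i)(j := y i))) \<partial>(\<Pi>\<^sub>M i\<in>I. M)) \<partial>(\<Pi>\<^sub>M j\<in>J. \<Pi>\<^sub>M i\<in>I. M))"
    by (subst Q.product_nn_integral_insert[OF insert.hyps meas]) (simp only: rw)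
  also have "\<dots> = (\<integral>\<^sup>+x. (\<Prod>i\<in>I. \<integral>\<^sup>+y. f i ((\<lambda>k\<in>J. x k i)(j := y)) \<partial>M) \<partial>(\<Pi>\<^sub>M j\<in>J. \<Pi>\<^sub>M i\<in>I. M))"
    by (intro nn_integral_cong PI.product_nn_integral_prod I m2) (auto simp: space_PiM PiE_iff)
  also have "\<dots> = (\<Prod>i\<in>I. \<integral>\<^sup>+v. (\<integral>\<^sup>+y. f i (v(j := y)) \<partial>M) \<partial>(\<Pi>\<^sub>M j\<in>J. M))"
    by (rule insert.IH) (intro sigma_finite_measure.borel_measurable_nn_integral[OF M] fm)
  also have "\<dots> = (\<Prod>i\<in>I. \<integral>\<^sup>+v. f i v \<partial>(\<Pi>\<^sub>M j\<in>insert j J. M))"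
    using insert.prems by (intro prod.cong refl P.product_nn_integral_insert[symmetric] insert.hyps) auto
  finally show ?case .
qed

text \<open>Equality is tested on boxes, whose indicator is a product of functions of single
  columns. Transposition is what presents target and noise, indexed by time and then component, as
  independent copies over the components; in Gaussian sums it exchanges the roles of copy and
  entry.\<close>

lemma distr_PiM_swap:
  fixes M :: "'a measure" and I :: "'i set" and J :: "'j set"
  assumes M: "sigma_finite_measure M" and I: "finite I" and J: "finite J"
  shows "distr (\<Pi>\<^sub>M j\<in>J. \<Pi>\<^sub>M i\<in>I. M) (\<Pi>\<^sub>M i\<in>I. \<Pi>\<^sub>M j\<in>J. M) (\<lambda>x. \<lambda>i\<in>I. \<lambda>j\<in>J. x j i)
    = (\<Pi>\<^sub>M i\<in>I. \<Pi>\<^sub>M j\<in>J. M)"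
proof -
  interpret P: product_sigma_finite "\<lambda>_::'j. M" using M by (simp add: product_sigma_finite_def)
  interpret Q: product_sigma_finite "\<lambda>_::'i. \<Pi>\<^sub>M j\<in>J. M"
    using P.sigma_finite[OF J] by (simp add: product_sigma_finite_def)
  let ?N = "\<Pi>\<^sub>M j\<in>J. \<Pi>\<^sub>M i\<in>I. M"
  let ?sw = "\<lambda>x. \<lambda>i\<in>I. \<lambda>j\<in>J. x j i"
  have sw[measurable]: "?sw \<in> measurable ?N (\<Pi>\<^sub>M i\<in>I. \<Pi>\<^sub>M j\<in>J. M)"
    by (intro measurable_restrict measurable_PiM_component2)
  show ?thesis
  proof (rule Q.PiM_eqI[OF I])
    fix A assume A: "\<And>i. i \<in> I \<Longrightarrow> A i \<in> sets (\<Pi>\<^sub>M j\<in>J. M)"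
    have "emeasure (distr ?N (\<Pi>\<^sub>M i\<in>I. \<Pi>\<^sub>M j\<in>J. M) ?sw) (Pi\<^sub>E I A)
      = (\<integral>\<^sup>+x. indicator (Pi\<^sub>E I A) (?sw x) \<partial>?N)"
    proof -
      have PA[measurable]: "Pi\<^sub>E I A \<in> sets (\<Pi>\<^sub>M i\<in>I. \<Pi>\<^sub>M j\<in>J. M)"
        using A I by (intro sets_PiM_I_finite) auto
      have "emeasure (distr ?N (\<Pi>\<^sub>M i\<in>I. \<Pi>\<^sub>M j\<in>J. M) ?sw) (Pi\<^sub>E I A)
        = (\<integral>\<^sup>+z. indicator (Pi\<^sub>E I A) z \<partial>distr ?N (\<Pi>\<^sub>M i\<in>I. \<Pi>\<^sub>M j\<in>J. M) ?sw)"
        using PA by simp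
      also have "\<dots> = (\<integral>\<^sup>+x. indicator (Pi\<^sub>E I A) (?sw x) \<partial>?N)"
        by (rule nn_integral_distr[OF sw]) measurable
      finally show ?thesis .
    qed
    also have "\<dots> = (\<integral>\<^sup>+x. (\<Prod>i\<in>I. indicator (A i) (\<lambda>j\<in>J. x j i)) \<partial>?N)"
      by (intro nn_integral_cong) (auto simp: indicator_def PiE_iff I prod_zero_iff intro!: prod.neutral)
    also have "\<dots> = (\<Prod>i\<in>I. \<integral>\<^sup>+v. indicator (A i) v \<partial>(\<Pi>\<^sub>M j\<in>J. M))"
      using A by (intro nn_integral_PiM_swap M I J) auto
    also have "\<dots> = (\<Prod>i\<in>I. emeasure (\<Pi>\<^sub>M j\<in>J. M) (A i))"
      using A by (intro prod.cong) auto
    finally show "emeasure (distr ?N (\<Pi>\<^sub>M i\<in>I. \<Pi>\<^sub>M j\<in>J. M) ?sw) (Pi\<^sub>E I A)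
       = (\<Prod>i\<in>I. emeasure (\<Pi>\<^sub>M j\<in>J. M) (A i))" .
  qed simp
qed

lemma PiM_density:
  assumes M: "sigma_finite_measure M" and J: "finite J"
    and f[measurable]: "f \<in> borel_measurable M" and D: "sigma_finite_measure (density M f)"
  shows "(\<Pi>\<^sub>M j\<in>J. density M f) = density (\<Pi>\<^sub>M j\<in>J. M) (\<lambda>x. \<Prod>j\<in>J. f (x j))"
proof -
  interpret P: product_sigma_finite "\<lambda>_. M" using M by (simp add: product_sigma_finite_def)
  interpret Q: product_sigma_finite "\<lambda>_. density M f" using D by (simp add: product_sigma_finite_def)
  show ?thesis
  proof (rule Q.PiM_eqI[OF J, symmetric])
    fix A assume A: "\<And>i. i \<in> J \<Longrightarrow> A i \<in> sets (density M f)"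
    have "emeasure (density (\<Pi>\<^sub>M j\<in>J. M) (\<lambda>x. \<Prod>j\<in>J. f (x j))) (Pi\<^sub>E J A)
      = (\<integral>\<^sup>+x. (\<Prod>j\<in>J. f (x j)) * indicator (Pi\<^sub>E J A) x \<partial>(\<Pi>\<^sub>M j\<in>J. M))"
      using A J by (subst emeasure_density) (auto intro!: sets_PiM_I_finite borel_measurable_prod_ennreal)
    also have "\<dots> = (\<integral>\<^sup>+x. (\<Prod>j\<in>J. f (x j) * indicator (A j) (x j)) \<partial>(\<Pi>\<^sub>M j\<in>J. M))"
    proof (intro nn_integral_cong)
      fix x assume "x \<in> space (\<Pi>\<^sub>M j\<in>J. M)"
      then have "x \<in> extensional J" by (auto simp: space_PiM PiE_iff)
      then have "(indicator (Pi\<^sub>E J A) x :: ennreal) = (\<Prod>j\<in>J. indicator (A j) (x j))"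
        by (auto simp: indicator_def PiE_iff J prod_zero_iff intro!: prod.neutral)
      then show "(\<Prod>j\<in>J. f (x j)) * indicator (Pi\<^sub>E J A) x = (\<Prod>j\<in>J. f (x j) * indicator (A j) (x j))"
        by (simp add: prod.distrib)
    qed
    also have "\<dots> = (\<Prod>j\<in>J. \<integral>\<^sup>+x. f x * indicator (A j) x \<partial>M)"
      using A by (intro P.product_nn_integral_prod J) auto
    also have "\<dots> = (\<Prod>j\<in>J. emeasure (density M f) (A j))"
      using A by (intro prod.cong) (auto simp: emeasure_density)
    finally show "emeasure (density (\<Pi>\<^sub>M j\<in>J. M) (\<lambda>x. \<Prod>j\<in>J. f (x j))) (Pi\<^sub>E J A)
      = (\<Prod>j\<in>J. emeasure (density M f) (A j))" .
  qed (simp cong: sets_PiM_cong)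
qed

lemma distr_PiM_componentwise:
  assumes I: "finite I" and M: "\<And>i. prob_space (M i)"
    and f[measurable]: "\<And>i. f i \<in> measurable (M i) (M' i)"
  shows "distr (PiM I M) (PiM I M') (\<lambda>x. \<lambda>i\<in>I. f i (x i)) = PiM I (\<lambda>i. distr (M i) (M' i) (f i))"
proof -
  interpret P: product_sigma_finite M
    using M by (simp add: product_sigma_finite_def prob_space_imp_sigma_finite)
  interpret Q: product_sigma_finite "\<lambda>i. distr (M i) (M' i) (f i)"
    using M f by (auto simp: product_sigma_finite_def intro!: prob_space_imp_sigma_finite prob_space.prob_space_distr)
  show ?thesis
  proof (rule Q.PiM_eqI[OF I])
    fix A assume "\<And>i. i \<in> I \<Longrightarrow> A i \<in> sets (distr (M i) (M' i) (f i))"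
    then have A: "\<And>i. i \<in> I \<Longrightarrow> A i \<in> sets (M' i)" by simp
    have fs: "f i (x i) \<in> space (M' i)" if "x \<in> space (PiM I M)" "i \<in> I" for x i
      using that measurable_space[OF f] by (auto simp: space_PiM)
    have "emeasure (distr (PiM I M) (PiM I M') (\<lambda>x. \<lambda>i\<in>I. f i (x i))) (Pi\<^sub>E I A)
      = emeasure (PiM I M) ((\<lambda>x. \<lambda>i\<in>I. f i (x i)) -` Pi\<^sub>E I A \<inter> space (PiM I M))"
      using A I by (intro emeasure_distr) (auto intro: sets_PiM_I_finite)
    also have "(\<lambda>x. \<lambda>i\<in>I. f i (x i)) -` Pi\<^sub>E I A \<inter> space (PiM I M) = (\<Pi>\<^sub>E i\<in>I. f i -` A i \<inter> space (M i))"
      by (auto simp: space_PiM PiE_iff)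
    also have "emeasure (PiM I M) \<dots> = (\<Prod>i\<in>I. emeasure (M i) (f i -` A i \<inter> space (M i)))"
      using A by (intro P.emeasure_PiM I) (auto intro: measurable_sets[OF f])
    also have "\<dots> = (\<Prod>i\<in>I. emeasure (distr (M i) (M' i) (f i)) (A i))"
      using A by (intro prod.cong) (auto simp: emeasure_distr)
    finally show "emeasure (distr (PiM I M) (PiM I M') (\<lambda>x. \<lambda>i\<in>I. f i (x i))) (Pi\<^sub>E I A)
      = (\<Prod>i\<in>I. emeasure (distr (M i) (M' i) (f i)) (A i))" .
  qed (simp cong: sets_PiM_cong)
qed

section \<open>Moments of functions of independent coordinates\<close>

lemma integral_PiM_component:
  fixes g :: "'a \<Rightarrow> real"
  assumes M: "\<And>i. prob_space (M i)" and i: "i \<in> I" and g: "g \<in> borel_measurable (M i)"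
  shows "(\<integral>x. g (x i) \<partial>PiM I M) = (\<integral>x. g x \<partial>M i)"
    and "integrable (PiM I M) (\<lambda>x. g (x i)) \<longleftrightarrow> integrable (M i) g"
proof -
  have d: "distr (PiM I M) (M i) (\<lambda>x. x i) = M i" by (rule distr_PiM_component[OF M i])
  have m: "(\<lambda>x. x i) \<in> measurable (PiM I M) (M i)" using i by measurable
  show "(\<integral>x. g (x i) \<partial>PiM I M) = (\<integral>x. g x \<partial>M i)"
    using integral_distr[OF m g] by (simp add: d)
  show "integrable (PiM I M) (\<lambda>x. g (x i)) \<longleftrightarrow> integrable (M i) g"
    using integrable_distr_eq[OF m g] by (simp add: d)
qed

text \<open>Expanding the square gives terms \<open>f i * f j\<close>; each is written as a product
  over all coordinates so that the product form of Fubini's theorem applies. Off the diagonal one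
  factor is a vanishing mean.\<close>

lemma PiM_centered_sum_second_moment:
  fixes f :: "'i \<Rightarrow> 'a \<Rightarrow> real"
  assumes J: "finite J" and M: "\<And>i. prob_space (M i)"
    and int: "\<And>i. i \<in> J \<Longrightarrow> integrable (M i) (f i)"
    and int2: "\<And>i. i \<in> J \<Longrightarrow> integrable (M i) (\<lambda>x. (f i x)\<^sup>2)"
    and mean: "\<And>i. i \<in> J \<Longrightarrow> (\<integral>x. f i x \<partial>M i) = 0"
  shows "integrable (PiM J M) (\<lambda>x. (\<Sum>i\<in>J. f i (x i))\<^sup>2)"
    and "(\<integral>x. (\<Sum>i\<in>J. f i (x i))\<^sup>2 \<partial>PiM J M) = (\<Sum>i\<in>J. \<integral>x. (f i x)\<^sup>2 \<partial>M i)"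
proof -
  interpret product_sigma_finite M
    using M by (simp add: product_sigma_finite_def prob_space_imp_sigma_finite)
  \<comment> \<open>\<open>\<phi> i j k\<close> is what coordinate \<open>k\<close> contributes to
    \<open>f i * f j\<close>: the square if \<open>i = j = k\<close>, the constant 1 if
    \<open>k\<close> is neither index.\<close>
  define \<phi> where "\<phi> i j k x = (if k = i then f i x else 1) * (if k = j then f j x else 1)" for i j k x
  have \<phi>int: "integrable (M k) (\<phi> i j k)" if "i \<in> J" "j \<in> J" for i j k
  proof -
    interpret prob_space "M k" by (rule M)
    show ?thesis using that int int2
      unfolding \<phi>_def[abs_def] by (cases "k = i"; cases "k = j") (auto simp: power2_eq_square)
  qed
  have rw: "(\<Sum>i\<in>J. f i (x i))\<^sup>2 = (\<Sum>i\<in>J. \<Sum>j\<in>J. \<Prod>k\<in>J. \<phi> i j k (x k))" for x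
    using J by (simp add: power2_eq_square sum_product \<phi>_def prod.distrib prod.delta)
  show "integrable (PiM J M) (\<lambda>x. (\<Sum>i\<in>J. f i (x i))\<^sup>2)"
    unfolding rw by (intro Bochner_Integration.integrable_sum product_integrable_prod J \<phi>int)
  have "(\<integral>x. (\<Sum>i\<in>J. f i (x i))\<^sup>2 \<partial>PiM J M) = (\<Sum>i\<in>J. \<Sum>j\<in>J. \<integral>x. (\<Prod>k\<in>J. \<phi> i j k (x k)) \<partial>PiM J M)"
    unfolding rw
    by (subst Bochner_Integration.integral_sum;
        intro Bochner_Integration.integrable_sum product_integrable_prod J \<phi>int sum.cong refl Bochner_Integration.integral_sum; assumption)
  also have "\<dots> = (\<Sum>i\<in>J. \<Sum>j\<in>J. \<Prod>k\<in>J. \<integral>x. \<phi> i j k x \<partial>M k)"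
    by (intro sum.cong refl product_integral_prod J \<phi>int)
  also have "\<dots> = (\<Sum>i\<in>J. \<Sum>j\<in>J. if j = i then \<integral>x. (f i x)\<^sup>2 \<partial>M i else 0)"
  proof (intro sum.cong refl)
    fix i j assume ij: "i \<in> J" "j \<in> J"
    show "(\<Prod>k\<in>J. \<integral>x. \<phi> i j k x \<partial>M k) = (if j = i then \<integral>x. (f i x)\<^sup>2 \<partial>M i else 0)"
    proof (cases "j = i")
      case True
      have "(\<Prod>k\<in>J. \<integral>x. \<phi> i j k x \<partial>M k) = (\<Prod>k\<in>J. if k = i then \<integral>x. (f i x)\<^sup>2 \<partial>M i else 1)"
        by (intro prod.cong refl) (simp add: \<phi>_def True power2_eq_square prob_space.prob_space[OF M])
      then show ?thesis using J ij True by simp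
    next
      case False
      have "(\<integral>x. \<phi> i j i x \<partial>M i) = 0" using False mean[OF ij(1)] by (simp add: \<phi>_def)
      then show ?thesis using ij J False by (auto simp: prod_zero_iff)
    qed
  qed
  also have "\<dots> = (\<Sum>i\<in>J. \<integral>x. (f i x)\<^sup>2 \<partial>M i)"
    using J by simp
  finally show "(\<integral>x. (\<Sum>i\<in>J. f i (x i))\<^sup>2 \<partial>PiM J M) = (\<Sum>i\<in>J. \<integral>x. (f i x)\<^sup>2 \<partial>M i)" .
qed

text \<open>Nonnegativity of the variance of \<open>|X|\<close>.\<close>

lemma (in prob_space) expectation_abs_le_sqrt:
  fixes X :: "'a \<Rightarrow> real"
  assumes [measurable]: "X \<in> borel_measurable M" and "integrable M (\<lambda>x. (X x)\<^sup>2)"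
  shows "integrable M X" and "expectation (\<lambda>x. \<bar>X x\<bar>) \<le> sqrt (expectation (\<lambda>x. (X x)\<^sup>2))"
proof -
  show I: "integrable M X" by (rule square_integrable_imp_integrable[OF assms])
  have "0 \<le> variance (\<lambda>x. \<bar>X x\<bar>)" by (rule variance_positive)
  also have "variance (\<lambda>x. \<bar>X x\<bar>) = expectation (\<lambda>x. (X x)\<^sup>2) - (expectation (\<lambda>x. \<bar>X x\<bar>))\<^sup>2"
    using I assms by (subst variance_eq) auto
  finally show "expectation (\<lambda>x. \<bar>X x\<bar>) \<le> sqrt (expectation (\<lambda>x. (X x)\<^sup>2))"
    by (intro real_le_rsqrt) auto
qed

lemma measurable_PiM_map:
  assumes "\<And>j. j \<in> J \<Longrightarrow> f j \<in> measurable (M j) (N j)"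
  shows "(\<lambda>x. \<lambda>j\<in>J. f j (x j)) \<in> measurable (PiM J M) (PiM J N)"
proof (rule measurable_restrict)
  fix j assume j: "j \<in> J"
  show "(\<lambda>x. f j (x j)) \<in> measurable (PiM J M) (N j)"
    by (rule measurable_compose[OF measurable_component_singleton[OF j, where M=M] assms[OF j]])
qed


section \<open>Square roots of covariance matrices\<close>

definition trace3 ::
  "'i set \<Rightarrow> ('i \<Rightarrow> 'i \<Rightarrow> real) \<Rightarrow> ('i \<Rightarrow> 'i \<Rightarrow> real) \<Rightarrow> ('i \<Rightarrow> 'i \<Rightarrow> real) \<Rightarrow> real" where
  "trace3 I X Y Z = (\<Sum>i\<in>I. \<Sum>j\<in>I. \<Sum>k\<in>I. X i j * Y j k * Z k i)"

lemma trace3_rotate: "trace3 I X Y Z = trace3 I Y Z X"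
proof -
  have "trace3 I X Y Z = (\<Sum>j\<in>I. \<Sum>i\<in>I. \<Sum>k\<in>I. X i j * Y j k * Z k i)"
    unfolding trace3_def by (rule sum.swap)
  also have "\<dots> = (\<Sum>j\<in>I. \<Sum>k\<in>I. \<Sum>i\<in>I. X i j * Y j k * Z k i)"
    by (intro sum.cong refl sum.swap)
  finally show ?thesis by (simp add: trace3_def ac_simps)
qed

text \<open>The trace sees the first two factors only through their product, so two roots of the
  same matrix are interchangeable there.\<close>

lemma trace3_cong_square:
  assumes "\<And>i j. i \<in> I \<Longrightarrow> j \<in> I \<Longrightarrow> (\<Sum>k\<in>I. B i k * B k j) = (\<Sum>k\<in>I. C i k * C k j)"
  shows "trace3 I B B X = trace3 I C C X"
proof -
  have "trace3 I A A X = (\<Sum>i\<in>I. \<Sum>k\<in>I. (\<Sum>j\<in>I. A i j * A j k) * X k i)" for A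
  proof -
    have "trace3 I A A X = (\<Sum>i\<in>I. \<Sum>k\<in>I. \<Sum>j\<in>I. A i j * A j k * X k i)"
      unfolding trace3_def by (intro sum.cong refl sum.swap)
    then show ?thesis by (simp add: sum_distrib_right)
  qed
  with assms show ?thesis by simp
qed

lemma trace3_diff:
  "trace3 I (\<lambda>i j. B i j - C i j) Y (\<lambda>i j. B i j - C i j)
    = trace3 I B Y B - trace3 I B Y C - trace3 I C Y B + trace3 I C Y C"
  by (simp add: trace3_def algebra_simps sum.distrib sum_subtractf)

text \<open>With \<open>\<Delta> = B - C\<close>, cyclicity of the trace gives \<open>tr (\<Delta> B \<Delta>) + tr (\<Delta> C \<Delta>) = tr ((B\<^sup>2 - C\<^sup>2) \<Delta>) = 0\<close>, where both
  summands are nonnegative.\<close>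

lemma psd_root_unique:
  assumes I: "finite I" and B: "psd_on I B" and C: "psd_on I C"
    and pd: "\<And>v i. (\<Sum>i\<in>I. \<Sum>j\<in>I. v i * C i j * v j) = 0 \<Longrightarrow> i \<in> I \<Longrightarrow> v i = 0"
    and sq: "\<And>i j. i \<in> I \<Longrightarrow> j \<in> I \<Longrightarrow> (\<Sum>k\<in>I. B i k * B k j) = (\<Sum>k\<in>I. C i k * C k j)"
    and ij: "i \<in> I" "j \<in> I"
  shows "B i j = C i j"
proof -
  define \<Delta> where "\<Delta> i j = B i j - C i j" for i j
  have sym: "\<Delta> i j = \<Delta> j i" if "i \<in> I" "j \<in> I" for i j
    using B C that by (auto simp: psd_on_def \<Delta>_def)
  define q where "q Y i = (\<Sum>j\<in>I. \<Sum>k\<in>I. \<Delta> i j * Y j k * \<Delta> i k)" for Y i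
  have q: "trace3 I \<Delta> Y \<Delta> = (\<Sum>i\<in>I. q Y i)" for Y
    unfolding trace3_def q_def using sym by (intro sum.cong refl) simp
  have nn: "0 \<le> q B i" "0 \<le> q C i" for i
    using B C by (simp_all add: psd_on_def q_def)
  note s = trace3_cong_square[OF sq]
  have "trace3 I \<Delta> B \<Delta> + trace3 I \<Delta> C \<Delta> = 0"
    unfolding \<Delta>_def[abs_def] trace3_diff
    using s[of B] s[of C] trace3_rotate[of I C B B] trace3_rotate[of I B C B] trace3_rotate[of I C B C]
      trace3_rotate[of I B C C]
    by simp
  then have "(\<Sum>i\<in>I. q B i + q C i) = 0" by (simp add: q sum.distrib)
  then have "q B i + q C i = 0"
    using nn ij I by (subst (asm) sum_nonneg_eq_0_iff) (auto intro: add_nonneg_nonneg)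
  \<comment> \<open>\<open>q C i\<close> is the quadratic form of \<open>C\<close> at row
    \<open>i\<close> of the difference. Definiteness is thus asked of \<open>C\<close> alone, and
    \<open>B\<close> may be whichever root the choice operator returns.\<close>
  then have "q C i = 0" using nn[of i] by linarith
  then have "\<Delta> i j = 0" using pd[of "\<Delta> i" j] ij by (simp add: q_def)
  then show ?thesis by (simp add: \<Delta>_def)
qed

text \<open>The square root of \<open>\<Sigma> = (I\<^sub>N + 1\<^sub>N 1\<^sub>N\<^sup>T) / 2\<close> is sought in the form \<open>a I\<^sub>N + b 1\<^sub>N 1\<^sub>N\<^sup>T\<close>, which leads to
  \<open>2 a\<^sup>2 = 1\<close> and \<open>2 a b + N b\<^sup>2 = 1/2\<close>.\<close>

definition Sigma_root :: "nat \<Rightarrow> nat \<Rightarrow> nat \<Rightarrow> real" where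
  "Sigma_root N i j = (if i = j then sqrt (1/2) else 0) + (sqrt ((real N + 1) / 2) - sqrt (1/2)) / real N"

lemma Sigma_root_square:
  assumes "i \<in> {1..N}" "j \<in> {1..N}"
  shows "(\<Sum>k\<in>{1..N}. Sigma_root N i k * Sigma_root N k j) = Sigma_mat i j"
proof -
  define a where "a = sqrt (1/2 :: real)"
  define b where "b = (sqrt ((real N + 1) / 2) - a) / real N"
  have N: "real N > 0" using assms by auto
  have a2: "a * a = 1/2" by (simp add: a_def)
  have Nb: "real N * b = sqrt ((real N + 1) / 2) - a" using N by (simp add: b_def)
  \<comment> \<open>\<open>a + N b\<close> is the eigenvalue of the root on the all-ones vector; its
    square \<open>(N + 1) / 2\<close> is the eigenvalue of the covariance there. Cancelling
    \<open>N\<close> leaves the equation for the off-diagonal entries.\<close>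
  have "(real N * b + a) * (real N * b + a) = (real N + 1) / 2" unfolding Nb by simp
  then have "real N * (2 * a * b + real N * b * b) = real N * (1/2)"
    using a2 by (simp add: algebra_simps)
  then have ab: "2 * a * b + real N * b * b = 1/2"
    using N mult_left_cancel[of "real N"] by auto
  have "(\<Sum>k\<in>{1..N}. Sigma_root N i k * Sigma_root N k j)
    = (\<Sum>k\<in>{1..N}. (if k = i then (if i = j then a * a else 0) else 0) + (if k = i then a * b else 0)
        + (if k = j then a * b else 0) + b * b)"
    unfolding Sigma_root_def a_def[symmetric] b_def[symmetric]
    by (intro sum.cong refl) (auto simp: algebra_simps)
  also have "\<dots> = (if i = j then a * a else 0) + (2 * a * b + real N * b * b)"
    using assms by (simp add: sum.distrib)
  also have "\<dots> = Sigma_mat i j"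
    by (simp add: ab a2 Sigma_mat_def)
  finally show ?thesis .
qed

text \<open>The form is \<open>a\<close> times the squared norm plus \<open>b\<close> times the
  squared sum, with \<open>b\<close> nonnegative and \<open>a = sqrt (1/2)\<close> at least 1/2. Any
  positive constant would do: the bound supplies the definiteness behind uniqueness of the
  root.\<close>

lemma Sigma_root_form:
  assumes "N \<ge> 1"
  shows "(1/2) * (\<Sum>i\<in>{1..N}. (v i)\<^sup>2) \<le> (\<Sum>i\<in>{1..N}. \<Sum>j\<in>{1..N}. v i * Sigma_root N i j * v j)"
proof -
  define a where "a = sqrt (1/2 :: real)"
  define b where "b = (sqrt ((real N + 1) / 2) - a) / real N"
  have b: "0 \<le> b" unfolding b_def a_def by (intro divide_nonneg_nonneg) auto
  have a: "1/2 \<le> a" unfolding a_def by (rule real_le_rsqrt) (simp add: power2_eq_square)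
  have "(\<Sum>i\<in>{1..N}. \<Sum>j\<in>{1..N}. v i * Sigma_root N i j * v j)
    = (\<Sum>i\<in>{1..N}. \<Sum>j\<in>{1..N}. (if j = i then a * (v i)\<^sup>2 else 0) + b * (v i * v j))"
    unfolding Sigma_root_def a_def[symmetric] b_def[symmetric]
    by (intro sum.cong refl) (auto simp: algebra_simps power2_eq_square)
  also have "\<dots> = a * (\<Sum>i\<in>{1..N}. (v i)\<^sup>2) + b * (\<Sum>i\<in>{1..N}. v i)\<^sup>2"
  proof -
    have "(\<Sum>i\<in>{1..N}. v i)\<^sup>2 = (\<Sum>i\<in>{1..N}. \<Sum>j\<in>{1..N}. v i * v j)"
      by (simp add: power2_eq_square sum_product)
    then show ?thesis by (simp add: sum.distrib sum_distrib_left)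
  qed
  finally have "(\<Sum>i\<in>{1..N}. \<Sum>j\<in>{1..N}. v i * Sigma_root N i j * v j)
    = a * (\<Sum>i\<in>{1..N}. (v i)\<^sup>2) + b * (\<Sum>i\<in>{1..N}. v i)\<^sup>2" .
  moreover have "(1/2) * (\<Sum>i\<in>{1..N}. (v i)\<^sup>2) \<le> a * (\<Sum>i\<in>{1..N}. (v i)\<^sup>2)"
    by (intro mult_right_mono a sum_nonneg) auto
  moreover have "0 \<le> b * (\<Sum>i\<in>{1..N}. v i)\<^sup>2" using b by simp
  ultimately show ?thesis by linarith
qed

text \<open>\<open>psd_sqrt\<close> is a choice among roots, so its value can be identified only
  through uniqueness. The scaled explicit root is definite for \<open>c > 0\<close>;
  \<open>c = 0\<close>, which a vanishing Fisher information produces, is treated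
  separately.\<close>

lemma psd_sqrt_scaled_Sigma:
  assumes N: "N \<ge> 1" and c: "0 \<le> c" and ij: "i \<in> {1..N}" "j \<in> {1..N}"
  shows "psd_sqrt {1..N} (\<lambda>i j. c * Sigma_mat i j) i j = sqrt c * Sigma_root N i j"
proof -
  let ?C = "\<lambda>i j. sqrt c * Sigma_root N i j" and ?I = "{1..N}"
  have form: "(\<Sum>i\<in>?I. \<Sum>j\<in>?I. v i * ?C i j * v j)
      = sqrt c * (\<Sum>i\<in>?I. \<Sum>j\<in>?I. v i * Sigma_root N i j * v j)" for v
    by (simp add: sum_distrib_left algebra_simps)
  have "0 \<le> (\<Sum>i\<in>?I. \<Sum>j\<in>?I. v i * ?C i j * v j)" for v
  proof -
    have "0 \<le> (1/2) * (\<Sum>i\<in>?I. (v i)\<^sup>2)" by (simp add: sum_nonneg)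
    also note Sigma_root_form[OF N, of v]
    finally show ?thesis unfolding form using c by (intro mult_nonneg_nonneg) auto
  qed
  then have psd: "psd_on ?I ?C"
    by (auto simp: psd_on_def Sigma_root_def)
  have sqC: "(\<Sum>k\<in>?I. ?C i k * ?C k j) = c * Sigma_mat i j" if "i \<in> ?I" "j \<in> ?I" for i j
  proof -
    have "(\<Sum>k\<in>?I. ?C i k * ?C k j) = (sqrt c * sqrt c) * (\<Sum>k\<in>?I. Sigma_root N i k * Sigma_root N k j)"
      by (simp only: sum_distrib_left ac_simps)
    then show ?thesis using c Sigma_root_square[OF that] by simp
  qed
  define B where "B = psd_sqrt ?I (\<lambda>i j. c * Sigma_mat i j)"
  have "psd_on ?I B \<and> (\<forall>i\<in>?I. \<forall>j\<in>?I. (\<Sum>k\<in>?I. B i k * B k j) = c * Sigma_mat i j)"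
    unfolding B_def psd_sqrt_def by (rule someI[of _ ?C]) (use psd sqC in auto)
  then have B: "psd_on ?I B" "\<And>i j. i \<in> ?I \<Longrightarrow> j \<in> ?I \<Longrightarrow> (\<Sum>k\<in>?I. B i k * B k j) = c * Sigma_mat i j"
    by auto
  have "B i j = ?C i j"
  proof (cases "c = 0")
    case True
    \<comment> \<open>By symmetry of \<open>B\<close>, a diagonal entry of its square is the sum of
      squares of a row; for \<open>c = 0\<close> it vanishes.\<close>
    have "(\<Sum>k\<in>?I. (B i k)\<^sup>2) = (\<Sum>k\<in>?I. B i k * B k i)"
      using B(1) ij by (intro sum.cong refl) (auto simp: psd_on_def power2_eq_square)
    then have "(\<Sum>k\<in>?I. (B i k)\<^sup>2) = 0"
      using B(2)[OF ij(1) ij(1)] True by simp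
    then have "B i j = 0"
      using ij by (subst (asm) sum_nonneg_eq_0_iff) auto
    then show ?thesis using True by simp
  next
    case False
    show ?thesis
    proof (rule psd_root_unique[OF _ B(1) psd])
      fix v :: "nat \<Rightarrow> real" and i
      assume "(\<Sum>i\<in>?I. \<Sum>j\<in>?I. v i * ?C i j * v j) = 0" and i: "i \<in> ?I"
      then have "(\<Sum>i\<in>?I. \<Sum>j\<in>?I. v i * Sigma_root N i j * v j) = 0"
        using False unfolding form by simp
      then have "(\<Sum>i\<in>?I. (v i)\<^sup>2) = 0"
        using Sigma_root_form[OF N, of v] sum_nonneg[of ?I "\<lambda>i. (v i)\<^sup>2"] by simp
      then show "v i = 0"
        using i by (subst (asm) sum_nonneg_eq_0_iff) auto
    qed (use B sqC ij in auto)
  qed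
  then show ?thesis by (simp add: B_def)
qed


section \<open>Gaussian vectors\<close>

abbreviation std_normal :: "real measure" where
  "std_normal \<equiv> density lborel (\<lambda>w. ennreal (std_normal_density w))"

lemma prob_space_std_normal: "prob_space std_normal"
  by (rule prob_space_normal_density) simp

lemma distr_weighted_sum_std_normal:
  assumes J: "finite J" and a: "(\<Sum>j\<in>J. (a j)\<^sup>2) = (1::real)"
  shows "distr (\<Pi>\<^sub>M j\<in>J. std_normal) borel (\<lambda>w. \<Sum>j\<in>J. a j * w j) = std_normal"
proof -
  \<comment> \<open>Zero coefficients are dropped: the zero multiple of a normal variable has no
    density, so the addition theorem for normal densities does not apply to it.\<close>
  define K where "K = {j\<in>J. a j \<noteq> 0}"
  have K: "finite K" "K \<subseteq> J" using J by (auto simp: K_def)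
  have sK: "(\<Sum>j\<in>J. a j * w j) = (\<Sum>j\<in>K. a j * w j)" for w
    unfolding K_def by (intro sum.mono_neutral_right J) auto
  have sK2: "(\<Sum>j\<in>K. (a j)\<^sup>2) = 1"
    unfolding K_def a[symmetric] by (intro sum.mono_neutral_left J) auto
  then have Kne: "K \<noteq> {}" by auto
  then have Jne: "J \<noteq> {}" using K by auto
  interpret P: prob_space "\<Pi>\<^sub>M j\<in>J. std_normal" by (intro prob_space_PiM prob_space_std_normal)
  have comp: "distr (\<Pi>\<^sub>M j\<in>J. std_normal) std_normal (\<lambda>w. w j) = std_normal" if "j \<in> J" for j
    using that by (intro distr_PiM_component prob_space_std_normal)
  have m: "(\<lambda>w. w j) \<in> measurable (\<Pi>\<^sub>M j\<in>J. std_normal) std_normal" if "j \<in> J" for j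
    using that by (rule measurable_component_singleton)
  have "P.indep_vars (\<lambda>_. std_normal) (\<lambda>j w. w j) J"
  proof (subst P.indep_vars_iff_distr_eq_PiM'[OF Jne m])
    have "distr (\<Pi>\<^sub>M j\<in>J. std_normal) (\<Pi>\<^sub>M j\<in>J. std_normal) (\<lambda>w. \<lambda>j\<in>J. w j)
      = distr (\<Pi>\<^sub>M j\<in>J. std_normal) (\<Pi>\<^sub>M j\<in>J. std_normal) (\<lambda>w. w)"
      by (intro distr_cong) (auto simp: space_PiM PiE_iff extensional_restrict)
    also have "\<dots> = (\<Pi>\<^sub>M j\<in>J. distr (\<Pi>\<^sub>M j\<in>J. std_normal) std_normal (\<lambda>w. w j))"
      by (auto intro!: PiM_cong simp: comp)
    finally show "distr (\<Pi>\<^sub>M j\<in>J. std_normal) (\<Pi>\<^sub>M j\<in>J. std_normal) (\<lambda>w. \<lambda>j\<in>J. w j)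
      = (\<Pi>\<^sub>M j\<in>J. distr (\<Pi>\<^sub>M j\<in>J. std_normal) std_normal (\<lambda>w. w j))" .
  qed
  then have "P.indep_vars (\<lambda>_. borel) (\<lambda>j w. a j * w j) J"
    by (rule P.indep_vars_compose2) simp
  then have ind: "P.indep_vars (\<lambda>_. borel) (\<lambda>j w. a j * w j) K"
    by (rule P.indep_vars_subset) (rule K)
  have d: "distributed (\<Pi>\<^sub>M j\<in>J. std_normal) lborel (\<lambda>w. a j * w j) (normal_density 0 \<bar>a j\<bar>)" if "j \<in> K" for j
  proof -
    have "distr (\<Pi>\<^sub>M j\<in>J. std_normal) lborel (\<lambda>w. w j) = distr (\<Pi>\<^sub>M j\<in>J. std_normal) std_normal (\<lambda>w. w j)"
      by (intro distr_cong) auto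
    then have "distributed (\<Pi>\<^sub>M j\<in>J. std_normal) lborel (\<lambda>w. w j) std_normal_density"
      using that K comp m[of j] by (auto simp: distributed_def cong: measurable_cong_sets)
    from P.normal_density_affine[OF this, of "a j" 0] show ?thesis
      using that by (simp add: K_def)
  qed
  have "distributed (\<Pi>\<^sub>M j\<in>J. std_normal) lborel (\<lambda>w. \<Sum>j\<in>K. a j * w j)
      (normal_density (\<Sum>j\<in>K. 0) (sqrt (\<Sum>j\<in>K. \<bar>a j\<bar>\<^sup>2)))"
    by (rule P.sum_indep_normal[OF K(1) Kne ind]) (auto intro: d, auto simp: K_def)
  then have "distributed (\<Pi>\<^sub>M j\<in>J. std_normal) lborel (\<lambda>w. \<Sum>j\<in>J. a j * w j) std_normal_density"
    by (simp add: sK2 sK)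
  then have "distr (\<Pi>\<^sub>M j\<in>J. std_normal) lborel (\<lambda>w. \<Sum>j\<in>J. a j * w j) = std_normal"
    by (simp add: distributed_def)
  moreover have "distr (\<Pi>\<^sub>M j\<in>J. std_normal) lborel (\<lambda>w. \<Sum>j\<in>J. a j * w j)
      = distr (\<Pi>\<^sub>M j\<in>J. std_normal) borel (\<lambda>w. \<Sum>j\<in>J. a j * w j)"
    by (intro distr_cong) auto
  ultimately show ?thesis by simp
qed

abbreviation noise1 :: "nat \<Rightarrow> (nat \<Rightarrow> real) measure" where
  "noise1 N \<equiv> mvnormal {1..N} (\<lambda>_. 0) Sigma_mat"

lemma sets_mvnormal[measurable_cong, simp]: "sets (mvnormal I \<mu> C) = sets (\<Pi>\<^sub>M i\<in>I. borel)"
  by (simp add: mvnormal_def)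

lemma linear_map_measurable:
  "(\<lambda>w. \<lambda>i\<in>I. \<mu> i + (\<Sum>j\<in>J. R i j * w j)) \<in> measurable (\<Pi>\<^sub>M j\<in>J. std_normal) (\<Pi>\<^sub>M i\<in>I. (borel :: real measure))"
proof (rule measurable_restrict)
  fix i assume "i \<in> I"
  have "(\<lambda>w. w j) \<in> borel_measurable (\<Pi>\<^sub>M j\<in>J. std_normal)" if "j \<in> J" for j
    using measurable_component_singleton[OF that, of "\<lambda>_. std_normal"] by (simp cong: measurable_cong_sets)
  then show "(\<lambda>w. \<mu> i + (\<Sum>j\<in>J. R i j * w j)) \<in> borel_measurable (\<Pi>\<^sub>M j\<in>J. std_normal)"
    by (intro borel_measurable_add borel_measurable_sum borel_measurable_times) auto
qed

lemma prob_space_mvnormal: "prob_space (mvnormal I \<mu> C)"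
  unfolding mvnormal_def
  by (intro prob_space.prob_space_distr prob_space_PiM prob_space_std_normal linear_map_measurable)

lemma mvnormal_scaled_Sigma:
  assumes N: "N \<ge> 1" and c: "0 \<le> c"
  shows "mvnormal {1..N} (\<lambda>_. \<mu>) (\<lambda>i j. c * Sigma_mat i j)
    = distr (\<Pi>\<^sub>M i\<in>{1..N}. std_normal) (\<Pi>\<^sub>M i\<in>{1..N}. borel)
        (\<lambda>w. \<lambda>i\<in>{1..N}. \<mu> + sqrt c * (\<Sum>j\<in>{1..N}. Sigma_root N i j * w j))"
  unfolding mvnormal_def
  by (intro distr_cong refl restrict_ext arg_cong2[where f="(+)"])
     (simp add: psd_sqrt_scaled_Sigma[OF N c] sum_distrib_left mult.assoc del: One_nat_def)

lemma noise1_eq: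
  assumes N: "N \<ge> 1"
  shows "noise1 N = distr (\<Pi>\<^sub>M i\<in>{1..N}. std_normal) (\<Pi>\<^sub>M i\<in>{1..N}. borel)
        (\<lambda>w. \<lambda>i\<in>{1..N}. \<Sum>j\<in>{1..N}. Sigma_root N i j * w j)"
  using mvnormal_scaled_Sigma[OF N, of 1 0] by simp

text \<open>The root of \<open>c * Sigma_mat\<close> is \<open>sqrt c\<close> times that of
  \<open>Sigma_mat\<close>, so the limiting noise is an affine image of the proposal noise. The case
  \<open>c = 0\<close>, a point mass, is covered.\<close>

lemma mvnormal_scaled_eq_distr_noise1:
  assumes N: "N \<ge> 1" and c: "0 \<le> c"
  shows "mvnormal {1..N} (\<lambda>_. \<mu>) (\<lambda>i j. c * Sigma_mat i j)
    = distr (noise1 N) (\<Pi>\<^sub>M i\<in>{1..N}. borel) (\<lambda>u. \<lambda>i\<in>{1..N}. \<mu> + sqrt c * u i)"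
  unfolding noise1_eq[OF N] mvnormal_scaled_Sigma[OF N c]
  using linear_map_measurable[where I="{1..N}" and J="{1..N}" and \<mu>="\<lambda>_. 0" and R="Sigma_root N"]
  by (subst distr_distr) (auto simp: comp_def cong: restrict_cong)

text \<open>Row \<open>n\<close> of the root has squared length
  \<open>Sigma_mat n n = 1\<close>.\<close>

lemma distr_noise1_component:
  assumes n: "n \<in> {1..N}"
  shows "distr (noise1 N) borel (\<lambda>u. u n) = std_normal"
proof -
  have N: "N \<ge> 1" using n by auto
  have "(\<Sum>j\<in>{1..N}. (Sigma_root N n j)\<^sup>2) = (\<Sum>j\<in>{1..N}. Sigma_root N n j * Sigma_root N j n)"
    by (intro sum.cong refl) (auto simp: power2_eq_square Sigma_root_def)
  also have "\<dots> = 1" by (subst Sigma_root_square[OF n n]) (simp add: Sigma_mat_def)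
  finally have "distr (\<Pi>\<^sub>M i\<in>{1..N}. std_normal) borel (\<lambda>w. \<Sum>j\<in>{1..N}. Sigma_root N n j * w j) = std_normal"
    by (intro distr_weighted_sum_std_normal) auto
  moreover have "distr (noise1 N) borel (\<lambda>u. u n)
    = distr (\<Pi>\<^sub>M i\<in>{1..N}. std_normal) borel (\<lambda>w. \<Sum>j\<in>{1..N}. Sigma_root N n j * w j)"
    unfolding noise1_eq[OF N]
    using linear_map_measurable[where I="{1..N}" and J="{1..N}" and \<mu>="\<lambda>_. 0" and R="Sigma_root N"] n
    by (subst distr_distr) (auto simp: comp_def)
  ultimately show ?thesis by simp
qed

text \<open>Write \<open>U j = R (W j)\<close> with \<open>W j\<close> standard normal.
  \<open>R\<close> mixes the entries within a copy and \<open>a\<close> mixes the copies, so the two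
  linear maps commute. After transposition each entry is a unit combination of independent standard
  normals; the combined vector is again standard, and \<open>R\<close> is applied last.\<close>

lemma distr_weighted_sum_noise1:
  assumes N: "N \<ge> 1" and J: "finite J" and a: "(\<Sum>j\<in>J. (a j)\<^sup>2) = (1::real)"
  shows "distr (\<Pi>\<^sub>M j\<in>J. noise1 N) (\<Pi>\<^sub>M n\<in>{1..N}. borel) (\<lambda>U. \<lambda>n\<in>{1..N}. \<Sum>j\<in>J. a j * U j n) = noise1 N"
proof -
  let ?I = "{1..N}"
  let ?S = "\<Pi>\<^sub>M i\<in>?I. std_normal" and ?B = "\<Pi>\<^sub>M i\<in>?I. (borel :: real measure)"
  let ?R = "\<lambda>w. \<lambda>i\<in>?I. \<Sum>j\<in>?I. Sigma_root N i j * w j"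
  let ?sw = "\<lambda>x. \<lambda>i\<in>?I. \<lambda>j\<in>J. x j i"
  let ?c = "\<lambda>X. \<lambda>i\<in>?I. \<Sum>j\<in>J. a j * X i j"
  have R: "?R \<in> measurable ?S ?B"
    using linear_map_measurable[where I="?I" and J="?I" and \<mu>="\<lambda>_. 0" and R="Sigma_root N"] by simp
  have pS: "prob_space ?S" by (intro prob_space_PiM prob_space_std_normal)
  have 1: "(\<Pi>\<^sub>M j\<in>J. noise1 N) = distr (\<Pi>\<^sub>M j\<in>J. ?S) (\<Pi>\<^sub>M j\<in>J. ?B) (\<lambda>W. \<lambda>j\<in>J. ?R (W j))"
    unfolding noise1_eq[OF N] by (rule distr_PiM_componentwise[OF J pS R, symmetric])
  have mR: "(\<lambda>W. \<lambda>j\<in>J. ?R (W j)) \<in> measurable (\<Pi>\<^sub>M j\<in>J. ?S) (\<Pi>\<^sub>M j\<in>J. ?B)"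
    by (intro measurable_PiM_map R)
  have mc0: "(\<lambda>U. \<lambda>n\<in>?I. \<Sum>j\<in>J. a j * U j n) \<in> measurable (\<Pi>\<^sub>M j\<in>J. ?B) ?B"
    by (intro measurable_restrict borel_measurable_sum borel_measurable_times borel_measurable_const measurable_PiM_component2)
  have m1: "(\<lambda>X. \<Sum>j\<in>J. a j * X j) \<in> measurable (\<Pi>\<^sub>M j\<in>J. std_normal) borel"
    using linear_map_measurable[where I="{0::nat}" and J=J and \<mu>="\<lambda>_. 0" and R="\<lambda>_. a"]
    by (auto dest: measurable_compose[OF _ measurable_component_singleton[of 0 "{0}"]])
  have mc: "?c \<in> measurable (\<Pi>\<^sub>M i\<in>?I. \<Pi>\<^sub>M j\<in>J. std_normal) (\<Pi>\<^sub>M i\<in>?I. borel)"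
    by (intro measurable_PiM_map m1)
  have msw: "?sw \<in> measurable (\<Pi>\<^sub>M j\<in>J. ?S) (\<Pi>\<^sub>M i\<in>?I. \<Pi>\<^sub>M j\<in>J. std_normal)"
    by (intro measurable_restrict measurable_PiM_component2)
  have R': "?R \<in> measurable ?B ?B" by measurable
  have "distr (\<Pi>\<^sub>M j\<in>J. noise1 N) ?B (\<lambda>U. \<lambda>n\<in>?I. \<Sum>j\<in>J. a j * U j n)
    = distr (\<Pi>\<^sub>M j\<in>J. ?S) ?B (\<lambda>W. \<lambda>n\<in>?I. \<Sum>j\<in>J. a j * ?R (W j) n)"
    unfolding 1 by (subst distr_distr[OF mc0 mR]) (auto simp: comp_def intro!: distr_cong)
  also have "\<dots> = distr (\<Pi>\<^sub>M j\<in>J. ?S) ?B (\<lambda>W. ?R (?c (?sw W)))"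
  proof (intro distr_cong refl restrict_ext)
    fix W n assume n: "n \<in> ?I"
    have "(\<Sum>j\<in>J. a j * ?R (W j) n) = (\<Sum>j\<in>J. \<Sum>k\<in>?I. a j * (Sigma_root N n k * W j k))"
      using n by (simp add: sum_distrib_left)
    also have "\<dots> = (\<Sum>k\<in>?I. \<Sum>j\<in>J. a j * (Sigma_root N n k * W j k))" by (rule sum.swap)
    also have "\<dots> = (\<Sum>k\<in>?I. Sigma_root N n k * ?c (?sw W) k)"
      by (intro sum.cong refl) (simp add: sum_distrib_left ac_simps)
    finally show "(\<Sum>j\<in>J. a j * ?R (W j) n) = (\<Sum>k\<in>?I. Sigma_root N n k * ?c (?sw W) k)" .
  qed
  also have "\<dots> = distr (distr (\<Pi>\<^sub>M j\<in>J. ?S) ?B (\<lambda>W. ?c (?sw W))) ?B ?R"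
    by (subst distr_distr[OF R' measurable_compose[OF msw mc]]) (simp only: comp_def)
  also have "distr (\<Pi>\<^sub>M j\<in>J. ?S) ?B (\<lambda>W. ?c (?sw W))
      = distr (distr (\<Pi>\<^sub>M j\<in>J. ?S) (\<Pi>\<^sub>M i\<in>?I. \<Pi>\<^sub>M j\<in>J. std_normal) ?sw) ?B ?c"
    by (subst distr_distr[OF mc msw]) (simp only: comp_def)
  also have "distr (\<Pi>\<^sub>M j\<in>J. ?S) (\<Pi>\<^sub>M i\<in>?I. \<Pi>\<^sub>M j\<in>J. std_normal) ?sw = (\<Pi>\<^sub>M i\<in>?I. \<Pi>\<^sub>M j\<in>J. std_normal)"
    by (rule distr_PiM_swap[OF prob_space_imp_sigma_finite[OF prob_space_std_normal] _ J]) simp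
  also have "distr \<dots> ?B ?c = (\<Pi>\<^sub>M i\<in>?I. std_normal)"
    by (subst distr_PiM_componentwise[OF _ prob_space_PiM[OF prob_space_std_normal] m1])
       (simp_all add: distr_weighted_sum_std_normal[OF J a])
  also have "distr ?S ?B ?R = noise1 N" by (rule noise1_eq[OF N, symmetric])
  finally show ?thesis .
qed

lemma noise1_moments:
  assumes n: "n \<in> {1..N}"
  shows "integrable (noise1 N) (\<lambda>u. (u n) ^ k)" "integrable (noise1 N) (\<lambda>u. \<bar>u n\<bar> ^ k)"
    and "(\<integral>u. u n \<partial>noise1 N) = 0" "(\<integral>u. (u n)\<^sup>2 \<partial>noise1 N) = 1" "(\<integral>u. (u n) ^ 4 \<partial>noise1 N) = 3"
    and "(\<integral>u. exp (s * u n) \<partial>noise1 N) = exp (s\<^sup>2 / 2)" "integrable (noise1 N) (\<lambda>u. exp (s * u n))"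
proof -
  have m: "(\<lambda>u. u n) \<in> borel_measurable (noise1 N)" using n by measurable
  have E: "(\<integral>u. f (u n) \<partial>noise1 N) = (\<integral>x. std_normal_density x * f x \<partial>lborel)"
    and I: "integrable (noise1 N) (\<lambda>u. f (u n)) \<longleftrightarrow> integrable lborel (\<lambda>x. std_normal_density x * f x)"
    if f: "f \<in> borel_measurable borel" for f :: "real \<Rightarrow> real"
    using integral_distr[OF m f] integrable_distr_eq[OF m f] f
    by (simp_all add: distr_noise1_component[OF n] integral_density integrable_density del: One_nat_def)
  show "integrable (noise1 N) (\<lambda>u. (u n) ^ k)"
    by (subst I[of "\<lambda>x. x ^ k"]) (simp_all add: integrable_std_normal_moment)
  show "integrable (noise1 N) (\<lambda>u. \<bar>u n\<bar> ^ k)"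
    by (subst I[of "\<lambda>x. \<bar>x\<bar> ^ k"]) (simp_all add: integrable_std_normal_moment_abs)
  show "(\<integral>u. u n \<partial>noise1 N) = 0"
    using E[of "\<lambda>x. x"] integral_std_normal_moment_odd[of 0] by simp
  show "(\<integral>u. (u n)\<^sup>2 \<partial>noise1 N) = 1"
    using E[of "\<lambda>x. x\<^sup>2"] integral_std_normal_moment_even[of 1] by simp
  show "(\<integral>u. (u n) ^ 4 \<partial>noise1 N) = 3"
    using E[of "\<lambda>x. x ^ 4"] integral_std_normal_moment_even[of 2] by (simp add: fact_numeral)
  \<comment> \<open>Completing the square: tilting by \<open>exp (s * x)\<close> moves the mean of
    the standard normal law to \<open>s\<close>.\<close>
  have sq: "std_normal_density x * exp (s * x) = exp (s\<^sup>2 / 2) * normal_density s 1 x" for x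
    by (simp add: std_normal_density_def normal_density_def exp_add[symmetric])
       (simp add: power2_eq_square field_simps)
  show "(\<integral>u. exp (s * u n) \<partial>noise1 N) = exp (s\<^sup>2 / 2)"
    by (subst E[of "\<lambda>x. exp (s * x)"]) (simp_all add: sq)
  show "integrable (noise1 N) (\<lambda>u. exp (s * u n))"
    by (subst I[of "\<lambda>x. exp (s * x)"]) (simp_all add: sq)
qed

section \<open>Calculus along coordinate lines\<close>

lemma Rn_upd: "x \<in> Rn T \<Longrightarrow> u \<in> {1..T} \<Longrightarrow> x(u := s) \<in> Rn T"
  by (auto simp: Rn_def PiE_iff extensional_def)

lemma Rn_eqI: "x \<in> Rn T \<Longrightarrow> y \<in> Rn T \<Longrightarrow> (\<And>i. i \<in> {1..T} \<Longrightarrow> x i = y i) \<Longrightarrow> x = y"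
  unfolding Rn_def by (rule PiE_ext)

lemma continuous_on_Rn_line:
  fixes f :: "(nat \<Rightarrow> real) \<Rightarrow> real"
  assumes "continuous_on (Rn T) f" "x \<in> Rn T" "u \<in> {1..T}"
  shows "continuous_on UNIV (\<lambda>s. f (x(u := s)))"
proof (rule continuous_on_compose2[OF assms(1)])
  show "continuous_on UNIV (\<lambda>s. x(u := s))"
  proof (rule continuous_on_coordinatewise_then_product)
    show "continuous_on UNIV (\<lambda>s. (x(u := s)) i)" for i
      by (cases "i = u") auto
  qed
  show "(\<lambda>s. x(u := s)) ` UNIV \<subseteq> Rn T"
    using Rn_upd assms by auto
qed

lemma DERIV_pderiv_at:
  assumes "\<And>x. x \<in> Rn T \<Longrightarrow> (\<lambda>s. f (x(u := s))) field_differentiable at (x u)"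
    and "x \<in> Rn T" "u \<in> {1..T}"
  shows "((\<lambda>s. f (x(u := s))) has_real_derivative pderiv_at u f (x(u := r))) (at r)"
proof -
  have "(\<lambda>s. f (x(u := r, u := s))) field_differentiable at ((x(u := r)) u)"
    by (rule assms(1)) (use assms Rn_upd in blast)
  then show ?thesis
    unfolding pderiv_at_def by (simp add: DERIV_deriv_iff_field_differentiable)
qed

text \<open>If \<open>\<phi>\<close> vanished somewhere, its logarithm would tend to \<open>-\<infinity>\<close> at the nearest zero, although
  a function with bounded second derivative on a bounded interval is bounded.\<close>

lemma positive_if_log_second_derivative_bounded:
  fixes \<phi> a b :: "real \<Rightarrow> real"
  assumes cont: "continuous_on UNIV \<phi>" and nonneg: "\<And>s. 0 \<le> \<phi> s"
    and pos: "0 < \<phi> s0"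
    and D1: "\<And>s. 0 < \<phi> s \<Longrightarrow> ((\<lambda>s. ln (\<phi> s)) has_real_derivative a s) (at s)"
    and D2: "\<And>s. 0 < \<phi> s \<Longrightarrow> (a has_real_derivative b s) (at s)"
    and bd: "\<And>s. 0 < \<phi> s \<Longrightarrow> \<bar>b s\<bar> \<le> C"
  shows "0 < \<phi> r"
proof (rule ccontr)
  assume "\<not> 0 < \<phi> r"
  then have r0: "\<phi> r = 0" using nonneg[of r] by linarith
  define \<psi> where "\<psi> \<theta> = \<phi> (s0 + \<theta> * (r - s0))" for \<theta>
  \<comment> \<open>The segment from \<open>s0\<close> to \<open>r\<close> is parametrised by
    [0, 1]. The zero set is closed, so its infimum \<open>m\<close> is the first zero, and before it
    the logarithm is differentiable.\<close>
  define Z where "Z = {\<theta>\<in>{0..1}. \<psi> \<theta> = 0}"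
  have cpsi: "continuous_on A \<psi>" for A
    unfolding \<psi>_def
    by (rule continuous_on_compose2[OF cont]) (auto intro!: continuous_intros)
  have "closed Z"
    unfolding Z_def by (intro continuous_closed_preimage_constant cpsi closed_real_atLeastAtMost)
  moreover have "1 \<in> Z" using r0 by (simp add: Z_def \<psi>_def)
  moreover have "bdd_below Z" unfolding Z_def by (auto intro!: bdd_belowI[of _ 0])
  ultimately have ZZ: "Inf Z \<in> Z" by (intro closed_contains_Inf) auto
  define m where "m = Inf Z"
  have m: "0 \<le> m" "m \<le> 1" "\<psi> m = 0" using ZZ by (auto simp: m_def Z_def)
  have m0: "m \<noteq> 0" using m pos by (auto simp: \<psi>_def)
  have pp: "0 < \<psi> \<theta>" if "0 \<le> \<theta>" "\<theta> < m" for \<theta>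
  proof -
    have "\<theta> \<notin> Z" using that \<open>bdd_below Z\<close> cInf_lower[of \<theta> Z] by (auto simp: m_def)
    then have "\<psi> \<theta> \<noteq> 0" using that m by (auto simp: Z_def)
    then show ?thesis using nonneg[of "s0 + \<theta> * (r - s0)"] by (auto simp: \<psi>_def order_less_le)
  qed
  define w where "w = r - s0"
  define a' where "a' \<theta> = a (s0 + \<theta> * w) * w" for \<theta>
  have d1: "((\<lambda>\<theta>. ln (\<psi> \<theta>)) has_real_derivative a' \<theta>) (at \<theta>)" if "0 \<le> \<theta>" "\<theta> < m" for \<theta>
  proof -
    have "((\<lambda>\<theta>. ln (\<phi> (s0 + \<theta> * w))) has_real_derivative a (s0 + \<theta> * w) * w) (at \<theta>)"
      by (rule DERIV_chain2[where f="\<lambda>s. ln (\<phi> s)"], rule D1)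
         (use pp[OF that] in \<open>auto simp: \<psi>_def w_def intro!: derivative_eq_intros\<close>)
    then show ?thesis by (simp add: \<psi>_def w_def a'_def)
  qed
  have d2: "(a' has_real_derivative b (s0 + \<theta> * w) * w * w) (at \<theta>)" if "0 \<le> \<theta>" "\<theta> < m" for \<theta>
  proof -
    have "((\<lambda>\<theta>. a (s0 + \<theta> * w)) has_real_derivative b (s0 + \<theta> * w) * w) (at \<theta>)"
      by (rule DERIV_chain2[where f=a], rule D2)
         (use pp[OF that] in \<open>auto simp: \<psi>_def w_def intro!: derivative_eq_intros\<close>)
    then show ?thesis unfolding a'_def by (rule DERIV_cmult_right)
  qed
  \<comment> \<open>On a parameter interval of length at most 1 the derivative of the logarithm
    changes by at most \<open>|C| * w * w\<close>; the two factors \<open>w\<close> come from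
    differentiating twice along the segment.\<close>
  define K where "K = \<bar>a' 0\<bar> + \<bar>C\<bar> * (w * w)"
  have a'b: "\<bar>a' \<theta>\<bar> \<le> K" if "0 \<le> \<theta>" "\<theta> < m" for \<theta>
  proof (cases "\<theta> = 0")
    case False
    then have "0 < \<theta>" using that by simp
    have "\<exists>z>0. z < \<theta> \<and> a' \<theta> - a' 0 = (\<theta> - 0) * (b (s0 + z * w) * w * w)"
      by (rule MVT2[OF \<open>0 < \<theta>\<close>]) (use d2 that in auto)
    then obtain z where z: "0 < z" "z < \<theta>" "a' \<theta> - a' 0 = (\<theta> - 0) * (b (s0 + z * w) * w * w)"
      by auto
    have "\<bar>b (s0 + z * w)\<bar> \<le> \<bar>C\<bar>"
      using bd[of "s0 + z * w"] pp[of z] z that by (auto simp: \<psi>_def w_def)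
    then have "\<theta> * (\<bar>b (s0 + z * w)\<bar> * (w * w)) \<le> 1 * (\<bar>C\<bar> * (w * w))"
      using that m by (intro mult_mono mult_right_mono) auto
    moreover have "\<bar>(\<theta> - 0) * (b (s0 + z * w) * w * w)\<bar> = \<theta> * (\<bar>b (s0 + z * w)\<bar> * (w * w))"
      using that by (simp add: abs_mult)
    ultimately have "\<bar>(\<theta> - 0) * (b (s0 + z * w) * w * w)\<bar> \<le> \<bar>C\<bar> * (w * w)"
      by simp
    then show ?thesis using z(3) unfolding K_def by linarith
  qed (auto simp: K_def)
  have lb: "ln (\<psi> 0) - K \<le> ln (\<psi> \<theta>)" if "0 < \<theta>" "\<theta> < m" for \<theta>
  proof -
    have "\<exists>z>0. z < \<theta> \<and> ln (\<psi> \<theta>) - ln (\<psi> 0) = (\<theta> - 0) * a' z"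
      by (rule MVT2[OF \<open>0 < \<theta>\<close>]) (use d1 that in auto)
    then obtain z where z: "0 < z" "z < \<theta>" "ln (\<psi> \<theta>) - ln (\<psi> 0) = (\<theta> - 0) * a' z"
      by auto
    have "\<bar>(\<theta> - 0) * a' z\<bar> \<le> 1 * K"
      unfolding abs_mult using that m a'b[of z] z by (intro mult_mono) auto
    then show ?thesis using z(3) by linarith
  qed
  have "(\<psi> \<longlongrightarrow> \<psi> m) (at_left m)"
    using cpsi[of UNIV] by (auto simp: continuous_on_def intro: tendsto_within_subset)
  moreover have "eventually (\<lambda>\<theta>. exp (ln (\<psi> 0) - K) \<le> \<psi> \<theta>) (at_left m)"
    unfolding eventually_at_left_field
    using m m0
    by (intro exI[of _ 0]) (auto simp: pp lb ln_ge_iff[symmetric])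
  ultimately have "exp (ln (\<psi> 0) - K) \<le> \<psi> m"
    by (intro tendsto_lowerbound) auto
  then show False using m(3) by (simp add: not_le)
qed

text \<open>\<open>B\<close> may differ from \<open>b c\<close>: in the multivariate expansion the
  one-dimensional step starts at an intermediate point of the path, whereas the second derivative is
  frozen at the initial point.\<close>

lemma taylor2_bound:
  fixes \<phi> a b :: "real \<Rightarrow> real"
  assumes "\<And>s. (\<phi> has_real_derivative a s) (at s)"
    and "\<And>s. (a has_real_derivative b s) (at s)"
    and "\<And>s. \<bar>s - c\<bar> \<le> \<bar>y - c\<bar> \<Longrightarrow> \<bar>b s - B\<bar> \<le> M"
  shows "\<bar>\<phi> y - \<phi> c - a c * (y - c) - (1/2) * B * (y - c)\<^sup>2\<bar> \<le> (1/2) * M * (y - c)\<^sup>2"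
proof (cases "y = c")
  case False
  define diff where "diff m = (if m = 0 then \<phi> else if m = 1 then a else b)" for m :: nat
  have "\<exists>t. (if y < c then y < t \<and> t < c else c < t \<and> t < y) \<and>
    \<phi> y = (\<Sum>m<2. (diff m c / fact m) * (y - c)^m) + (diff 2 t / fact 2) * (y - c)^2"
    by (rule Taylor[where a="min y c" and b="max y c"])
       (use False assms in \<open>auto simp: diff_def less_2_cases_iff\<close>)
  then obtain t where t: "if y < c then y < t \<and> t < c else c < t \<and> t < y"
    "\<phi> y = \<phi> c + a c * (y - c) + b t / 2 * (y - c)\<^sup>2"
    by (auto simp: diff_def numeral_2_eq_2)
  have "\<phi> y - \<phi> c - a c * (y - c) - (1/2) * B * (y - c)\<^sup>2 = (b t - B) * ((1/2) * (y - c)\<^sup>2)"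
    unfolding t(2) by (simp add: field_simps)
  also have "\<bar>\<dots>\<bar> = \<bar>b t - B\<bar> * ((1/2) * (y - c)\<^sup>2)"
    by (simp add: abs_mult)
  also have "\<dots> \<le> M * ((1/2) * (y - c)\<^sup>2)"
    using t(1) by (intro mult_right_mono assms) (auto split: if_splits)
  finally show ?thesis by simp
qed simp

text \<open>Moving from \<open>x\<close> to \<open>y\<close> one coordinate at a time needs derivatives along coordinate lines only,
  hence neither a chain rule nor the symmetry of the mixed derivatives.\<close>

lemma coordinatewise_taylor:
  fixes f :: "(nat \<Rightarrow> real) \<Rightarrow> real" and g :: "nat \<Rightarrow> (nat \<Rightarrow> real) \<Rightarrow> real"
    and h :: "nat \<Rightarrow> nat \<Rightarrow> (nat \<Rightarrow> real) \<Rightarrow> real"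
  assumes Df: "\<And>x u r. x \<in> Rn T \<Longrightarrow> u \<in> {1..T} \<Longrightarrow>
      ((\<lambda>s. f (x(u := s))) has_real_derivative g u (x(u := r))) (at r)"
    and Dg: "\<And>x s u r. x \<in> Rn T \<Longrightarrow> s \<in> {1..T} \<Longrightarrow> u \<in> {1..T} \<Longrightarrow>
      ((\<lambda>q. g u (x(s := q))) has_real_derivative h s u (x(s := r))) (at r)"
    and Lip: "\<And>s u x y. s \<in> {1..T} \<Longrightarrow> u \<in> {1..T} \<Longrightarrow> x \<in> Rn T \<Longrightarrow> y \<in> Rn T \<Longrightarrow>
      \<bar>h s u x - h s u y\<bar> \<le> L * (\<Sum>i\<in>{1..T}. \<bar>x i - y i\<bar>)"
    and L: "0 \<le> L" and x: "x \<in> Rn T" and y: "y \<in> Rn T"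
  defines "\<delta> \<equiv> \<lambda>i. y i - x i"
  defines "S \<equiv> \<Sum>i\<in>{1..T}. \<bar>\<delta> i\<bar>"
  shows "\<bar>f y - f x - (\<Sum>t\<in>{1..T}. g t x * \<delta> t + (1/2) * h t t x * (\<delta> t)\<^sup>2
            + (\<Sum>s\<in>{1..<t}. h s t x * \<delta> s * \<delta> t))\<bar> \<le> L * S ^ 3"
proof -
  define z where "z m = (\<lambda>i. if i \<le> m then y i else x i)" for m
  have zR: "z m \<in> Rn T" for m
    using x y by (auto simp: z_def Rn_def PiE_iff extensional_def)
  have z0: "z 0 = x"
    by (rule Rn_eqI[OF zR x]) (auto simp: z_def)
  have zT: "z T = y"
    by (rule Rn_eqI[OF zR y]) (auto simp: z_def)
  have zS: "z (Suc m) = (z m)(Suc m := y (Suc m))" for m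
    by (auto simp: z_def fun_eq_iff le_Suc_eq)
  have zx: "z m (Suc m) = x (Suc m)" "(z m)(Suc m := x (Suc m)) = z m" for m
    by (auto simp: z_def fun_eq_iff)
  have S0: "0 \<le> S" unfolding S_def by (intro sum_nonneg) auto
  \<comment> \<open>All points visited lie in the box spanned by \<open>x\<close> and
    \<open>y\<close>, so the second derivatives stay within \<open>L * S\<close> of their values at
    \<open>x\<close>.\<close>
  have hb: "\<bar>h s u ((z m)(Suc m := q)) - h s u x\<bar> \<le> L * S"
    if "s \<in> {1..T}" "u \<in> {1..T}" "Suc m \<in> {1..T}" "\<bar>q - x (Suc m)\<bar> \<le> \<bar>y (Suc m) - x (Suc m)\<bar>" for s u m q
  proof -
    have "\<bar>h s u ((z m)(Suc m := q)) - h s u x\<bar> \<le> L * (\<Sum>i\<in>{1..T}. \<bar>((z m)(Suc m := q)) i - x i\<bar>)"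
      by (intro Lip Rn_upd zR that x)
    also have "\<dots> \<le> L * S"
      unfolding S_def \<delta>_def using that by (intro mult_left_mono L sum_mono) (auto simp: z_def)
    finally show ?thesis .
  qed
  \<comment> \<open>Up to accumulated mean value errors, a first derivative at the
    \<open>m\<close>-th point is affine in the displacements already made.\<close>
  have Q: "\<bar>g u (z m) - g u x - (\<Sum>s\<in>{1..m}. h s u x * \<delta> s)\<bar> \<le> L * S * (\<Sum>s\<in>{1..m}. \<bar>\<delta> s\<bar>)"
    if "m \<le> T" "u \<in> {1..T}" for m u
    using that
  proof (induction m)
    case (Suc m)
    have T: "Suc m \<in> {1..T}" using Suc by auto
    have "\<bar>g u (z (Suc m)) - g u (z m) - h (Suc m) u x * \<delta> (Suc m)\<bar> \<le> L * S * \<bar>\<delta> (Suc m)\<bar>"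
    proof (cases "y (Suc m) = x (Suc m)")
      case True then show ?thesis using zx[of m] by (simp add: zS \<delta>_def)
    next
      case False
      define \<phi> where "\<phi> q = g u ((z m)(Suc m := q))" for q
      have D: "(\<phi> has_real_derivative h (Suc m) u ((z m)(Suc m := q))) (at q)" for q
        unfolding \<phi>_def by (intro Dg zR T Suc)
      obtain q where q: "\<bar>q - x (Suc m)\<bar> \<le> \<bar>y (Suc m) - x (Suc m)\<bar>"
        "\<phi> (y (Suc m)) - \<phi> (x (Suc m)) = (y (Suc m) - x (Suc m)) * h (Suc m) u ((z m)(Suc m := q))"
      proof (cases "x (Suc m) < y (Suc m)")
        case True
        from MVT2[OF True, of \<phi>, OF D] that show ?thesis by force
      next
        case F: False
        then have "y (Suc m) < x (Suc m)" using False by auto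
        from MVT2[OF this, of \<phi>, OF D] obtain q where "y (Suc m) < q" "q < x (Suc m)"
          "\<phi> (x (Suc m)) - \<phi> (y (Suc m)) = (x (Suc m) - y (Suc m)) * h (Suc m) u ((z m)(Suc m := q))" by auto
        then show ?thesis by (intro that[of q]) (auto simp: algebra_simps)
      qed
      have "g u (z (Suc m)) - g u (z m) = \<delta> (Suc m) * h (Suc m) u ((z m)(Suc m := q))"
        using q(2) zx[of m] by (simp add: \<phi>_def zS \<delta>_def)
      then have "\<bar>g u (z (Suc m)) - g u (z m) - h (Suc m) u x * \<delta> (Suc m)\<bar>
          = \<bar>h (Suc m) u ((z m)(Suc m := q)) - h (Suc m) u x\<bar> * \<bar>\<delta> (Suc m)\<bar>"
        by (simp add: abs_mult[symmetric] algebra_simps)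
      also have "\<dots> \<le> L * S * \<bar>\<delta> (Suc m)\<bar>"
        by (intro mult_right_mono hb T Suc q) auto
      finally show ?thesis .
    qed
    then show ?case using Suc by (simp add: algebra_simps)
  qed (simp add: z0)
  \<comment> \<open>In step \<open>t\<close> the derivative \<open>g t\<close> is taken where the
    coordinates \<open>s < t\<close> have already moved. Replacing it by means of \<open>Q\<close>
    yields each mixed term once, for \<open>s < t\<close>, and without a factor 1/2.\<close>
  have P: "\<bar>f (z m) - f x - (\<Sum>t\<in>{1..m}. g t x * \<delta> t + (1/2) * h t t x * (\<delta> t)\<^sup>2
            + (\<Sum>s\<in>{1..<t}. h s t x * \<delta> s * \<delta> t))\<bar> \<le> L * S * S * (\<Sum>t\<in>{1..m}. \<bar>\<delta> t\<bar>)"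
    if "m \<le> T" for m
    using that
  proof (induction m)
    case (Suc m)
    have T: "Suc m \<in> {1..T}" using Suc by auto
    let ?c = "\<delta> (Suc m)"
    have "\<bar>f ((z m)(Suc m := y (Suc m))) - f ((z m)(Suc m := x (Suc m)))
        - g (Suc m) ((z m)(Suc m := x (Suc m))) * (y (Suc m) - x (Suc m))
        - (1/2) * h (Suc m) (Suc m) x * (y (Suc m) - x (Suc m))\<^sup>2\<bar> \<le> (1/2) * (L * S) * (y (Suc m) - x (Suc m))\<^sup>2"
      by (rule taylor2_bound[where \<phi>="\<lambda>q. f ((z m)(Suc m := q))" and a="\<lambda>q. g (Suc m) ((z m)(Suc m := q))"
            and b="\<lambda>q. h (Suc m) (Suc m) ((z m)(Suc m := q))"])
         (intro Df Dg zR T hb; assumption)+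
    then have A: "\<bar>f (z (Suc m)) - f (z m) - g (Suc m) (z m) * ?c - (1/2) * h (Suc m) (Suc m) x * ?c\<^sup>2\<bar>
        \<le> (1/2) * (L * S) * ?c\<^sup>2"
      by (simp add: zS[symmetric] zx \<delta>_def)
    have "g (Suc m) (z m) * ?c - g (Suc m) x * ?c - (\<Sum>s\<in>{1..m}. h s (Suc m) x * \<delta> s * ?c)
        = (g (Suc m) (z m) - g (Suc m) x - (\<Sum>s\<in>{1..m}. h s (Suc m) x * \<delta> s)) * ?c"
      by (simp add: algebra_simps sum_distrib_left)
    also have "\<bar>\<dots>\<bar> \<le> L * S * (\<Sum>s\<in>{1..m}. \<bar>\<delta> s\<bar>) * \<bar>?c\<bar>"
      unfolding abs_mult by (intro mult_right_mono Q T) (use Suc in auto)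
    finally have B: "\<bar>g (Suc m) (z m) * ?c - g (Suc m) x * ?c - (\<Sum>s\<in>{1..m}. h s (Suc m) x * \<delta> s * ?c)\<bar>
        \<le> L * S * (\<Sum>s\<in>{1..m}. \<bar>\<delta> s\<bar>) * \<bar>?c\<bar>" .
    \<comment> \<open>Half the new increment plus the earlier ones is at most \<open>S\<close>, so
      the one-dimensional Taylor error and the error from \<open>Q\<close> together fit into the
      cubic bound.\<close>
    have "(\<Sum>s\<in>{1..m}. \<bar>\<delta> s\<bar>) + \<bar>?c\<bar> = (\<Sum>s\<in>{1..Suc m}. \<bar>\<delta> s\<bar>)" by simp
    also have "\<dots> \<le> S" unfolding S_def using Suc.prems by (intro sum_mono2) auto
    finally have "L * S * \<bar>?c\<bar> * ((1/2) * \<bar>?c\<bar> + (\<Sum>s\<in>{1..m}. \<bar>\<delta> s\<bar>)) \<le> L * S * \<bar>?c\<bar> * S"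
      using L S0 by (intro mult_left_mono mult_nonneg_nonneg) auto
    then have C: "(1/2) * (L * S) * ?c\<^sup>2 + L * S * (\<Sum>s\<in>{1..m}. \<bar>\<delta> s\<bar>) * \<bar>?c\<bar> \<le> L * S * S * \<bar>?c\<bar>"
      by (simp add: algebra_simps power2_eq_square flip: power2_abs)
    have "(\<Sum>t\<in>{1..Suc m}. g t x * \<delta> t + (1/2) * h t t x * (\<delta> t)\<^sup>2 + (\<Sum>s\<in>{1..<t}. h s t x * \<delta> s * \<delta> t))
      = (\<Sum>t\<in>{1..m}. g t x * \<delta> t + (1/2) * h t t x * (\<delta> t)\<^sup>2 + (\<Sum>s\<in>{1..<t}. h s t x * \<delta> s * \<delta> t))
        + (g (Suc m) x * ?c + (1/2) * h (Suc m) (Suc m) x * ?c\<^sup>2 + (\<Sum>s\<in>{1..m}. h s (Suc m) x * \<delta> s * ?c))"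
      by (simp add: atLeastLessThanSuc_atLeastAtMost)
    moreover have "L * S * S * (\<Sum>t\<in>{1..Suc m}. \<bar>\<delta> t\<bar>) = L * S * S * (\<Sum>t\<in>{1..m}. \<bar>\<delta> t\<bar>) + L * S * S * \<bar>?c\<bar>"
      by (simp add: algebra_simps)
    ultimately show ?case using A B C Suc.IH Suc.prems by linarith
  qed (simp add: z0)
  have eq: "L * S * S * (\<Sum>t\<in>{1..T}. \<bar>\<delta> t\<bar>) = L * S ^ 3"
    by (simp only: S_def[symmetric] power3_eq_cube mult.assoc)
  show ?thesis using P[OF order_refl] unfolding zT eq .
qed

declare One_nat_def [simp del]

section \<open>Measurability of partial derivatives, and integrals of derivatives\<close>

lemma measurable_PiM_update:
  assumes [measurable]: "g \<in> measurable (PiM I M) (M u)"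
  shows "(\<lambda>x. x(u := g x)) \<in> measurable (PiM I M) (PiM (insert u I) M)"
proof -
  have "(\<lambda>x. (\<lambda>(f, y). f(u := y)) (x, g x)) \<in> measurable (PiM I M) (PiM (insert u I) M)"
    by (rule measurable_compose[OF _ measurable_add_dim]) measurable
  then show ?thesis by simp
qed

text \<open>A partial derivative is the pointwise limit of difference quotients with step
  \<open>1 / (n + 1)\<close>, and these are measurable because updating one coordinate is.\<close>

lemma measurable_pderiv_at:
  fixes f :: "(nat \<Rightarrow> real) \<Rightarrow> real"
  assumes f: "f \<in> borel_measurable (\<Pi>\<^sub>M t\<in>{1..T}. lborel)" and u: "u \<in> {1..T}"
    and D: "\<And>x r. x \<in> Rn T \<Longrightarrow> ((\<lambda>s. f (x(u := s))) has_real_derivative pderiv_at u f (x(u := r))) (at r)"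
  shows "pderiv_at u f \<in> borel_measurable (\<Pi>\<^sub>M t\<in>{1..T}. lborel)"
proof (rule borel_measurable_LIMSEQ_real)
  let ?P = "\<Pi>\<^sub>M t\<in>{1..T}. (lborel :: real measure)"
  fix n :: nat
  have "(\<lambda>x. x u + 1 / real (Suc n)) \<in> measurable ?P lborel"
    using u by measurable
  then have "(\<lambda>x. x(u := x u + 1 / real (Suc n))) \<in> measurable ?P ?P"
    using measurable_PiM_update[of "\<lambda>x. x u + 1 / real (Suc n)" "{1..T}" "\<lambda>_. lborel" u]
    by (simp only: insert_absorb[OF u])
  from measurable_compose[OF this f]
  show "(\<lambda>x. (f (x(u := x u + 1 / real (Suc n))) - f x) / (1 / real (Suc n))) \<in> borel_measurable ?P"
    using f by measurable
next
  fix x assume "x \<in> space (\<Pi>\<^sub>M t\<in>{1..T}. (lborel :: real measure))"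
  then have x: "x \<in> Rn T" by (simp add: space_PiM Rn_def)
  have "((\<lambda>h. (f (x(u := x u + h)) - f (x(u := x u))) / h) \<longlongrightarrow> pderiv_at u f (x(u := x u))) (at 0)"
    using D[OF x, of "x u"] by (simp only: DERIV_def)
  then have "((\<lambda>h. (f (x(u := x u + h)) - f x) / h) \<longlongrightarrow> pderiv_at u f x) (at 0)" by simp
  moreover have "filterlim (\<lambda>n. 1 / real (Suc n)) (at 0) sequentially"
    by (intro filterlim_atI lim_1_over_n[THEN LIMSEQ_Suc]) auto
  ultimately show "(\<lambda>n. (f (x(u := x u + 1 / real (Suc n))) - f x) / (1 / real (Suc n))) \<longlonglongrightarrow> pderiv_at u f x"
    by (rule filterlim_compose)
qed

text \<open>Integrating \<open>H (x + 1) - H x = \<integral>\<^sub>0\<^sup>1 H' (x + s) ds\<close> over \<open>x\<close> gives \<open>0 = \<integral> H'\<close>, by translation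
  invariance and Fubini's theorem.\<close>

lemma integral_derivative_eq_0:
  fixes H H' :: "real \<Rightarrow> real"
  assumes D: "\<And>x. (H has_real_derivative H' x) (at x)" and cont: "continuous_on UNIV H'"
    and H: "integrable lborel H" and H': "integrable lborel H'"
  shows "(\<integral>x. H' x \<partial>lborel) = 0"
proof -
  define F where "F s x = indicator {0..1::real} s * H' (s + x)" for s x
  have mH'[measurable]: "H' \<in> borel_measurable borel" using cont by (rule borel_measurable_continuous_onI)
  have transl: "(\<integral>x. H' (s + x) \<partial>lborel) = (\<integral>x. H' x \<partial>lborel)"
    "(\<integral>x. \<bar>H' (s + x)\<bar> \<partial>lborel) = (\<integral>x. \<bar>H' x\<bar> \<partial>lborel)" "integrable lborel (\<lambda>x. H' (s + x))" for s
    using lborel_integral_real_affine[of 1 H' s] lborel_integral_real_affine[of 1 "\<lambda>x. \<bar>H' x\<bar>" s]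
      lborel_integrable_real_affine[OF H', of 1 s] by simp_all
  have "integrable (lborel \<Otimes>\<^sub>M lborel) (case_prod F)"
  proof (rule lborel_pair.Fubini_integrable)
    show "case_prod F \<in> borel_measurable (lborel \<Otimes>\<^sub>M lborel)"
      unfolding F_def by measurable
    have "(\<integral>x. norm (case_prod F (s, x)) \<partial>lborel) = indicator {0..1} s * (\<integral>x. \<bar>H' x\<bar> \<partial>lborel)" for s
      by (simp add: F_def abs_mult transl)
    then show "integrable lborel (\<lambda>s. \<integral>x. norm (case_prod F (s, x)) \<partial>lborel)"
      by (simp add: integrable_real_mult_indicator)
    show "AE s in lborel. integrable lborel (\<lambda>x. case_prod F (s, x))"
      by (simp add: F_def transl)
  qed
  then have "(\<integral>x. (\<integral>s. F s x \<partial>lborel) \<partial>lborel) = (\<integral>s. (\<integral>x. F s x \<partial>lborel) \<partial>lborel)"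
    by (rule lborel_pair.Fubini_integral)
  also have "\<dots> = (\<integral>x. H' x \<partial>lborel)"
    by (simp add: F_def transl)
  finally have "(\<integral>x. H' x \<partial>lborel) = (\<integral>x. (\<integral>s. F s x \<partial>lborel) \<partial>lborel)" ..
  also have "\<dots> = (\<integral>x. H (1 + x) - H x \<partial>lborel)"
  proof (intro Bochner_Integration.integral_cong refl)
    fix x
    have "(\<integral>s. indicator {0..1} s *\<^sub>R H' (s + x) \<partial>lborel) = H (1 + x) - H (0 + x)"
    proof (rule integral_FTC_atLeastAtMost)
      fix s
      have "((\<lambda>s. H (s + x)) has_real_derivative H' (s + x)) (at s)"
        using D[of "s + x"] by (simp add: DERIV_shift)
      then show "((\<lambda>s. H (s + x)) has_vector_derivative H' (s + x)) (at s within {0..1})"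
        unfolding has_real_derivative_iff_has_vector_derivative by (rule has_vector_derivative_at_within)
      show "continuous_on {0..1} (\<lambda>s. H' (s + x))"
        by (rule continuous_on_compose2[OF cont]) (auto intro!: continuous_intros)
    qed simp
    then show "(\<integral>s. F s x \<partial>lborel) = H (1 + x) - H x" by (simp add: F_def)
  qed
  also have "\<dots> = 0"
    using lborel_integral_real_affine[of 1 H 1] lborel_integrable_real_affine[OF H, of 1 1] H by simp
  finally show ?thesis .
qed


section \<open>Derivatives of the log-density\<close>

text \<open>The model enters the analysis only through these properties of its density. The bounds
  on second derivatives of the logarithm are stated where \<open>p\<close> is positive; that this is
  everywhere is a consequence, \<open>p_pos\<close>.\<close>

locale smooth_target =
  fixes T :: nat and p :: "(nat \<Rightarrow> real) \<Rightarrow> real"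
  assumes p_meas[measurable]: "p \<in> borel_measurable (\<Pi>\<^sub>M t\<in>{1..T}. lborel)"
    and p_nonneg: "0 \<le> p x"
    and prob_pi: "prob_space (pi_measure T p)"
    and C2: "C_k T 2 p"
    and Lip: "s \<in> {1..T} \<Longrightarrow> u \<in> {1..T} \<Longrightarrow>
           Lipschitz_Rn T {x \<in> Rn T. p x > 0} (pderiv_at s (pderiv_at u (log_p p)))"
    and bdd: "s \<in> {1..T} \<Longrightarrow> u \<in> {1..T} \<Longrightarrow>
           bounded (pderiv_at s (pderiv_at u (log_p p)) ` {x \<in> Rn T. p x > 0})"
    and moment4: "u \<in> {1..T} \<Longrightarrow> integrable (pi_measure T p) (\<lambda>x. \<bar>pderiv_at u (log_p p) x\<bar> ^ 4)"
begin

abbreviation "lbT \<equiv> \<Pi>\<^sub>M t\<in>{1..T}. (lborel :: real measure)"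
abbreviation "pd u \<equiv> pderiv_at u p"
abbreviation "score u \<equiv> pderiv_at u (log_p p)"
abbreviation "hess s u \<equiv> pderiv_at s (pderiv_at u (log_p p))"

lemma space_lbT: "space lbT = Rn T" by (simp add: space_PiM Rn_def)

lemma C2_facts:
  shows "continuous_on (Rn T) p"
    and "u \<in> {1..T} \<Longrightarrow> x \<in> Rn T \<Longrightarrow> (\<lambda>s. p (x(u := s))) field_differentiable at (x u)"
    and "u \<in> {1..T} \<Longrightarrow> s \<in> {1..T} \<Longrightarrow> x \<in> Rn T \<Longrightarrow> (\<lambda>q. pd u (x(s := q))) field_differentiable at (x s)"
    and "u \<in> {1..T} \<Longrightarrow> s \<in> {1..T} \<Longrightarrow> continuous_on (Rn T) (pderiv_at s (pd u))"
  using C2 by (simp_all add: numeral_2_eq_2)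

lemma DERIV_p:
  assumes "x \<in> Rn T" "u \<in> {1..T}"
  shows "((\<lambda>s. p (x(u := s))) has_real_derivative pd u (x(u := r))) (at r)"
  using assms C2_facts(2) by (intro DERIV_pderiv_at) auto

lemma DERIV_pd:
  assumes "x \<in> Rn T" "u \<in> {1..T}" "s \<in> {1..T}"
  shows "((\<lambda>q. pd u (x(s := q))) has_real_derivative pderiv_at s (pd u) (x(s := r))) (at r)"
  using assms C2_facts(3) by (intro DERIV_pderiv_at) auto

lemma DERIV_log_p:
  assumes "x \<in> Rn T" "u \<in> {1..T}" "0 < p (x(u := r))"
  shows "((\<lambda>s. log_p p (x(u := s))) has_real_derivative score u (x(u := r))) (at r)"
    and "score u (x(u := r)) = pd u (x(u := r)) / p (x(u := r))"
proof -
  have D: "((\<lambda>s. log_p p (x(u := s))) has_real_derivative pd u (x(u := r)) / p (x(u := r))) (at r)"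
    unfolding log_p_def using DERIV_ln_divide[OF assms(3)] DERIV_p[OF assms(1,2)]
    by (auto intro!: derivative_eq_intros simp: assms(3))
  have "score u (x(u := r)) = deriv (\<lambda>s. log_p p (x(u := s))) r"
    by (simp add: pderiv_at_def)
  then show "score u (x(u := r)) = pd u (x(u := r)) / p (x(u := r))"
    using DERIV_imp_deriv[OF D] by simp
  then show "((\<lambda>s. log_p p (x(u := s))) has_real_derivative score u (x(u := r))) (at r)"
    using D by simp
qed

lemma score_eq: "x \<in> Rn T \<Longrightarrow> u \<in> {1..T} \<Longrightarrow> 0 < p x \<Longrightarrow> score u x = pd u x / p x"
  using DERIV_log_p(2)[of x u "x u"] by simp

lemma DERIV_score:
  assumes x: "x \<in> Rn T" and u: "u \<in> {1..T}" and s: "s \<in> {1..T}" and pos: "0 < p (x(s := r))"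
  shows "((\<lambda>q. score u (x(s := q))) has_real_derivative hess s u (x(s := r))) (at r)"
    and "hess s u (x(s := r)) = pderiv_at s (pd u) (x(s := r)) / p (x(s := r))
      - score s (x(s := r)) * score u (x(s := r))"
proof -
  let ?y = "x(s := r)"
  \<comment> \<open>\<open>score u\<close> is known to be the quotient \<open>pd u / p\<close> only
    where \<open>p\<close> is positive, so the quotient rule is transferred on an open neighbourhood
    of \<open>r\<close> in the line.\<close>
  define S where "S = {q. 0 < p (x(s := q))}"
  have "continuous_on UNIV (\<lambda>q. p (x(s := q)))"
    by (rule continuous_on_Rn_line[OF C2_facts(1) x s])
  then have "open S" unfolding S_def by (intro open_Collect_less continuous_on_const)
  have y: "?y \<in> Rn T" using Rn_upd x s by blast
  have "((\<lambda>q. pd u (x(s := q)) / p (x(s := q))) has_real_derivative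
      (pderiv_at s (pd u) ?y * p ?y - pd u ?y * pd s ?y) / (p ?y * p ?y)) (at r)"
    using DERIV_divide[OF DERIV_pd[OF x u s] DERIV_p[OF x s]] pos by simp
  then have D: "((\<lambda>q. score u (x(s := q))) has_real_derivative
      (pderiv_at s (pd u) ?y * p ?y - pd u ?y * pd s ?y) / (p ?y * p ?y)) (at r)"
  proof (rule has_field_derivative_transform_within_open[OF _ \<open>open S\<close>])
    show "r \<in> S" using pos by (simp add: S_def)
    show "pd u (x(s := q)) / p (x(s := q)) = score u (x(s := q))" if "q \<in> S" for q
      using that Rn_upd[OF x s] u by (simp add: S_def score_eq)
  qed
  have h: "hess s u ?y = deriv (\<lambda>q. score u (x(s := q))) r"
    by (simp add: pderiv_at_def)
  then show "((\<lambda>q. score u (x(s := q))) has_real_derivative hess s u ?y) (at r)"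
    using DERIV_imp_deriv[OF D] D by simp
  show "hess s u ?y = pderiv_at s (pd u) ?y / p ?y - score s ?y * score u ?y"
    unfolding h DERIV_imp_deriv[OF D] score_eq[OF y s pos] score_eq[OF y u pos]
    using pos by (simp add: field_simps)
qed

text \<open>A density of total mass 1 is positive somewhere. From such a point the coordinates of
  \<open>y\<close> are introduced one at a time, and positivity propagates along each coordinate
  line.\<close>

lemma p_pos: "0 < p y" if y: "y \<in> Rn T"
proof -
  have "\<exists>x\<in>Rn T. 0 < p x"
  proof (rule ccontr)
    assume "\<not> (\<exists>x\<in>Rn T. 0 < p x)"
    then have "p x = 0" if "x \<in> Rn T" for x using that p_nonneg[of x] by (metis order_le_less)
    then have "(\<integral>\<^sup>+x. ennreal (p x) * indicator (space lbT) x \<partial>lbT) = (\<integral>\<^sup>+x. 0 \<partial>lbT)"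
      by (intro nn_integral_cong) (simp add: space_lbT)
    then have "emeasure (density lbT (\<lambda>x. ennreal (p x))) (space lbT) = 0"
      by (subst emeasure_density) auto
    then have "emeasure (pi_measure T p) (space (pi_measure T p)) = 0"
      by (simp add: pi_measure_def)
    then show False using prob_space.emeasure_space_1[OF prob_pi] by simp
  qed
  then obtain x where x: "x \<in> Rn T" "0 < p x" by blast
  define z where "z m = (\<lambda>i. if i \<le> m then y i else x i)" for m
  have zR: "z m \<in> Rn T" for m
    using x y by (auto simp: z_def Rn_def PiE_iff extensional_def)
  have "0 < p (z m)" if "m \<le> T" for m
    using that
  proof (induction m)
    case 0
    have "z 0 = x" by (rule Rn_eqI[OF zR x(1)]) (auto simp: z_def)
    then show ?case using x by simp
  next
    case (Suc m)
    have u: "Suc m \<in> {1..T}" using Suc by auto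
    obtain C where C: "\<And>x. x \<in> Rn T \<Longrightarrow> 0 < p x \<Longrightarrow> \<bar>hess (Suc m) (Suc m) x\<bar> \<le> C"
      using bdd[OF u u] by (auto simp: bounded_iff)
    have "0 < p ((z m)(Suc m := y (Suc m)))"
    proof (rule positive_if_log_second_derivative_bounded[where \<phi>="\<lambda>s. p ((z m)(Suc m := s))"
          and a="\<lambda>s. score (Suc m) ((z m)(Suc m := s))" and b="\<lambda>s. hess (Suc m) (Suc m) ((z m)(Suc m := s))"
          and C=C and ?s0.0="z m (Suc m)"])
      show "continuous_on UNIV (\<lambda>s. p ((z m)(Suc m := s)))"
        by (rule continuous_on_Rn_line[OF C2_facts(1) zR u])
      show "0 < p ((z m)(Suc m := z m (Suc m)))" using Suc by simp
      show "((\<lambda>s. ln (p ((z m)(Suc m := s)))) has_real_derivative score (Suc m) ((z m)(Suc m := s))) (at s)"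
        if "0 < p ((z m)(Suc m := s))" for s
        using DERIV_log_p(1)[OF zR u that] by (simp add: log_p_def)
      show "((\<lambda>s. score (Suc m) ((z m)(Suc m := s))) has_real_derivative hess (Suc m) (Suc m) ((z m)(Suc m := s))) (at s)"
        if "0 < p ((z m)(Suc m := s))" for s
        by (rule DERIV_score(1)[OF zR u u that])
      show "\<bar>hess (Suc m) (Suc m) ((z m)(Suc m := s))\<bar> \<le> C" if "0 < p ((z m)(Suc m := s))" for s
        by (intro C that Rn_upd zR u)
    qed (rule p_nonneg)
    moreover have "(z m)(Suc m := y (Suc m)) = z (Suc m)"
      by (auto simp: z_def fun_eq_iff le_Suc_eq)
    ultimately show ?case by simp
  qed
  moreover have "z T = y"
    by (rule Rn_eqI[OF zR y]) (auto simp: z_def)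
  ultimately show ?thesis by (metis order_refl)
qed

section \<open>Integrability of the derivatives and the Fisher information identity\<close>

lemma measurable_derivs:
  assumes u: "u \<in> {1..T}" and s: "s \<in> {1..T}"
  shows "pd u \<in> borel_measurable lbT" "pderiv_at s (pd u) \<in> borel_measurable lbT"
    "score u \<in> borel_measurable lbT" "hess s u \<in> borel_measurable lbT"
proof -
  have lp: "log_p p \<in> borel_measurable lbT" unfolding log_p_def[abs_def] by measurable
  show 1: "pd u \<in> borel_measurable lbT"
    by (intro measurable_pderiv_at p_meas u DERIV_p)
  show "pderiv_at s (pd u) \<in> borel_measurable lbT"
    by (intro measurable_pderiv_at s 1 DERIV_pd u)
  show 2: "score u \<in> borel_measurable lbT"
    by (intro measurable_pderiv_at u lp DERIV_log_p(1) p_pos Rn_upd)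
  show "hess s u \<in> borel_measurable lbT"
    by (intro measurable_pderiv_at s 2 DERIV_score(1) p_pos Rn_upd u)
qed

lemma sets_pi[measurable_cong]: "sets (pi_measure T p) = sets lbT"
  by (simp add: pi_measure_def)

lemma space_pi: "space (pi_measure T p) = Rn T"
  by (simp add: pi_measure_def space_lbT)

text \<open>The finitely many constants are merged by summing absolute values, and the Euclidean
  distance is replaced by the larger l1 distance, which suits the coordinatewise expansion.\<close>

lemma bound_Lip_exist:
  obtains C L where "0 \<le> C" "0 \<le> L"
    "\<And>s u x. s \<in> {1..T} \<Longrightarrow> u \<in> {1..T} \<Longrightarrow> x \<in> Rn T \<Longrightarrow> \<bar>hess s u x\<bar> \<le> C"
    "\<And>s u x y. s \<in> {1..T} \<Longrightarrow> u \<in> {1..T} \<Longrightarrow> x \<in> Rn T \<Longrightarrow> y \<in> Rn T \<Longrightarrow>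
       \<bar>hess s u x - hess s u y\<bar> \<le> L * (\<Sum>i\<in>{1..T}. \<bar>x i - y i\<bar>)"
proof -
  have eq: "{x \<in> Rn T. 0 < p x} = Rn T" using p_pos by auto
  have "\<exists>C. \<forall>x\<in>Rn T. \<bar>hess s u x\<bar> \<le> C" if "s \<in> {1..T}" "u \<in> {1..T}" for s u
    using bdd[OF that] by (auto simp: eq bounded_iff)
  then obtain c where c: "\<And>s u x. s \<in> {1..T} \<Longrightarrow> u \<in> {1..T} \<Longrightarrow> x \<in> Rn T \<Longrightarrow> \<bar>hess s u x\<bar> \<le> c s u"
    by metis
  have "\<exists>L. \<forall>x\<in>Rn T. \<forall>y\<in>Rn T. \<bar>hess s u x - hess s u y\<bar> \<le> L * L2_set (\<lambda>i. x i - y i) {1..T}"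
    if "s \<in> {1..T}" "u \<in> {1..T}" for s u
    using Lip[OF that] by (auto simp: eq Lipschitz_Rn_def)
  then obtain l where l: "\<And>s u x y. s \<in> {1..T} \<Longrightarrow> u \<in> {1..T} \<Longrightarrow> x \<in> Rn T \<Longrightarrow> y \<in> Rn T \<Longrightarrow>
      \<bar>hess s u x - hess s u y\<bar> \<le> l s u * L2_set (\<lambda>i. x i - y i) {1..T}"
    by metis
  define C where "C = (\<Sum>s\<in>{1..T}. \<Sum>u\<in>{1..T}. \<bar>c s u\<bar>)"
  define L where "L = (\<Sum>s\<in>{1..T}. \<Sum>u\<in>{1..T}. \<bar>l s u\<bar>)"
  have le: "\<bar>f s u\<bar> \<le> (\<Sum>s\<in>{1..T}. \<Sum>u\<in>{1..T}. \<bar>f s u\<bar>)" if "s \<in> {1..T}" "u \<in> {1..T}" for f :: "nat \<Rightarrow> nat \<Rightarrow> real" and s u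
  proof -
    have "\<bar>f s u\<bar> \<le> (\<Sum>u\<in>{1..T}. \<bar>f s u\<bar>)" using that by (intro member_le_sum) auto
    also have "\<dots> \<le> (\<Sum>s\<in>{1..T}. \<Sum>u\<in>{1..T}. \<bar>f s u\<bar>)"
      using that by (intro member_le_sum[of s "{1..T}" "\<lambda>s. \<Sum>u\<in>{1..T}. \<bar>f s u\<bar>"] sum_nonneg) auto
    finally show ?thesis .
  qed
  show thesis
  proof (rule that[of C L])
    show "0 \<le> C" "0 \<le> L" by (auto simp: C_def L_def intro!: sum_nonneg)
  next
    fix s u x assume *: "s \<in> {1..T}" "u \<in> {1..T}" "x \<in> Rn T"
    show "\<bar>hess s u x\<bar> \<le> C" using c[OF *] le[OF *(1,2), of c] by (simp add: C_def)
    fix y assume y: "y \<in> Rn T"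
    have "\<bar>hess s u x - hess s u y\<bar> \<le> l s u * L2_set (\<lambda>i. x i - y i) {1..T}" by (rule l[OF * y])
    also have "\<dots> \<le> L * (\<Sum>i\<in>{1..T}. \<bar>x i - y i\<bar>)"
    proof (rule mult_mono)
      show "l s u \<le> L" using le[OF *(1,2), of l] by (simp add: L_def)
    qed (auto simp: L_def L2_set_le_sum_abs intro!: sum_nonneg)
    finally show "\<bar>hess s u x - hess s u y\<bar> \<le> L * (\<Sum>i\<in>{1..T}. \<bar>x i - y i\<bar>)" .
  qed
qed

lemma integrable_score:
  assumes u: "u \<in> {1..T}"
  shows "integrable (pi_measure T p) (\<lambda>x. (score u x)\<^sup>2)" "integrable (pi_measure T p) (score u)"
    "integrable (pi_measure T p) (\<lambda>x. ((score u x)\<^sup>2)\<^sup>2)"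
proof -
  interpret prob_space "pi_measure T p" by (rule prob_pi)
  have m[measurable]: "score u \<in> borel_measurable (pi_measure T p)"
    using measurable_derivs[OF u u] by (simp cong: measurable_cong_sets add: sets_pi)
  show 3: "integrable (pi_measure T p) (\<lambda>x. ((score u x)\<^sup>2)\<^sup>2)"
    using moment4[OF u] by simp
  show 2: "integrable (pi_measure T p) (\<lambda>x. (score u x)\<^sup>2)"
    by (rule square_integrable_imp_integrable[OF _ 3]) simp
  show "integrable (pi_measure T p) (score u)"
    by (rule square_integrable_imp_integrable[OF m 2])
qed

lemma integrable_hess:
  assumes u: "u \<in> {1..T}" and s: "s \<in> {1..T}"
  shows "integrable (pi_measure T p) (hess s u)" "integrable (pi_measure T p) (\<lambda>x. (hess s u x)\<^sup>2)"
proof -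
  interpret prob_space "pi_measure T p" by (rule prob_pi)
  obtain C L where C: "\<And>s u x. s \<in> {1..T} \<Longrightarrow> u \<in> {1..T} \<Longrightarrow> x \<in> Rn T \<Longrightarrow> \<bar>hess s u x\<bar> \<le> C"
    by (rule bound_Lip_exist) blast
  have m[measurable]: "hess s u \<in> borel_measurable (pi_measure T p)"
    using measurable_derivs[OF u s] by (simp cong: measurable_cong_sets add: sets_pi)
  show "integrable (pi_measure T p) (hess s u)"
    by (rule integrable_const_bound[of _ C]) (auto simp: space_pi intro!: AE_I2 C s u)
  show "integrable (pi_measure T p) (\<lambda>x. (hess s u x)\<^sup>2)"
    using C[OF s u]
    by (intro integrable_const_bound[of _ "C\<^sup>2"]) (auto simp: space_pi abs_le_square_iff[symmetric] intro!: AE_I2 power2_mono, meson abs_ge_self order_trans)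
qed

lemma integral_pi: "f \<in> borel_measurable lbT \<Longrightarrow> (\<integral>x. f x \<partial>pi_measure T p) = (\<integral>x. p x * f x \<partial>lbT)"
  and integrable_pi: "f \<in> borel_measurable lbT \<Longrightarrow> integrable (pi_measure T p) f \<longleftrightarrow> integrable lbT (\<lambda>x. p x * f x)"
  for f :: "(nat \<Rightarrow> real) \<Rightarrow> real"
  using p_nonneg by (simp_all add: pi_measure_def integral_density integrable_density)

text \<open>\<open>p\<close> times \<open>hess u u\<close> plus the squared score is the second
  partial derivative of \<open>p\<close>, that is, the derivative along the \<open>u\<close>-line of
  the integrable function \<open>pd u\<close>; hence it integrates to 0.\<close>

lemma integral_hess_diag:
  assumes u: "u \<in> {1..T}"
  shows "(\<integral>x. hess u u x \<partial>pi_measure T p) = - fisher T p u"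
proof -
  let ?P2 = "pderiv_at u (pd u)"
  let ?I = "{1..T} - {u}"
  have ins: "insert u ?I = {1..T}" "finite ?I" "u \<notin> ?I" using u by auto
  note m = measurable_derivs[OF u u]
  have P2: "?P2 x = p x * (hess u u x + (score u x)\<^sup>2)" if "x \<in> Rn T" for x
    using DERIV_score(2)[OF that u u, of "x u"] p_pos[OF that] by (simp add: power2_eq_square)
  have P1: "pd u x = p x * score u x" if "x \<in> Rn T" for x
    using score_eq[OF that u p_pos[OF that]] p_pos[OF that] by simp
  have I2: "integrable lbT ?P2"
  proof -
    have "integrable lbT (\<lambda>x. p x * (hess u u x + (score u x)\<^sup>2))"
      using m integrable_hess(1)[OF u u] integrable_score(1)[OF u] by (subst integrable_pi[symmetric]) auto
    also have "?this \<longleftrightarrow> integrable lbT (?P2)"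
      by (intro Bochner_Integration.integrable_cong refl) (auto simp: P2 space_lbT)
    finally show ?thesis .
  qed
  have I1: "integrable lbT (pd u)"
  proof -
    have "integrable lbT (\<lambda>x. p x * score u x)"
      using m integrable_score(2)[OF u] by (subst integrable_pi[symmetric]) auto
    also have "?this \<longleftrightarrow> integrable lbT (pd u)"
      by (intro Bochner_Integration.integrable_cong refl) (auto simp: P1 space_lbT)
    finally show ?thesis .
  qed
  interpret product_sigma_finite "\<lambda>_::nat. lborel :: real measure"
    by (simp add: product_sigma_finite_def sigma_finite_lborel)
  \<comment> \<open>Fubini's theorem gives integrability along almost every line, which is enough
    because the inner integral only has to vanish almost everywhere.\<close>
  have AE_slice: "AE x in PiM ?I (\<lambda>_. lborel). integrable lborel (\<lambda>y. f (x(u := y)))"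
    if f: "integrable lbT f" for f :: "(nat \<Rightarrow> real) \<Rightarrow> real"
  proof -
    have fm: "f \<in> borel_measurable (PiM (insert u ?I) (\<lambda>_. lborel))" using f ins by simp
    have fm2: "(\<lambda>(x, y). f (x(u := y))) \<in> borel_measurable (PiM ?I (\<lambda>_. lborel) \<Otimes>\<^sub>M lborel)"
      using measurable_compose[OF measurable_add_dim fm] by (simp add: split_def)
    have "(\<integral>\<^sup>+x. \<integral>\<^sup>+y. ennreal (norm (f (x(u := y)))) \<partial>lborel \<partial>PiM ?I (\<lambda>_. lborel))
      = (\<integral>\<^sup>+x. ennreal (norm (f x)) \<partial>PiM (insert u ?I) (\<lambda>_. lborel))"
      by (intro product_nn_integral_insert[symmetric] ins measurable_compose[OF fm]) simp
    also have "\<dots> < \<infinity>" using f ins by (simp add: integrable_iff_bounded)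
    finally have "AE x in PiM ?I (\<lambda>_. lborel). (\<integral>\<^sup>+y. ennreal (norm (f (x(u := y)))) \<partial>lborel) \<noteq> \<infinity>"
      using fm2 by (intro nn_integral_PInf_AE lborel.borel_measurable_nn_integral) (auto simp: split_def)
    with AE_space show ?thesis
    proof eventually_elim
      case (elim x)
      have "(\<lambda>y. f (x(u := y))) \<in> borel_measurable lborel"
        using measurable_compose_Pair1[OF elim(1) fm2] by simp
      then show ?case using elim(2) by (simp add: integrable_iff_bounded less_top)
    qed
  qed
  have "(\<integral>x. ?P2 x \<partial>lbT) = (\<integral>x. (\<integral>y. ?P2 (x(u := y)) \<partial>lborel) \<partial>PiM ?I (\<lambda>_. lborel))"
    using product_integral_insert[OF ins(2,3), of ?P2] I2 by (simp only: ins(1))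
  also have "\<dots> = (\<integral>x. 0 \<partial>PiM ?I (\<lambda>_. lborel :: real measure))"
  proof (rule Bochner_Integration.integral_cong_AE)
    have "?P2 \<in> borel_measurable (PiM (insert u ?I) (\<lambda>_. lborel))" using m(2) ins by simp
    from measurable_compose[OF measurable_add_dim this]
    show "(\<lambda>x. \<integral>y. ?P2 (x(u := y)) \<partial>lborel) \<in> borel_measurable (PiM ?I (\<lambda>_. lborel))"
      by (intro lborel.borel_measurable_lebesgue_integral) (simp add: split_def)
    show "AE x in PiM ?I (\<lambda>_. lborel). (\<integral>y. ?P2 (x(u := y)) \<partial>lborel) = 0"
      using AE_slice[OF I1] AE_slice[OF I2] AE_space
    proof eventually_elim
      case (elim x)
      \<comment> \<open>A point of the product over the other coordinates has no genuine value at
        \<open>u\<close>; 0 is a placeholder that every later update overwrites.\<close>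
      have x0: "x(u := 0) \<in> Rn T"
        using elim(3) u by (auto simp: space_PiM Rn_def PiE_iff extensional_def)
      show ?case
      proof (rule integral_derivative_eq_0[OF _ _ elim(1,2)])
        show "((\<lambda>y. pd u (x(u := y))) has_real_derivative ?P2 (x(u := r))) (at r)" for r
          using DERIV_pd[OF x0 u u, of r] by simp
        show "continuous_on UNIV (\<lambda>y. ?P2 (x(u := y)))"
          using continuous_on_Rn_line[OF C2_facts(4)[OF u u] x0 u] by simp
      qed
    qed
  qed simp
  finally have "0 = (\<integral>x. ?P2 x \<partial>lbT)" by simp
  also have "\<dots> = (\<integral>x. p x * (hess u u x + (score u x)\<^sup>2) \<partial>lbT)"
    by (intro Bochner_Integration.integral_cong refl) (simp add: P2 space_lbT)
  also have "\<dots> = (\<integral>x. hess u u x + (score u x)\<^sup>2 \<partial>pi_measure T p)"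
    using m by (subst integral_pi) auto
  also have "\<dots> = (\<integral>x. hess u u x \<partial>pi_measure T p) + fisher T p u"
    unfolding fisher_def by (intro Bochner_Integration.integral_add integrable_hess u integrable_score)
  finally show ?thesis by linarith
qed

end

section \<open>Bounds in the first mean and selection laws\<close>

lemma integral_PiM_mult:
  fixes f g :: "'a \<Rightarrow> real"
  assumes I: "finite I" and M: "\<And>i. prob_space (M i)" and ij: "i \<in> I" "j \<in> I" "i \<noteq> j"
    and f: "integrable (M i) f" and g: "integrable (M j) g"
  shows "integrable (PiM I M) (\<lambda>x. f (x i) * g (x j))"
    and "(\<integral>x. f (x i) * g (x j) \<partial>PiM I M) = (\<integral>x. f x \<partial>M i) * (\<integral>x. g x \<partial>M j)"
proof -
  interpret product_sigma_finite M
    using M by (simp add: product_sigma_finite_def prob_space_imp_sigma_finite)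
  define \<phi> where "\<phi> k x = (if k = i then f x else 1) * (if k = j then g x else 1)" for k x
  have \<phi>: "integrable (M k) (\<phi> k)" for k
  proof -
    interpret prob_space "M k" by (rule M)
    show ?thesis using f g ij unfolding \<phi>_def[abs_def] by (cases "k = i"; cases "k = j") auto
  qed
  have rw: "f (x i) * g (x j) = (\<Prod>k\<in>I. \<phi> k (x k))" for x
    using I ij by (simp add: \<phi>_def prod.distrib)
  show "integrable (PiM I M) (\<lambda>x. f (x i) * g (x j))"
    unfolding rw by (intro product_integrable_prod I \<phi>)
  have "(\<integral>x. f (x i) * g (x j) \<partial>PiM I M) = (\<Prod>k\<in>I. \<integral>x. \<phi> k x \<partial>M k)"
    unfolding rw by (intro product_integral_prod I \<phi>)
  also have "\<dots> = (\<Prod>k\<in>I. (if k = i then \<integral>x. f x \<partial>M i else 1) * (if k = j then \<integral>x. g x \<partial>M j else 1))"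
    using ij by (intro prod.cong refl) (auto simp: \<phi>_def prob_space.prob_space[OF M])
  also have "\<dots> = (\<integral>x. f x \<partial>M i) * (\<integral>x. g x \<partial>M j)"
    using I ij by (simp add: prod.distrib)
  finally show "(\<integral>x. f (x i) * g (x j) \<partial>PiM I M) = (\<integral>x. f x \<partial>M i) * (\<integral>x. g x \<partial>M j)" .
qed

text \<open>Integrability is part of the notion because the Bochner integral of a non-integrable
  function is 0, so that the inequality alone would say nothing.\<close>

definition L1_le :: "'a measure \<Rightarrow> ('a \<Rightarrow> real) \<Rightarrow> real \<Rightarrow> bool" where
  "L1_le M f b \<longleftrightarrow> integrable M f \<and> (\<integral>x. \<bar>f x\<bar> \<partial>M) \<le> b"

lemma L1_leD: "L1_le M f b \<Longrightarrow> integrable M f" "L1_le M f b \<Longrightarrow> (\<integral>x. \<bar>f x\<bar> \<partial>M) \<le> b"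
  by (auto simp: L1_le_def)

lemma L1_le_mono: "L1_le M f a \<Longrightarrow> a \<le> b \<Longrightarrow> L1_le M f b"
  by (auto simp: L1_le_def)

lemma L1_le_zero: "0 \<le> b \<Longrightarrow> L1_le M (\<lambda>_. 0) b"
  by (simp add: L1_le_def)

lemma L1_le_dominated:
  assumes g: "L1_le M g b" and f: "f \<in> borel_measurable M"
    and le: "\<And>x. x \<in> space M \<Longrightarrow> \<bar>f x\<bar> \<le> \<bar>g x\<bar>"
  shows "L1_le M f b"
proof -
  have I: "integrable M f"
    using g f le by (auto simp: L1_le_def intro: Bochner_Integration.integrable_bound[of M g])
  have "(\<integral>x. \<bar>f x\<bar> \<partial>M) \<le> (\<integral>x. \<bar>g x\<bar> \<partial>M)"
    using I g le by (intro integral_mono) (auto simp: L1_le_def)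
  with I g show ?thesis by (auto simp: L1_le_def)
qed

lemma L1_le_add:
  assumes "L1_le M f a" "L1_le M g b"
  shows "L1_le M (\<lambda>x. f x + g x) (a + b)"
proof -
  have "(\<integral>x. \<bar>f x + g x\<bar> \<partial>M) \<le> (\<integral>x. \<bar>f x\<bar> + \<bar>g x\<bar> \<partial>M)"
    using assms by (intro integral_mono) (auto simp: L1_le_def)
  also have "\<dots> = (\<integral>x. \<bar>f x\<bar> \<partial>M) + (\<integral>x. \<bar>g x\<bar> \<partial>M)"
    using assms by (intro Bochner_Integration.integral_add) (auto simp: L1_le_def)
  finally show ?thesis using assms by (auto simp: L1_le_def)
qed

lemma L1_le_sum:
  assumes "\<And>i. i \<in> I \<Longrightarrow> L1_le M (f i) (b i)"
  shows "L1_le M (\<lambda>x. \<Sum>i\<in>I. f i x) (\<Sum>i\<in>I. b i)"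
proof (cases "finite I")
  case True
  then show ?thesis using assms
    by (induction I rule: finite_induct) (auto intro: L1_le_zero L1_le_add)
qed (simp add: L1_le_zero)

lemma L1_le_cmult: "L1_le M f b \<Longrightarrow> L1_le M (\<lambda>x. c * f x) (\<bar>c\<bar> * b)"
  by (auto simp: L1_le_def abs_mult mult_left_mono)

lemma (in prob_space) L1_le_const: "\<bar>c\<bar> \<le> b \<Longrightarrow> L1_le M (\<lambda>_. c) b"
  by (simp add: L1_le_def prob_space)

lemma (in prob_space) L1_le_sqrt:
  assumes "X \<in> borel_measurable M" "integrable M (\<lambda>x. (X x)\<^sup>2)" "expectation (\<lambda>x. (X x)\<^sup>2) \<le> b"
  shows "L1_le M X (sqrt b)"
  using expectation_abs_le_sqrt[OF assms(1,2)] assms(3)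
  by (auto simp: L1_le_def intro: order_trans real_sqrt_le_mono)

text \<open>Changing all exponents by at most \<open>e\<close> scales numerator and denominator by
  factors between \<open>exp (- e)\<close> and \<open>exp e\<close>, so the second quotient is at
  least \<open>exp (- 2 * e)\<close> times the first. The rest is
  \<open>exp (- 2 * e) \<ge> 1 - 2 * e\<close> and the fact that a quotient is at most 1.\<close>

lemma softmax_le:
  fixes H H' :: "'k \<Rightarrow> real"
  assumes I: "finite I" and k: "k \<in> I" and e: "\<And>l. l \<in> I \<Longrightarrow> \<bar>H l - H' l\<bar> \<le> e"
  shows "exp (H k) / (\<Sum>l\<in>I. exp (H l)) - exp (H' k) / (\<Sum>l\<in>I. exp (H' l)) \<le> 2 * e"
proof -
  let ?Z = "\<Sum>l\<in>I. exp (H l)" and ?Z' = "\<Sum>l\<in>I. exp (H' l)"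
  have Z: "0 < ?Z" "0 < ?Z'" using I k by (auto intro!: sum_pos)
  define q where "q = exp (H k) / ?Z"
  have q: "0 \<le> q" "q \<le> 1"
    using Z member_le_sum[of k I "\<lambda>l. exp (H l)"] I k by (auto simp: q_def)
  have le: "?Z' \<le> exp e * ?Z"
    unfolding sum_distrib_left
  proof (rule sum_mono)
    fix l assume "l \<in> I"
    then have "exp (H' l) \<le> exp (e + H l)" using e[of l] by simp
    then show "exp (H' l) \<le> exp e * exp (H l)" by (simp add: exp_add)
  qed
  have "exp (H k) * exp (- e) \<le> exp (H' k)"
    using e[OF k] by (simp add: exp_add[symmetric])
  then have "exp (- e) * exp (H k) / (exp e * ?Z) \<le> exp (H' k) / ?Z'"
    using le Z by (intro frac_le) (auto simp: mult.commute)
  moreover have "exp (- e) * exp (H k) / (exp e * ?Z) = exp (- 2 * e) * q"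
    by (simp add: q_def exp_minus exp_double power2_eq_square divide_simps)
  moreover have "(1 - 2 * e) * q \<le> exp (- 2 * e) * q"
    using q exp_ge_add_one_self[of "- 2 * e"] by (intro mult_right_mono) auto
  moreover have "0 \<le> e" using e[OF k] by linarith
  then have "2 * e * q \<le> 2 * e" using q by (simp add: mult_left_le)
  ultimately show ?thesis by (simp add: q_def[symmetric] algebra_simps)
qed

text \<open>The sum of the differences stands in for their maximum because it can be integrated term
  by term against L1 bounds.\<close>

lemma softmax_Lipschitz:
  fixes H H' :: "'k \<Rightarrow> real"
  assumes "finite I" "k \<in> I"
  shows "\<bar>exp (H k) / (\<Sum>l\<in>I. exp (H l)) - exp (H' k) / (\<Sum>l\<in>I. exp (H' l))\<bar> \<le> 2 * (\<Sum>l\<in>I. \<bar>H l - H' l\<bar>)"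
proof -
  have e: "\<bar>H l - H' l\<bar> \<le> (\<Sum>l\<in>I. \<bar>H l - H' l\<bar>)" if "l \<in> I" for l
    using that assms by (intro member_le_sum) auto
  show ?thesis
    using softmax_le[of I k H H', OF assms e] softmax_le[of I k H' H "\<Sum>l\<in>I. \<bar>H l - H' l\<bar>", OF assms] e
    by (simp add: abs_minus_commute abs_le_iff)
qed

section \<open>The law of the selected index vector\<close>

lemma finite_indices[simp]: "finite (indices T N)"
  by (auto simp: indices_def intro!: finite_PiE)

text \<open>Integrating out \<omega> leaves a discrete law on the finite set
  \<open>indices T N\<close>, whose weights are the integrals of \<open>q\<close>. Joint
  measurability follows from measurability for each \<open>k\<close>, the index set being
  countable.\<close>

lemma
  fixes P :: "'w measure"
  assumes P: "prob_space P" and q: "\<And>k. k \<in> indices T N \<Longrightarrow> integrable P (\<lambda>\<omega>. q \<omega> k)"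
    and q0: "\<And>\<omega> k. \<omega> \<in> space P \<Longrightarrow> k \<in> indices T N \<Longrightarrow> 0 \<le> q \<omega> k" and A: "A \<subseteq> indices T N"
  shows measure_select_law: "measure (select_law T N P q) {z \<in> space (select_law T N P q). snd z \<in> A}
      = (\<Sum>k\<in>A. \<integral>\<omega>. q \<omega> k \<partial>P)"
    and measure_K_law: "measure (K_law T N (select_law T N P q)) A = (\<Sum>k\<in>A. \<integral>\<omega>. q \<omega> k \<partial>P)"
proof -
  let ?C = "count_space (indices T N)" and ?Q = "select_law T N P q"
  interpret P: prob_space P by fact
  interpret C: sigma_finite_measure ?C
    by (rule sigma_finite_measure_count_space_finite) simp
  have ctb: "countable (indices T N)" by (rule countable_finite) simp
  have finA: "finite A" using A by (rule finite_subset) simp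
  have qm: "(\<lambda>(\<omega>, k). ennreal (q \<omega> k)) \<in> borel_measurable (P \<Otimes>\<^sub>M ?C)"
  proof -
    have "(\<lambda>z. ennreal (q (fst z) (snd z))) \<in> borel_measurable (P \<Otimes>\<^sub>M ?C)"
      by (rule measurable_compose_countable'[where f="\<lambda>k z. ennreal (q (fst z) k)" and g=snd, OF _ _ ctb])
         (use q in \<open>auto intro!: measurable_compose[OF measurable_fst]\<close>)
    then show ?thesis by (simp add: split_def)
  qed
  have sp: "space ?Q = space P \<times> indices T N"
    by (simp add: select_law_def space_pair_measure)
  have eq: "{z \<in> space ?Q. snd z \<in> A} = space P \<times> A" using A sp by auto
  have sA: "space P \<times> A \<in> sets (P \<Otimes>\<^sub>M ?C)"
    using A by (intro pair_measureI) auto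
  have "emeasure ?Q (space P \<times> A) = (\<integral>\<^sup>+z. (case z of (\<omega>, k) \<Rightarrow> ennreal (q \<omega> k)) * indicator (space P \<times> A) z \<partial>(P \<Otimes>\<^sub>M ?C))"
    unfolding select_law_def by (rule emeasure_density[OF qm sA])
  also have "\<dots> = (\<integral>\<^sup>+\<omega>. (\<integral>\<^sup>+k. ennreal (q \<omega> k) * indicator (space P \<times> A) (\<omega>, k) \<partial>?C) \<partial>P)"
    using qm sA by (subst C.nn_integral_fst[symmetric]) auto
  also have "\<dots> = (\<integral>\<^sup>+\<omega>. (\<Sum>k\<in>A. ennreal (q \<omega> k)) \<partial>P)"
  proof (rule nn_integral_cong)
    fix \<omega> assume w: "\<omega> \<in> space P"
    have "(\<integral>\<^sup>+k. ennreal (q \<omega> k) * indicator (space P \<times> A) (\<omega>, k) \<partial>?C)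
      = (\<Sum>k\<in>indices T N. ennreal (q \<omega> k) * indicator A k)"
      using w by (simp add: nn_integral_count_space_finite indicator_def)
    also have "\<dots> = (\<Sum>k\<in>A. ennreal (q \<omega> k))"
      using A by (intro sum.mono_neutral_cong_right) auto
    finally show "(\<integral>\<^sup>+k. ennreal (q \<omega> k) * indicator (space P \<times> A) (\<omega>, k) \<partial>?C) = (\<Sum>k\<in>A. ennreal (q \<omega> k))" .
  qed
  also have "\<dots> = (\<Sum>k\<in>A. \<integral>\<^sup>+\<omega>. ennreal (q \<omega> k) \<partial>P)"
    using q A by (intro nn_integral_sum) auto
  also have "\<dots> = (\<Sum>k\<in>A. ennreal (\<integral>\<omega>. q \<omega> k \<partial>P))"
    using q q0 A by (intro sum.cong refl nn_integral_eq_integral) auto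
  also have "\<dots> = ennreal (\<Sum>k\<in>A. \<integral>\<omega>. q \<omega> k \<partial>P)"
    using q0 A by (intro sum_ennreal Bochner_Integration.integral_nonneg) auto
  finally have em: "emeasure ?Q (space P \<times> A) = ennreal (\<Sum>k\<in>A. \<integral>\<omega>. q \<omega> k \<partial>P)" .
  have nn: "0 \<le> (\<Sum>k\<in>A. \<integral>\<omega>. q \<omega> k \<partial>P)"
    using q0 A by (intro sum_nonneg Bochner_Integration.integral_nonneg) auto
  show 1: "measure ?Q {z \<in> space ?Q. snd z \<in> A} = (\<Sum>k\<in>A. \<integral>\<omega>. q \<omega> k \<partial>P)"
    unfolding eq by (simp add: measure_def em nn)
  have "snd \<in> measurable ?Q ?C"
    unfolding select_law_def by (simp add: measurable_snd)
  then have "measure (K_law T N ?Q) A = measure ?Q (snd -` A \<inter> space ?Q)"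
    unfolding K_law_def using A by (intro measure_distr) auto
  also have "snd -` A \<inter> space ?Q = {z \<in> space ?Q. snd z \<in> A}" by auto
  finally show "measure (K_law T N ?Q) A = (\<Sum>k\<in>A. \<integral>\<omega>. q \<omega> k \<partial>P)" using 1 by simp
qed

lemma accept_prob_select_law:
  assumes P: "prob_space P" and q: "\<And>k. k \<in> indices T N \<Longrightarrow> integrable P (\<lambda>\<omega>. q \<omega> k)"
    and q0: "\<And>\<omega> k. \<omega> \<in> space P \<Longrightarrow> k \<in> indices T N \<Longrightarrow> 0 \<le> q \<omega> k"
  shows "accept_prob (select_law T N P q) t = (\<Sum>k | k \<in> indices T N \<and> k t \<noteq> 0. \<integral>\<omega>. q \<omega> k \<partial>P)"
proof -
  have "{z \<in> space (select_law T N P q). snd z t \<noteq> 0}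
    = {z \<in> space (select_law T N P q). snd z \<in> {k \<in> indices T N. k t \<noteq> 0}}"
    by (auto simp: select_law_def space_pair_measure)
  then show ?thesis
    unfolding accept_prob_def using measure_select_law[OF P q q0, where A="{k \<in> indices T N. k t \<noteq> 0}"] by auto
qed

text \<open>Both quantities compare sums of the same integrals over a subset of
  \<open>indices T N\<close>: an arbitrary event for total variation,
  \<open>{k. k t \<noteq> 0}\<close> for acceptance. A bound for single index vectors therefore
  serves both.\<close>

lemma
  assumes P: "prob_space P" and q: "\<And>k. k \<in> indices T N \<Longrightarrow> integrable P (\<lambda>\<omega>. q \<omega> k)"
    and q0: "\<And>\<omega> k. \<omega> \<in> space P \<Longrightarrow> k \<in> indices T N \<Longrightarrow> 0 \<le> q \<omega> k"
    and P': "prob_space P'" and q': "\<And>k. k \<in> indices T N \<Longrightarrow> integrable P' (\<lambda>\<omega>. q' \<omega> k)"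
    and q0': "\<And>\<omega> k. \<omega> \<in> space P' \<Longrightarrow> k \<in> indices T N \<Longrightarrow> 0 \<le> q' \<omega> k"
    and diff: "\<And>k. k \<in> indices T N \<Longrightarrow> \<bar>(\<integral>\<omega>. q \<omega> k \<partial>P) - (\<integral>\<omega>. q' \<omega> k \<partial>P')\<bar> \<le> b"
  shows tv_dist_K_law_le: "tv_dist (K_law T N (select_law T N P q)) (K_law T N (select_law T N P' q'))
      \<le> real (card (indices T N)) * b"
    and accept_prob_diff_le: "\<bar>accept_prob (select_law T N P q) t - accept_prob (select_law T N P' q') t\<bar>
      \<le> real (card (indices T N)) * b"
proof -
  have le: "\<bar>(\<Sum>k\<in>A. \<integral>\<omega>. q \<omega> k \<partial>P) - (\<Sum>k\<in>A. \<integral>\<omega>. q' \<omega> k \<partial>P')\<bar> \<le> real (card (indices T N)) * b"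
    if A: "A \<subseteq> indices T N" for A
  proof -
    have "\<bar>(\<Sum>k\<in>A. \<integral>\<omega>. q \<omega> k \<partial>P) - (\<Sum>k\<in>A. \<integral>\<omega>. q' \<omega> k \<partial>P')\<bar>
      \<le> (\<Sum>k\<in>A. \<bar>(\<integral>\<omega>. q \<omega> k \<partial>P) - (\<integral>\<omega>. q' \<omega> k \<partial>P')\<bar>)"
      unfolding sum_subtractf[symmetric] by (rule sum_abs)
    also have "\<dots> \<le> (\<Sum>k\<in>indices T N. \<bar>(\<integral>\<omega>. q \<omega> k \<partial>P) - (\<integral>\<omega>. q' \<omega> k \<partial>P')\<bar>)"
      by (intro sum_mono2 A) auto
    also have "\<dots> \<le> (\<Sum>k\<in>indices T N. b)" by (intro sum_mono diff)
    finally show ?thesis by simp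
  qed
  show "tv_dist (K_law T N (select_law T N P q)) (K_law T N (select_law T N P' q')) \<le> real (card (indices T N)) * b"
    unfolding tv_dist_def
  proof (rule cSUP_least)
    fix A assume "A \<in> sets (K_law T N (select_law T N P q))"
    then have A: "A \<subseteq> indices T N" by (simp add: K_law_def)
    show "\<bar>measure (K_law T N (select_law T N P q)) A - measure (K_law T N (select_law T N P' q')) A\<bar>
        \<le> real (card (indices T N)) * b"
      using le[OF A] measure_K_law[OF P q q0 A] measure_K_law[OF P' q' q0' A] by simp
  qed auto
  show "\<bar>accept_prob (select_law T N P q) t - accept_prob (select_law T N P' q') t\<bar> \<le> real (card (indices T N)) * b"
    using accept_prob_select_law[OF P q q0, where t=t] accept_prob_select_law[OF P' q' q0', where t=t]
      le[of "{k \<in> indices T N. k t \<noteq> 0}"] by simp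
qed

section \<open>The law of large numbers for the target\<close>

definition col ::
  "nat \<Rightarrow> (nat \<Rightarrow> nat \<Rightarrow> real) \<Rightarrow> nat \<Rightarrow> nat \<Rightarrow> real" where
  "col T x d = (\<lambda>t\<in>{1..T}. x t d)"

definition avg ::
  "nat \<Rightarrow> nat \<Rightarrow> ((nat \<Rightarrow> real) \<Rightarrow> real) \<Rightarrow> (nat \<Rightarrow> nat \<Rightarrow> real) \<Rightarrow> real" where
  "avg T D \<phi> x = (\<Sum>d\<in>{1..D}. \<phi> (col T x d)) / real D"

text \<open>D^(-1/4): it tends to 0, while \<open>D\<close> times its square is
  \<open>sqrt D\<close> and still diverges, as Chebyshev's inequality requires.\<close>

definition tol :: "nat \<Rightarrow> real" where "tol D = inverse (sqrt (sqrt (real D)))"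

lemma col_Rn: "col T x d \<in> Rn T"
  by (simp add: col_def Rn_def)

lemma tol_nonneg: "0 \<le> tol D" by (simp add: tol_def)

lemma tol_pos: "D \<ge> 1 \<Longrightarrow> 0 < tol D" by (simp add: tol_def)

lemma tol_square: "real D * (tol D)\<^sup>2 = sqrt (real D)"
  by (simp add: tol_def power_inverse real_div_sqrt flip: divide_inverse)

lemma sqrt_of_nat_at_top: "filterlim (\<lambda>D. sqrt (real D)) at_top sequentially"
  by (rule filterlim_compose[OF sqrt_at_top filterlim_real_sequentially])

lemma tol_tendsto_0: "tol \<longlonglongrightarrow> 0"
  unfolding tol_def[abs_def]
  by (rule tendsto_inverse_0_at_top[OF filterlim_compose[OF sqrt_at_top sqrt_of_nat_at_top]])

lemma measurable_col:
  assumes d: "d \<in> {1..D}"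
  shows "(\<lambda>x. col T x d) \<in> measurable (\<Pi>\<^sub>M t\<in>{1..T}. \<Pi>\<^sub>M d\<in>{1..D}. lborel) (\<Pi>\<^sub>M t\<in>{1..T}. lborel)"
  unfolding col_def by (intro measurable_restrict measurable_PiM_component2 d)

lemma measurable_avg:
  assumes "\<phi> \<in> borel_measurable (\<Pi>\<^sub>M t\<in>{1..T}. lborel)"
  shows "avg T D \<phi> \<in> borel_measurable (\<Pi>\<^sub>M t\<in>{1..T}. \<Pi>\<^sub>M d\<in>{1..D}. lborel)"
  unfolding avg_def[abs_def]
  by (intro borel_measurable_divide borel_measurable_sum measurable_compose[OF measurable_col assms]) auto

lemma sets_PiM_PiM_borel:
  "sets (\<Pi>\<^sub>M t\<in>{1..T}. \<Pi>\<^sub>M d\<in>{1..D}. (borel :: real measure)) = sets (\<Pi>\<^sub>M t\<in>{1..T}. \<Pi>\<^sub>M d\<in>{1..D}. lborel)"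
  by (intro sets_PiM_cong) auto

context smooth_target
begin

text \<open>After transposition the array consists of \<open>D\<close> independent trajectories with
  law \<open>pi_measure T p\<close>, so averages over components are averages of independent
  variables.\<close>

lemma target_measure_eq:
  "target_measure T D p = distr (\<Pi>\<^sub>M d\<in>{1..D}. pi_measure T p) (\<Pi>\<^sub>M t\<in>{1..T}. \<Pi>\<^sub>M d\<in>{1..D}. lborel)
     (\<lambda>y. \<lambda>t\<in>{1..T}. \<lambda>d\<in>{1..D}. y d t)"
proof -
  let ?N = "\<Pi>\<^sub>M t\<in>{1..T}. \<Pi>\<^sub>M d\<in>{1..D}. (lborel :: real measure)"
  let ?sw = "\<lambda>y. \<lambda>t\<in>{1..T}. \<lambda>d\<in>{1..D}. y d t"
  let ?h = "\<lambda>x. ennreal (target_density T D p x)"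
  have sw: "?sw \<in> measurable (\<Pi>\<^sub>M d\<in>{1..D}. lbT) ?N"
    by (intro measurable_restrict measurable_PiM_component2)
  have h: "?h \<in> borel_measurable ?N"
    unfolding target_density_def col_def[symmetric]
    by (intro measurable_compose[OF _ measurable_ennreal] borel_measurable_prod measurable_compose[OF measurable_col p_meas])
  have sfT: "sigma_finite_measure lbT"
    by (intro product_sigma_finite.sigma_finite) (auto simp: product_sigma_finite_def sigma_finite_lborel)
  have "target_measure T D p = density (distr (\<Pi>\<^sub>M d\<in>{1..D}. lbT) ?N ?sw) ?h"
    unfolding target_measure_def by (subst distr_PiM_swap[OF sigma_finite_lborel]) auto
  also have "\<dots> = distr (density (\<Pi>\<^sub>M d\<in>{1..D}. lbT) (\<lambda>y. ?h (?sw y))) ?N ?sw"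
    by (rule density_distr[OF h sw])
  also have "density (\<Pi>\<^sub>M d\<in>{1..D}. lbT) (\<lambda>y. ?h (?sw y)) = density (\<Pi>\<^sub>M d\<in>{1..D}. lbT) (\<lambda>y. \<Prod>d\<in>{1..D}. ennreal (p (y d)))"
  proof (rule density_cong)
    show "(\<lambda>y. ?h (?sw y)) \<in> borel_measurable (\<Pi>\<^sub>M d\<in>{1..D}. lbT)"
      by (rule measurable_compose[OF sw h])
    show "(\<lambda>y. \<Prod>d\<in>{1..D}. ennreal (p (y d))) \<in> borel_measurable (\<Pi>\<^sub>M d\<in>{1..D}. lbT)"
      by measurable
    show "AE y in \<Pi>\<^sub>M d\<in>{1..D}. lbT. ?h (?sw y) = (\<Prod>d\<in>{1..D}. ennreal (p (y d)))"
    proof (rule AE_I2)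
      fix y assume y: "y \<in> space (\<Pi>\<^sub>M d\<in>{1..D}. lbT)"
      have "(\<lambda>t\<in>{1..T}. ?sw y t d) = y d" if "d \<in> {1..D}" for d
        using y that by (auto simp: space_PiM PiE_iff extensional_def fun_eq_iff)
      then have "target_density T D p (?sw y) = (\<Prod>d\<in>{1..D}. p (y d))"
        unfolding target_density_def by (intro prod.cong refl) simp
      then show "?h (?sw y) = (\<Prod>d\<in>{1..D}. ennreal (p (y d)))"
        by (simp add: prod_ennreal p_nonneg)
    qed
  qed
  also have "\<dots> = (\<Pi>\<^sub>M d\<in>{1..D}. pi_measure T p)"
    unfolding pi_measure_def using prob_space_imp_sigma_finite[OF prob_pi]
    by (intro PiM_density[symmetric] sfT) (auto simp: pi_measure_def)
  finally show ?thesis .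
qed

lemma prob_target: "prob_space (target_measure T D p)"
  unfolding target_measure_eq
  by (intro prob_space.prob_space_distr prob_space_PiM prob_pi measurable_restrict)
     (auto intro: measurable_PiM_component2 simp: sets_pi cong: measurable_cong_sets sets_PiM_cong)

text \<open>The centred sum has second moment \<open>D * V\<close>, where \<open>V\<close> is the
  variance of one summand, and the threshold is \<open>D * tol D\<close>; Chebyshev's inequality
  leaves \<open>V\<close> divided by \<open>sqrt D\<close>.\<close>

lemma LLN_rate:
  assumes \<phi>[measurable]: "\<phi> \<in> borel_measurable lbT" and i1: "integrable (pi_measure T p) \<phi>"
    and i2: "integrable (pi_measure T p) (\<lambda>x. (\<phi> x)\<^sup>2)" and c: "(\<integral>x. \<phi> x \<partial>pi_measure T p) = c" and D: "D \<ge> 1"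
  shows "measure (target_measure T D p) {x \<in> space (target_measure T D p). tol D \<le> \<bar>avg T D \<phi> x - c\<bar>}
    \<le> (\<integral>x. (\<phi> x - c)\<^sup>2 \<partial>pi_measure T p) / sqrt (real D)"
proof -
  let ?P = "\<Pi>\<^sub>M d\<in>{1..D}. pi_measure T p"
  let ?N = "\<Pi>\<^sub>M t\<in>{1..T}. \<Pi>\<^sub>M d\<in>{1..D}. (lborel :: real measure)"
  let ?sw = "\<lambda>y. \<lambda>t\<in>{1..T}. \<lambda>d\<in>{1..D}. y d t"
  let ?V = "\<integral>x. (\<phi> x - c)\<^sup>2 \<partial>pi_measure T p"
  interpret pi: prob_space "pi_measure T p" by (rule prob_pi)
  interpret P: prob_space ?P by (intro prob_space_PiM prob_pi)
  have sP: "sets ?P = sets (\<Pi>\<^sub>M d\<in>{1..D}. lbT)" by (intro sets_PiM_cong) (auto simp: sets_pi)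
  have sw: "?sw \<in> measurable ?P ?N"
    unfolding measurable_cong_sets[OF sP refl] by (intro measurable_restrict measurable_PiM_component2)
  have \<phi>pi[measurable]: "\<phi> \<in> borel_measurable (pi_measure T p)"
    by (simp add: measurable_cong_sets[OF sets_pi refl])
  have i0: "integrable (pi_measure T p) (\<lambda>x. \<phi> x - c)" using i1 by simp
  have i3: "integrable (pi_measure T p) (\<lambda>x. (\<phi> x - c)\<^sup>2)"
    using i1 i2 by (simp add: power2_diff)
  have z: "(\<integral>x. \<phi> x - c \<partial>pi_measure T p) = 0"
    using i1 c by (simp add: pi.prob_space)
  have sm: "integrable ?P (\<lambda>y. (\<Sum>d\<in>{1..D}. \<phi> (y d) - c)\<^sup>2)"
    "(\<integral>y. (\<Sum>d\<in>{1..D}. \<phi> (y d) - c)\<^sup>2 \<partial>?P) = real D * ?V"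
    using PiM_centered_sum_second_moment[of "{1..D}" "\<lambda>_. pi_measure T p" "\<lambda>_ x. \<phi> x - c", OF _ prob_pi i0 i3 z] by simp_all
  have [measurable]: "avg T D \<phi> \<in> borel_measurable ?N" by (rule measurable_avg[OF \<phi>])
  have "measure (target_measure T D p) {x \<in> space (target_measure T D p). tol D \<le> \<bar>avg T D \<phi> x - c\<bar>}
    = measure ?P (?sw -` {x \<in> space ?N. tol D \<le> \<bar>avg T D \<phi> x - c\<bar>} \<inter> space ?P)"
    unfolding target_measure_eq by (subst measure_distr[OF sw]) auto
  also have "?sw -` {x \<in> space ?N. tol D \<le> \<bar>avg T D \<phi> x - c\<bar>} \<inter> space ?P
    = {y \<in> space ?P. real D * tol D \<le> \<bar>\<Sum>d\<in>{1..D}. \<phi> (y d) - c\<bar>}"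
  proof -
    have "(tol D \<le> \<bar>avg T D \<phi> (?sw y) - c\<bar>) = (real D * tol D \<le> \<bar>\<Sum>d\<in>{1..D}. \<phi> (y d) - c\<bar>)"
      if y: "y \<in> space ?P" for y
    proof -
      have "col T (?sw y) d = y d" if "d \<in> {1..D}" for d
        using y that by (auto simp: space_PiM space_pi Rn_def PiE_iff extensional_def fun_eq_iff col_def)
      then have "avg T D \<phi> (?sw y) - c = (\<Sum>d\<in>{1..D}. \<phi> (y d) - c) / real D"
        using D by (simp add: avg_def sum_subtractf field_simps)
      then have "\<bar>avg T D \<phi> (?sw y) - c\<bar> = \<bar>\<Sum>d\<in>{1..D}. \<phi> (y d) - c\<bar> / real D"
        by (simp only: abs_divide abs_of_nat)
      then show ?thesis using D by (simp add: pos_le_divide_eq mult.commute)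
    qed
    then show ?thesis using measurable_space[OF sw] by auto
  qed
  also have "measure ?P \<dots> \<le> (\<integral>y. (\<Sum>d\<in>{1..D}. \<phi> (y d) - c)\<^sup>2 \<partial>?P) / (real D * tol D)\<^sup>2"
    using D tol_pos[OF D] sm(1) by (intro P.second_moment_method) auto
  also have "\<dots> = ?V / (real D * (tol D)\<^sup>2)"
    unfolding sm(2) using D by (simp add: power2_eq_square)
  finally show ?thesis by (simp add: tol_square)
qed

lemma LLN:
  assumes "\<phi> \<in> borel_measurable lbT" "integrable (pi_measure T p) \<phi>"
    "integrable (pi_measure T p) (\<lambda>x. (\<phi> x)\<^sup>2)" "(\<integral>x. \<phi> x \<partial>pi_measure T p) = c"
  shows "(\<lambda>D. measure (target_measure T D p) {x \<in> space (target_measure T D p). tol D \<le> \<bar>avg T D \<phi> x - c\<bar>}) \<longlonglongrightarrow> 0"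
proof (rule tendsto_sandwich[OF _ _ tendsto_const])
  show "(\<lambda>D. (\<integral>x. (\<phi> x - c)\<^sup>2 \<partial>pi_measure T p) / sqrt (real D)) \<longlonglongrightarrow> 0"
    by (intro tendsto_divide_0[OF tendsto_const] filterlim_at_top_imp_at_infinity sqrt_of_nat_at_top)
  show "\<forall>\<^sub>F D in sequentially. measure (target_measure T D p) {x \<in> space (target_measure T D p). tol D \<le> \<bar>avg T D \<phi> x - c\<bar>}
      \<le> (\<integral>x. (\<phi> x - c)\<^sup>2 \<partial>pi_measure T p) / sqrt (real D)"
    by (rule eventually_sequentiallyI[of 1]) (rule LLN_rate[OF assms])
qed simp

text \<open>Only diagonal second derivatives are constrained. The mixed ones multiply products of
  independent centred noise, for which the uniform bound on \<open>hess\<close> is enough.\<close>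

definition good :: "nat \<Rightarrow> (nat \<Rightarrow> nat \<Rightarrow> real) set" where
  "good D = {x \<in> space (\<Pi>\<^sub>M t\<in>{1..T}. \<Pi>\<^sub>M d\<in>{1..D}. (lborel :: real measure)). \<forall>u\<in>{1..T}.
     \<bar>avg T D (\<lambda>z. (score u z)\<^sup>2) x - fisher T p u\<bar> < tol D \<and>
     \<bar>avg T D (hess u u) x - (- fisher T p u)\<bar> < tol D}"

lemma sets_good: "good D \<in> sets (\<Pi>\<^sub>M t\<in>{1..T}. \<Pi>\<^sub>M d\<in>{1..D}. (borel :: real measure))"
proof -
  have [measurable]: "avg T D (\<lambda>z. (score u z)\<^sup>2) \<in> borel_measurable (\<Pi>\<^sub>M t\<in>{1..T}. \<Pi>\<^sub>M d\<in>{1..D}. lborel)"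
    "avg T D (hess u u) \<in> borel_measurable (\<Pi>\<^sub>M t\<in>{1..T}. \<Pi>\<^sub>M d\<in>{1..D}. lborel)" if "u \<in> {1..T}" for u
    using measurable_derivs[OF that that] by (auto intro!: measurable_avg)
  show ?thesis unfolding sets_PiM_PiM_borel good_def by measurable
qed

text \<open>Union bound over the \<open>2 T\<close> exceptional events. The centre
  \<open>- fisher T p u\<close> of the second kind is the correct mean by
  \<open>integral_hess_diag\<close>.\<close>

lemma measure_good_tendsto_1: "(\<lambda>D. measure (target_measure T D p) (good D)) \<longlonglongrightarrow> 1"
proof -
  let ?Q = "\<lambda>D. target_measure T D p" and ?N = "\<lambda>D. \<Pi>\<^sub>M t\<in>{1..T}. \<Pi>\<^sub>M d\<in>{1..D}. (lborel :: real measure)"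
  define b1 where "b1 D u = {x \<in> space (?Q D). tol D \<le> \<bar>avg T D (\<lambda>z. (score u z)\<^sup>2) x - fisher T p u\<bar>}" for D u
  define b2 where "b2 D u = {x \<in> space (?Q D). tol D \<le> \<bar>avg T D (hess u u) x - (- fisher T p u)\<bar>}" for D u
  have sp: "space (?Q D) = space (?N D)" for D
    by (simp add: target_measure_def)
  have st: "sets (?Q D) = sets (?N D)" for D
    by (simp add: target_measure_def)
  have b_sets: "b1 D u \<in> sets (?Q D)" "b2 D u \<in> sets (?Q D)" if "u \<in> {1..T}" for D u
  proof -
    have [measurable]: "avg T D (\<lambda>z. (score u z)\<^sup>2) \<in> borel_measurable (?N D)"
      "avg T D (hess u u) \<in> borel_measurable (?N D)"
      using measurable_derivs[OF that that] by (auto intro!: measurable_avg)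
    show "b1 D u \<in> sets (?Q D)" "b2 D u \<in> sets (?Q D)"
      unfolding b1_def b2_def st sp by measurable
  qed
  have lim: "(\<lambda>D. \<Sum>u\<in>{1..T}. measure (?Q D) (b1 D u) + measure (?Q D) (b2 D u)) \<longlonglongrightarrow> 0"
  proof (intro tendsto_null_sum tendsto_add_zero)
    fix u assume u: "u \<in> {1..T}"
    show "(\<lambda>D. measure (?Q D) (b1 D u)) \<longlonglongrightarrow> 0"
      unfolding b1_def using measurable_derivs[OF u u] integrable_score[OF u]
      by (intro LLN) (auto simp: fisher_def)
    show "(\<lambda>D. measure (?Q D) (b2 D u)) \<longlonglongrightarrow> 0"
      unfolding b2_def by (intro LLN measurable_derivs[OF u u] integrable_hess u integral_hess_diag)
  qed
  have lower: "1 - (\<Sum>u\<in>{1..T}. measure (?Q D) (b1 D u) + measure (?Q D) (b2 D u))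
      \<le> measure (?Q D) (good D)" for D
  proof -
    interpret prob_space "?Q D" by (rule prob_target)
    have gs: "good D \<in> sets (?Q D)" using sets_good by (simp add: st sets_PiM_PiM_borel)
    have "space (?Q D) - good D = (\<Union>u\<in>{1..T}. b1 D u \<union> b2 D u)"
      unfolding good_def sp[symmetric] b1_def b2_def by (auto simp: not_less)
    then have "prob (space (?Q D) - good D) \<le> (\<Sum>u\<in>{1..T}. prob (b1 D u \<union> b2 D u))"
      using b_sets by (auto intro!: finite_measure_subadditive_finite)
    also have "\<dots> \<le> (\<Sum>u\<in>{1..T}. prob (b1 D u) + prob (b2 D u))"
      using b_sets by (intro sum_mono measure_Un_le) auto
    finally show ?thesis using prob_compl[OF gs] by simp
  qed
  show ?thesis
  proof (rule tendsto_sandwich[OF _ _ _ tendsto_const])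
    show "\<forall>\<^sub>F D in sequentially. 1 - (\<Sum>u\<in>{1..T}. measure (?Q D) (b1 D u) + measure (?Q D) (b2 D u))
        \<le> measure (?Q D) (good D)"
      using lower by simp
    show "\<forall>\<^sub>F D in sequentially. measure (?Q D) (good D) \<le> 1"
      using prob_space.prob_le_1[OF prob_target] by simp
    show "(\<lambda>D. 1 - (\<Sum>u\<in>{1..T}. measure (?Q D) (b1 D u) + measure (?Q D) (b2 D u))) \<longlonglongrightarrow> 1"
      using tendsto_diff[OF tendsto_const[of 1] lim] by simp
  qed
qed

end

section \<open>Moments of the proposal noise\<close>

lemma L1_le_distr:
  assumes "X \<in> measurable M M'" "f \<in> borel_measurable M'"
  shows "L1_le (distr M M' X) f b \<longleftrightarrow> L1_le M (\<lambda>x. f (X x)) b"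
  using assms by (simp add: L1_le_def integrable_distr_eq integral_distr)

lemma L1_le_PiM_component:
  assumes M: "\<And>i. prob_space (M i)" and i: "i \<in> I" and f: "L1_le (M i) f b"
  shows "L1_le (PiM I M) (\<lambda>x. f (x i)) b"
proof -
  have int: "integrable (M i) f" using f by (rule L1_leD)
  then have m: "f \<in> borel_measurable (M i)" by (rule borel_measurable_integrable)
  then have m': "(\<lambda>x. \<bar>f x\<bar>) \<in> borel_measurable (M i)" by (rule borel_measurable_abs)
  show ?thesis
    using int L1_leD(2)[OF f]
    unfolding L1_le_def integral_PiM_component(1)[of M, OF M i m'] integral_PiM_component(2)[of M, OF M i m] ..
qed

text \<open>Subadditivity of the root. A Lipschitz bound would fail at 0, a possible value of the
  Fisher information, so a tolerance passes to its square root.\<close>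

lemma abs_sqrt_diff_le: "0 \<le> a \<Longrightarrow> 0 \<le> b \<Longrightarrow> \<bar>sqrt a - sqrt b\<bar> \<le> sqrt \<bar>a - b\<bar>"
proof -
  have *: "sqrt a \<le> sqrt b + sqrt \<bar>a - b\<bar>" if "0 \<le> a" "0 \<le> b" for a b :: real
  proof -
    have "sqrt a \<le> sqrt (b + \<bar>a - b\<bar>)" by simp
    also have "\<dots> \<le> sqrt b + sqrt \<bar>a - b\<bar>" using that by (intro sqrt_add_le_add_sqrt) auto
    finally show ?thesis .
  qed
  assume "0 \<le> a" "0 \<le> b"
  then show ?thesis using *[of a b] *[of b a] by (simp add: abs_minus_commute abs_le_iff)
qed

text \<open>The sum is at most \<open>T\<close> times its largest term, whose cube occurs on the
  right.\<close>

lemma sum_cube_le: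
  fixes b :: "nat \<Rightarrow> real"
  assumes "\<And>t. t \<in> {1..T} \<Longrightarrow> 0 \<le> b t"
  shows "(\<Sum>t\<in>{1..T}. b t) ^ 3 \<le> real T ^ 3 * (\<Sum>t\<in>{1..T}. b t ^ 3)"
proof (cases "T = 0")
  case False
  define m where "m = Max (b ` {1..T})"
  have "m \<in> b ` {1..T}" unfolding m_def using False by (intro Max_in) auto
  then obtain s where s: "s \<in> {1..T}" "m = b s" by auto
  have "(\<Sum>t\<in>{1..T}. b t) \<le> (\<Sum>t\<in>{1..T}. m)" unfolding m_def by (intro sum_mono Max_ge) auto
  then have "(\<Sum>t\<in>{1..T}. b t) ^ 3 \<le> (real T * m) ^ 3"
    using assms by (intro power_mono sum_nonneg) auto
  also have "\<dots> = real T ^ 3 * b s ^ 3" by (simp add: s power_mult_distrib)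
  also have "\<dots> \<le> real T ^ 3 * (\<Sum>t\<in>{1..T}. b t ^ 3)"
    using s assms by (intro mult_left_mono member_le_sum[of s "{1..T}" "\<lambda>t. b t ^ 3"]) auto
  finally show ?thesis .
qed simp

text \<open>The cube of \<open>|u|\<close> is at most \<open>1 + u^4\<close>, and the fourth moment
  of a standard normal variable is 3; hence the 4.\<close>

lemma noise1_cube: 
  assumes n: "n \<in> {1..N}"
  shows "L1_le (noise1 N) (\<lambda>u. \<bar>u n\<bar> ^ 3) 4"
proof (rule L1_le_dominated)
  interpret prob_space "noise1 N" by (rule prob_space_mvnormal)
  have i4: "integrable (noise1 N) (\<lambda>u. (u n) ^ 4)" by (rule noise1_moments[OF n])
  have "(\<integral>u. 1 + (u n) ^ 4 \<partial>noise1 N) = 4"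
    using i4 noise1_moments(5)[OF n] by (simp add: prob_space)
  then show "L1_le (noise1 N) (\<lambda>u. 1 + (u n) ^ 4) 4"
    using i4 by (simp add: L1_le_def)
  show "(\<lambda>u. \<bar>u n\<bar> ^ 3) \<in> borel_measurable (noise1 N)" using n by measurable
  show "\<bar>\<bar>u n\<bar> ^ 3\<bar> \<le> \<bar>1 + (u n) ^ 4\<bar>" for u :: "nat \<Rightarrow> real"
  proof -
    have "\<bar>u n\<bar> ^ 3 \<le> 1 + (u n) ^ 4"
    proof (cases "\<bar>u n\<bar> \<le> 1")
      case True
      then have "\<bar>u n\<bar> ^ 3 \<le> 1" by (intro power_le_one) auto
      moreover have "0 \<le> (u n) ^ 4" by simp
      ultimately show ?thesis by linarith
    next
      case False
      then have "\<bar>u n\<bar> ^ 3 \<le> \<bar>u n\<bar> ^ 4" by (intro power_increasing) auto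
      moreover have "\<bar>u n\<bar> ^ 4 = (u n) ^ 4" by simp
      ultimately show ?thesis by linarith
    qed
    moreover have "\<bar>\<bar>u n\<bar> ^ 3\<bar> = \<bar>u n\<bar> ^ 3" "0 \<le> (u n) ^ 4" by simp_all
    ultimately show ?thesis by linarith
  qed
qed

lemma prob_noise_law: "prob_space (noise_law T D N)"
  unfolding noise_law_def by (intro prob_space_PiM prob_space_mvnormal)

lemma measurable_noise:
  assumes "t \<in> {1..T}" "d \<in> {1..D}" "n \<in> {1..N}"
  shows "(\<lambda>U. U t d n) \<in> borel_measurable (noise_law T D N)"
proof -
  have "(\<lambda>u. u n) \<in> borel_measurable (noise1 N)" using assms by measurable
  then show ?thesis unfolding noise_law_def
    by (rule measurable_compose[OF measurable_PiM_component2[OF assms(1,2)]])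
qed

lemma L1_le_noise:
  assumes "t \<in> {1..T}" "d \<in> {1..D}" "L1_le (noise1 N) f b"
  shows "L1_le (noise_law T D N) (\<lambda>U. f (U t d)) b"
  unfolding noise_law_def
  by (intro L1_le_PiM_component[where f="\<lambda>u. f (u d)"] L1_le_PiM_component[where f=f] prob_space_PiM prob_space_mvnormal assms)

text \<open>The coefficients are deterministic, so the summands are independent and centred across
  components: the second moment grows like \<open>D\<close>, the L1 norm like \<open>sqrt D\<close>.
  All times of one component stay together in \<open>Y\<close>, which admits products over two
  times.\<close>

lemma L1_le_noise_sum:
  fixes Y :: "(nat \<Rightarrow> nat \<Rightarrow> real) \<Rightarrow> real"
  assumes i1: "integrable (\<Pi>\<^sub>M t\<in>{1..T}. noise1 N) Y" and i2: "integrable (\<Pi>\<^sub>M t\<in>{1..T}. noise1 N) (\<lambda>u. (Y u)\<^sup>2)"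
    and z: "(\<integral>u. Y u \<partial>(\<Pi>\<^sub>M t\<in>{1..T}. noise1 N)) = 0" and v: "(\<integral>u. (Y u)\<^sup>2 \<partial>(\<Pi>\<^sub>M t\<in>{1..T}. noise1 N)) = v"
    and c: "\<And>d. d \<in> {1..D} \<Longrightarrow> \<bar>c d\<bar> \<le> C"
  shows "L1_le (noise_law T D N) (\<lambda>U. \<Sum>d\<in>{1..D}. c d * Y (\<lambda>t\<in>{1..T}. U t d)) (sqrt (real D * (C\<^sup>2 * v)))"
proof -
  let ?\<mu> = "\<Pi>\<^sub>M t\<in>{1..T}. noise1 N"
  let ?P = "\<Pi>\<^sub>M d\<in>{1..D}. ?\<mu>"
  let ?sw = "\<lambda>V. \<lambda>t\<in>{1..T}. \<lambda>d\<in>{1..D}. V d t"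
  have p\<mu>: "prob_space ?\<mu>" by (intro prob_space_PiM prob_space_mvnormal)
  interpret P: prob_space ?P by (intro prob_space_PiM p\<mu>)
  have v0: "0 \<le> v" unfolding v[symmetric] by simp
  have sw: "?sw \<in> measurable ?P (noise_law T D N)"
    unfolding noise_law_def by (intro measurable_restrict measurable_PiM_component2)
  have eq: "noise_law T D N = distr ?P (noise_law T D N) ?sw"
    unfolding noise_law_def
    by (rule distr_PiM_swap[OF prob_space_imp_sigma_finite[OF prob_space_mvnormal], symmetric]) auto
  have m: "(\<lambda>U. \<Sum>d\<in>{1..D}. c d * Y (\<lambda>t\<in>{1..T}. U t d)) \<in> borel_measurable (noise_law T D N)"
    unfolding noise_law_def
    by (intro borel_measurable_sum borel_measurable_times borel_measurable_const
        measurable_compose[OF _ borel_measurable_integrable[OF i1]] measurable_restrict measurable_PiM_component2)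
  have i1': "integrable ?\<mu> (\<lambda>u. c d * Y u)" for d using i1 by simp
  have i2': "integrable ?\<mu> (\<lambda>u. (c d * Y u)\<^sup>2)" for d using i2 by (simp add: power_mult_distrib)
  have sm: "integrable ?P (\<lambda>V. (\<Sum>d\<in>{1..D}. c d * Y (V d))\<^sup>2)"
    "(\<integral>V. (\<Sum>d\<in>{1..D}. c d * Y (V d))\<^sup>2 \<partial>?P) = (\<Sum>d\<in>{1..D}. \<integral>u. (c d * Y u)\<^sup>2 \<partial>?\<mu>)"
    using PiM_centered_sum_second_moment[of "{1..D}" "\<lambda>_. ?\<mu>" "\<lambda>d u. c d * Y u", OF _ p\<mu> i1' i2'] z by simp_all
  have "(\<Sum>d\<in>{1..D}. \<integral>u. (c d * Y u)\<^sup>2 \<partial>?\<mu>) = (\<Sum>d\<in>{1..D}. (c d)\<^sup>2 * v)"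
    by (simp add: power_mult_distrib v)
  also have "\<dots> \<le> (\<Sum>d\<in>{1..D}. C\<^sup>2 * v)"
    using c v0 by (intro sum_mono mult_right_mono) (auto intro: abs_le_square_iff[THEN iffD1] order_trans[OF _ abs_ge_self])
  finally have le: "(\<integral>V. (\<Sum>d\<in>{1..D}. c d * Y (V d))\<^sup>2 \<partial>?P) \<le> real D * (C\<^sup>2 * v)"
    using sm(2) by simp
  have mP: "(\<lambda>V. \<Sum>d\<in>{1..D}. c d * Y (V d)) \<in> borel_measurable ?P"
    using borel_measurable_integrable[OF i1] by measurable
  have "L1_le ?P (\<lambda>V. \<Sum>d\<in>{1..D}. c d * Y (V d)) (sqrt (real D * (C\<^sup>2 * v)))"
    by (rule P.L1_le_sqrt[OF mP sm(1) le])
  then have "L1_le ?P (\<lambda>V. \<Sum>d\<in>{1..D}. c d * Y (\<lambda>t\<in>{1..T}. ?sw V t d)) (sqrt (real D * (C\<^sup>2 * v)))"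
  proof (rule L1_le_dominated)
    show "(\<lambda>V. \<Sum>d\<in>{1..D}. c d * Y (\<lambda>t\<in>{1..T}. ?sw V t d)) \<in> borel_measurable ?P"
      by (rule measurable_compose[OF sw m])
    fix V assume V: "V \<in> space ?P"
    have "(\<lambda>t\<in>{1..T}. ?sw V t d) = V d" if "d \<in> {1..D}" for d
      using V that by (auto simp: space_PiM PiE_iff extensional_def fun_eq_iff)
    then have "(\<Sum>d\<in>{1..D}. c d * Y (\<lambda>t\<in>{1..T}. ?sw V t d)) = (\<Sum>d\<in>{1..D}. c d * Y (V d))"
      by (intro sum.cong refl) simp
    then show "\<bar>\<Sum>d\<in>{1..D}. c d * Y (\<lambda>t\<in>{1..T}. ?sw V t d)\<bar> \<le> \<bar>\<Sum>d\<in>{1..D}. c d * Y (V d)\<bar>" by simp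
  qed
  then show ?thesis by (subst eq) (simp only: L1_le_distr[OF sw m])
qed

text \<open>The constant 2 is the variance of a squared standard normal variable,
  \<open>3 - 2 + 1\<close>.\<close>

lemma L1_le_noise_square_sum:
  assumes t: "t \<in> {1..T}" and n: "n \<in> {1..N}" and c: "\<And>d. d \<in> {1..D} \<Longrightarrow> \<bar>c d\<bar> \<le> C"
  shows "L1_le (noise_law T D N) (\<lambda>U. \<Sum>d\<in>{1..D}. c d * ((U t d n)\<^sup>2 - 1)) (sqrt (real D * (C\<^sup>2 * 2)))"
proof -
  let ?\<mu> = "\<Pi>\<^sub>M t\<in>{1..T}. noise1 N"
  interpret n1: prob_space "noise1 N" by (rule prob_space_mvnormal)
  have m: "(\<lambda>u. (u n)\<^sup>2 - 1) \<in> borel_measurable (noise1 N)" using n by measurable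
  have j1: "integrable (noise1 N) (\<lambda>u. (u n)\<^sup>2 - 1)" using noise1_moments(1)[OF n, of 2] by simp
  have sq: "((x::real)\<^sup>2 - 1)\<^sup>2 = x ^ 4 - 2 * x\<^sup>2 + 1" for x by (simp add: power2_eq_square power4_eq_xxxx algebra_simps)
  have j2: "integrable (noise1 N) (\<lambda>u. ((u n)\<^sup>2 - 1)\<^sup>2)"
    unfolding sq using noise1_moments(1)[OF n, of 2] noise1_moments(1)[OF n, of 4] by simp
  have e1: "(\<integral>u. (u n)\<^sup>2 - 1 \<partial>noise1 N) = 0"
    using noise1_moments(1)[OF n, of 2] noise1_moments(4)[OF n] by (simp add: n1.prob_space)
  have e2: "(\<integral>u. ((u n)\<^sup>2 - 1)\<^sup>2 \<partial>noise1 N) = 2"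
    unfolding sq using noise1_moments(1)[OF n, of 2] noise1_moments(1)[OF n, of 4] noise1_moments(4,5)[OF n]
    by (simp add: n1.prob_space)
  note comp = integral_PiM_component[of "\<lambda>_. noise1 N" t "{1..T}", OF prob_space_mvnormal t]
  have "L1_le (noise_law T D N) (\<lambda>U. \<Sum>d\<in>{1..D}. c d * ((\<lambda>u. (u t n)\<^sup>2 - 1) (\<lambda>t\<in>{1..T}. U t d))) (sqrt (real D * (C\<^sup>2 * 2)))"
  proof (rule L1_le_noise_sum[OF _ _ _ _ c])
    show "integrable ?\<mu> (\<lambda>u. (u t n)\<^sup>2 - 1)"
      by (rule comp(2)[OF m, THEN iffD2, OF j1])
    show "integrable ?\<mu> (\<lambda>u. ((u t n)\<^sup>2 - 1)\<^sup>2)"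
      by (rule comp(2)[of "\<lambda>u. ((u n)\<^sup>2 - 1)\<^sup>2", OF borel_measurable_integrable[OF j2], THEN iffD2, OF j2])
    show "(\<integral>u. (u t n)\<^sup>2 - 1 \<partial>?\<mu>) = 0"
      using comp(1)[OF m] e1 by (rule trans)
    show "(\<integral>u. ((u t n)\<^sup>2 - 1)\<^sup>2 \<partial>?\<mu>) = 2"
      using comp(1)[of "\<lambda>u. ((u n)\<^sup>2 - 1)\<^sup>2", OF borel_measurable_integrable[OF j2]] e2 by (rule trans)
  qed
  then show ?thesis using t by simp
qed

text \<open>Noises at different times are independent for any proposal numbers \<open>n\<close> and
  \<open>m\<close>, so the product has mean 0 and second moment 1.\<close>

lemma L1_le_noise_product_sum:
  assumes st: "s \<in> {1..T}" "t \<in> {1..T}" "s \<noteq> t" and n: "n \<in> {1..N}" "m \<in> {1..N}"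
    and c: "\<And>d. d \<in> {1..D} \<Longrightarrow> \<bar>c d\<bar> \<le> C"
  shows "L1_le (noise_law T D N) (\<lambda>U. \<Sum>d\<in>{1..D}. c d * (U s d n * U t d m)) (sqrt (real D * (C\<^sup>2 * 1)))"
proof -
  note mult = integral_PiM_mult[of "{1..T}" "\<lambda>_. noise1 N" s t, OF _ prob_space_mvnormal st]
  have a: "integrable (noise1 N) (\<lambda>u. u n)" "integrable (noise1 N) (\<lambda>u. u m)"
    using noise1_moments(1)[OF n(1), of 1] noise1_moments(1)[OF n(2), of 1] by simp_all
  have b: "integrable (noise1 N) (\<lambda>u. (u n)\<^sup>2)" "integrable (noise1 N) (\<lambda>u. (u m)\<^sup>2)"
    using noise1_moments(1)[OF n(1), of 2] noise1_moments(1)[OF n(2), of 2] by simp_all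
  have "L1_le (noise_law T D N) (\<lambda>U. \<Sum>d\<in>{1..D}. c d * ((\<lambda>u. u s n * u t m) (\<lambda>t\<in>{1..T}. U t d))) (sqrt (real D * (C\<^sup>2 * 1)))"
  proof (rule L1_le_noise_sum[OF _ _ _ _ c])
    let ?\<mu> = "\<Pi>\<^sub>M t\<in>{1..T}. noise1 N"
    show "integrable ?\<mu> (\<lambda>u. u s n * u t m)"
      by (rule mult(1)[OF _ a]) simp
    show "integrable ?\<mu> (\<lambda>u. (u s n * u t m)\<^sup>2)"
      unfolding power_mult_distrib by (rule mult(1)[OF _ b]) simp
    show "(\<integral>u. u s n * u t m \<partial>?\<mu>) = 0"
      using mult(2)[OF _ a] noise1_moments(3)[OF n(1)] by simp
    show "(\<integral>u. (u s n * u t m)\<^sup>2 \<partial>?\<mu>) = 1"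
      unfolding power_mult_distrib using mult(2)[OF _ b] noise1_moments(4)[OF n(1)] noise1_moments(4)[OF n(2)] by simp
  qed
  then show ?thesis using st by simp
qed

section \<open>Weighted sums of the noise over the components\<close>

definition wsum ::
  "nat \<Rightarrow> (nat \<Rightarrow> nat \<Rightarrow> real) \<Rightarrow> (nat \<Rightarrow> nat \<Rightarrow> nat \<Rightarrow> real) \<Rightarrow> nat \<Rightarrow> nat \<Rightarrow> real" where
  "wsum D a U t n = (\<Sum>d\<in>{1..D}. a t d * U t d n)"

lemma wsum_distr:
  assumes N: "N \<ge> 1" and t: "t \<in> {1..T}" and a: "(\<Sum>d\<in>{1..D}. (a t d)\<^sup>2) = 1" and f: "L1_le (noise1 N) f b"
  shows "L1_le (noise_law T D N) (\<lambda>U. f (\<lambda>n\<in>{1..N}. wsum D a U t n)) b"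
proof -
  let ?g = "\<lambda>V. \<lambda>n\<in>{1..N}. \<Sum>d\<in>{1..D}. a t d * V d n"
  have g: "?g \<in> measurable (\<Pi>\<^sub>M d\<in>{1..D}. noise1 N) (\<Pi>\<^sub>M n\<in>{1..N}. borel)"
  proof (intro measurable_restrict borel_measurable_sum borel_measurable_times borel_measurable_const)
    fix n d assume *: "n \<in> {1..N}" "d \<in> {1..D}"
    then have "(\<lambda>u. u n) \<in> borel_measurable (noise1 N)" by measurable
    then show "(\<lambda>V. V d n) \<in> borel_measurable (\<Pi>\<^sub>M d\<in>{1..D}. noise1 N)"
      by (rule measurable_compose[OF measurable_component_singleton[OF *(2)]])
  qed
  have f': "f \<in> borel_measurable (\<Pi>\<^sub>M n\<in>{1..N}. borel)"
    using borel_measurable_integrable[OF L1_leD(1)[OF f]] by (simp cong: measurable_cong_sets)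
  have "L1_le (\<Pi>\<^sub>M d\<in>{1..D}. noise1 N) (\<lambda>V. f (?g V)) b"
    using f unfolding L1_le_distr[OF g f', symmetric] distr_weighted_sum_noise1[OF N finite_atLeastAtMost a] .
  then have "L1_le (\<Pi>\<^sub>M t\<in>{1..T}. \<Pi>\<^sub>M d\<in>{1..D}. noise1 N) (\<lambda>U. f (?g (U t))) b"
    by (intro L1_le_PiM_component[where f="\<lambda>V. f (?g V)"] prob_space_PiM prob_space_mvnormal t)
  then show ?thesis by (simp add: wsum_def noise_law_def)
qed

lemma L1_le_wsum:
  assumes N: "N \<ge> 1" and t: "t \<in> {1..T}" and a: "(\<Sum>d\<in>{1..D}. (a t d)\<^sup>2) = 1" and n: "n \<in> {1..N}"
  shows "L1_le (noise_law T D N) (\<lambda>U. wsum D a U t n) 1"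
proof -
  interpret prob_space "noise1 N" by (rule prob_space_mvnormal)
  have "L1_le (noise1 N) (\<lambda>u. u n) (sqrt 1)"
    using n noise1_moments(1)[OF n, of 2] noise1_moments(4)[OF n] by (intro L1_le_sqrt) auto
  from wsum_distr[where f="\<lambda>u. u n" and a=a, OF N t a this] show ?thesis using n by simp
qed

section \<open>Gaussian approximation of the log-ratio\<close>

definition prop_col ::
  "nat \<Rightarrow> nat \<Rightarrow> (nat \<Rightarrow> real) \<Rightarrow> (nat \<Rightarrow> nat \<Rightarrow> real) \<Rightarrow> (nat \<Rightarrow> nat \<Rightarrow> nat \<Rightarrow> real) \<Rightarrow> (nat \<Rightarrow> nat) \<Rightarrow> nat \<Rightarrow> nat \<Rightarrow> real" where
  "prop_col T D ell x U k d = (\<lambda>t\<in>{1..T}. proposal D ell x U (k t) t d)"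

definition step ::
  "nat \<Rightarrow> (nat \<Rightarrow> real) \<Rightarrow> (nat \<Rightarrow> nat \<Rightarrow> nat \<Rightarrow> real) \<Rightarrow> (nat \<Rightarrow> nat) \<Rightarrow> nat \<Rightarrow> nat \<Rightarrow> real" where
  "step D ell U k d t = (if k t = 0 then 0 else sqrt (ell t / real D) * U t d (k t))"

definition log_ratio ::
  "nat \<Rightarrow> nat \<Rightarrow> (nat \<Rightarrow> real) \<Rightarrow> ((nat \<Rightarrow> real) \<Rightarrow> real) \<Rightarrow> (nat \<Rightarrow> nat \<Rightarrow> real) \<Rightarrow> (nat \<Rightarrow> nat \<Rightarrow> nat \<Rightarrow> real) \<Rightarrow> (nat \<Rightarrow> nat) \<Rightarrow> real" where
  "log_ratio T D ell p x U k = (\<Sum>d\<in>{1..D}. log_p p (prop_col T D ell x U k d) - log_p p (col T x d))"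

text \<open>For unit vectors \<open>a t\<close>, this is a copy, jointly in \<open>t\<close> and
  \<open>n\<close>, of the limiting vector \<open>V\<close> on the proposal noise space.\<close>

definition gauss_ratio ::
  "nat \<Rightarrow> nat \<Rightarrow> (nat \<Rightarrow> real) \<Rightarrow> ((nat \<Rightarrow> real) \<Rightarrow> real) \<Rightarrow> (nat \<Rightarrow> nat \<Rightarrow> real) \<Rightarrow> (nat \<Rightarrow> nat \<Rightarrow> nat \<Rightarrow> real) \<Rightarrow> nat \<Rightarrow> nat \<Rightarrow> real" where
  "gauss_ratio T D ell p a U t n = - (1/2) * ell t * fisher T p t + sqrt (ell t * fisher T p t) * wsum D a U t n"

lemma prop_col_Rn: "prop_col T D ell x U k d \<in> Rn T"
  by (simp add: prop_col_def Rn_def)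

lemma prop_col_minus_col: "t \<in> {1..T} \<Longrightarrow> prop_col T D ell x U k d t - col T x d t = step D ell U k d t"
  by (simp add: prop_col_def col_def proposal_def step_def)

lemma indices_range: "k \<in> indices T N \<Longrightarrow> t \<in> {1..T} \<Longrightarrow> k t \<noteq> 0 \<Longrightarrow> k t \<in> {1..N}"
  by (auto simp: indices_def PiE_iff Suc_le_eq One_nat_def)

lemma measurable_prop_col:
  assumes k: "k \<in> indices T N" and d: "d \<in> {1..D}"
  shows "(\<lambda>U. prop_col T D ell x U k d) \<in> measurable (noise_law T D N) (\<Pi>\<^sub>M t\<in>{1..T}. lborel)"
  unfolding prop_col_def
proof (rule measurable_restrict)
  fix t assume t: "t \<in> {1..T}"
  show "(\<lambda>U. proposal D ell x U (k t) t d) \<in> measurable (noise_law T D N) lborel"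
  proof (cases "k t = 0")
    case False
    have [measurable]: "(\<lambda>U. U t d (k t)) \<in> borel_measurable (noise_law T D N)"
      by (rule measurable_noise[OF t d indices_range[OF k t False]])
    show ?thesis using False unfolding proposal_def by simp
  qed (simp add: proposal_def)
qed

text \<open>The terms stem, in this order, from the root of the empirical mean of squared scores,
  from the empirical mean of second derivatives, and from quadratic fluctuations together with the
  Taylor remainder. The first one, D^(-1/8), dominates.\<close>

definition rate :: "nat \<Rightarrow> real" where
  "rate D = sqrt (tol D) + tol D + 1 / sqrt (real D)"

lemma rate_ge: "sqrt (tol D) \<le> rate D" "tol D \<le> rate D" "1 / sqrt (real D) \<le> rate D" "0 \<le> rate D"
  using tol_nonneg[of D] by (auto simp: rate_def)

lemma rate_tendsto_0: "rate \<longlonglongrightarrow> 0"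
proof -
  have "(\<lambda>D. 1 / sqrt (real D)) \<longlonglongrightarrow> 0"
    by (intro tendsto_divide_0[OF tendsto_const] filterlim_at_top_imp_at_infinity sqrt_of_nat_at_top)
  moreover have "(\<lambda>D. sqrt (tol D)) \<longlonglongrightarrow> 0"
    using tendsto_real_sqrt[OF tol_tendsto_0] by simp
  ultimately have "(\<lambda>D. sqrt (tol D) + tol D + 1 / sqrt (real D)) \<longlonglongrightarrow> 0 + 0 + 0"
    by (intro tendsto_add tol_tendsto_0)
  then show ?thesis by (simp add: rate_def[abs_def])
qed

context smooth_target
begin

text \<open>The score vector over the components, normalised. If all scores vanish it is replaced by
  the first unit vector, so that \<open>wsum\<close> keeps its normal law even then.\<close>

definition weight ::
  "nat \<Rightarrow> (nat \<Rightarrow> nat \<Rightarrow> real) \<Rightarrow> nat \<Rightarrow> nat \<Rightarrow> real" where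
  "weight D x t d = (let Q = \<Sum>e\<in>{1..D}. (score t (col T x e))\<^sup>2 in
     if Q = 0 then (if d = 1 then 1 else 0) else score t (col T x d) / sqrt Q)"

lemma weight_norm: "D \<ge> 1 \<Longrightarrow> (\<Sum>d\<in>{1..D}. (weight D x t d)\<^sup>2) = 1"
proof -
  assume D: "D \<ge> 1"
  define Q where "Q = (\<Sum>e\<in>{1..D}. (score t (col T x e))\<^sup>2)"
  have Q0: "0 \<le> Q" unfolding Q_def by (intro sum_nonneg) auto
  show ?thesis
  proof (cases "Q = 0")
    case True
    have "(\<Sum>d\<in>{1..D}. (weight D x t d)\<^sup>2) = (\<Sum>d\<in>{1..D}. if d = 1 then 1 else 0)"
      using True by (intro sum.cong refl) (simp add: weight_def Q_def)
    then show ?thesis using D by simp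
  next
    case False
    have "(\<Sum>d\<in>{1..D}. (weight D x t d)\<^sup>2) = (\<Sum>d\<in>{1..D}. (score t (col T x d))\<^sup>2 / Q)"
      using False Q0 by (intro sum.cong refl) (simp add: weight_def Q_def[symmetric] power_divide)
    also have "\<dots> = 1" using False by (simp add: sum_divide_distrib[symmetric] Q_def[symmetric])
    finally show ?thesis .
  qed
qed

text \<open>The prefactor is the Euclidean norm of the score vector; where it is 0 every score is 0,
  and the conventional weight is multiplied by 0.\<close>

lemma score_eq_weight:
  assumes d: "d \<in> {1..D}"
  shows "score t (col T x d) = sqrt (real D) * sqrt (avg T D (\<lambda>z. (score t z)\<^sup>2) x) * weight D x t d"
proof -
  define Q where "Q = (\<Sum>e\<in>{1..D}. (score t (col T x e))\<^sup>2)"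
  have avgQ: "sqrt (real D) * sqrt (avg T D (\<lambda>z. (score t z)\<^sup>2) x) = sqrt Q"
    using d by (simp add: avg_def Q_def real_sqrt_mult[symmetric])
  have Q0: "0 \<le> Q" unfolding Q_def by (intro sum_nonneg) auto
  show ?thesis
  proof (cases "Q = 0")
    case True
    then have "(score t (col T x d))\<^sup>2 = 0"
      unfolding Q_def using d by (subst (asm) sum_nonneg_eq_0_iff) auto
    then show ?thesis unfolding avgQ using True by simp
  next
    case False
    then show ?thesis unfolding avgQ using Q0 by (simp add: weight_def Q_def[symmetric])
  qed
qed

text \<open>Numerator and denominator are divided by the density at the current state, which is
  positive by \<open>p_pos\<close>.\<close>

lemma ehmm_select_eq_softmax:
  "ehmm_select T D N ell p x U k = exp (log_ratio T D ell p x U k) / (\<Sum>l\<in>indices T N. exp (log_ratio T D ell p x U l))"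
proof -
  define Z where "Z = (\<Prod>d\<in>{1..D}. p (col T x d))"
  have Z: "0 < Z" unfolding Z_def by (intro prod_pos p_pos col_Rn ballI)
  have *: "target_density T D p (\<lambda>t. proposal D ell x U (l t) t) = Z * exp (log_ratio T D ell p x U l)" for l
  proof -
    have "exp (log_ratio T D ell p x U l) = (\<Prod>d\<in>{1..D}. p (prop_col T D ell x U l d) / p (col T x d))"
      unfolding log_ratio_def log_p_def exp_sum[OF finite_atLeastAtMost]
      by (intro prod.cong refl) (simp add: exp_diff p_pos col_Rn prop_col_Rn)
    also have "\<dots> = target_density T D p (\<lambda>t. proposal D ell x U (l t) t) / Z"
      by (simp add: prod_dividef Z_def target_density_def prop_col_def)
    finally show ?thesis using Z by simp
  qed
  show ?thesis
    unfolding ehmm_select_def * sum_distrib_left[symmetric] using Z by simp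
qed

lemma measurable_log_ratio:
  assumes "k \<in> indices T N"
  shows "(\<lambda>U. log_ratio T D ell p x U k) \<in> borel_measurable (noise_law T D N)"
proof -
  have lp: "log_p p \<in> borel_measurable lbT" unfolding log_p_def[abs_def] by measurable
  show ?thesis unfolding log_ratio_def
    by (intro borel_measurable_sum borel_measurable_diff borel_measurable_const
        measurable_compose[OF measurable_prop_col[OF assms] lp])
qed

section \<open>Quadratic expansion of the log-ratio and its remainder\<close>

lemma fisher_nonneg: "0 \<le> fisher T p t"
  by (simp add: fisher_def)

definition quad_expansion ::
  "nat \<Rightarrow> (nat \<Rightarrow> real) \<Rightarrow> (nat \<Rightarrow> nat \<Rightarrow> real) \<Rightarrow> (nat \<Rightarrow> nat \<Rightarrow> nat \<Rightarrow> real) \<Rightarrow> (nat \<Rightarrow> nat) \<Rightarrow> real" where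
  "quad_expansion D ell x U k = (\<Sum>d\<in>{1..D}. \<Sum>t\<in>{1..T}. score t (col T x d) * step D ell U k d t
            + (1/2) * hess t t (col T x d) * (step D ell U k d t)\<^sup>2
            + (\<Sum>s\<in>{1..<t}. hess s t (col T x d) * step D ell U k d s * step D ell U k d t))"

text \<open>Three defects at time \<open>t\<close>: the empirical norm of the scores against its
  limit, the diagonal second-order term against its limiting mean, and the mixed terms with earlier
  times. If \<open>k t = 0\<close> the state at time \<open>t\<close> does not move and nothing is
  contributed.\<close>

definition expansion_error ::
  "nat \<Rightarrow> (nat \<Rightarrow> real) \<Rightarrow> (nat \<Rightarrow> nat \<Rightarrow> real) \<Rightarrow> (nat \<Rightarrow> nat \<Rightarrow> nat \<Rightarrow> real) \<Rightarrow> (nat \<Rightarrow> nat) \<Rightarrow> nat \<Rightarrow> real" where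
  "expansion_error D ell x U k t =
          (if k t = 0 then 0 else sqrt (ell t) * (sqrt (avg T D (\<lambda>z. (score t z)\<^sup>2) x) - sqrt (fisher T p t))
             * wsum D (weight D x) U t (k t))
        + (if k t = 0 then 0 else (1/2) * ell t * (avg T D (hess t t) x + fisher T p t)
             + (1/2) * ell t / real D * (\<Sum>d\<in>{1..D}. hess t t (col T x d) * ((U t d (k t))\<^sup>2 - 1)))
        + (\<Sum>s\<in>{1..<t}. if k s = 0 \<or> k t = 0 then 0 else sqrt (ell s * ell t) / real D
             * (\<Sum>d\<in>{1..D}. hess s t (col T x d) * (U s d (k s) * U t d (k t))))"

text \<open>The linear Taylor term is exactly Gaussian given \<open>x\<close>; the quadratic terms concentrate around their
  means, which are \<open>- \<ell>\<^sub>t I\<^sub>t / 2\<close> on the diagonal and \<open>0\<close> off the diagonal.\<close>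

lemma log_ratio_expansion:
  assumes k: "k \<in> indices T N" and D: "D \<ge> 1" and ell: "\<And>t. t \<in> {1..T} \<Longrightarrow> 0 < ell t"
  shows "quad_expansion D ell x U k
      - (\<Sum>t\<in>{1..T}. if k t = 0 then 0 else gauss_ratio T D ell p (weight D x) U t (k t))
    = (\<Sum>t\<in>{1..T}. expansion_error D ell x U k t)"
proof -
  let ?st = "step D ell U k"
  have "quad_expansion D ell x U k
    = (\<Sum>t\<in>{1..T}. \<Sum>d\<in>{1..D}. score t (col T x d) * ?st d t
            + (1/2) * hess t t (col T x d) * (?st d t)\<^sup>2
            + (\<Sum>s\<in>{1..<t}. hess s t (col T x d) * ?st d s * ?st d t))"
    unfolding quad_expansion_def by (rule sum.swap)
  also have "\<dots> = (\<Sum>t\<in>{1..T}. (\<Sum>d\<in>{1..D}. score t (col T x d) * ?st d t)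
            + (\<Sum>d\<in>{1..D}. (1/2) * hess t t (col T x d) * (?st d t)\<^sup>2)
            + (\<Sum>s\<in>{1..<t}. \<Sum>d\<in>{1..D}. hess s t (col T x d) * ?st d s * ?st d t))"
    unfolding sum.distrib by (intro arg_cong2[where f="(+)"] refl sum.cong sum.swap)
  finally have 1: "quad_expansion D ell x U k
    = (\<Sum>t\<in>{1..T}. (\<Sum>d\<in>{1..D}. score t (col T x d) * ?st d t)
            + (\<Sum>d\<in>{1..D}. (1/2) * hess t t (col T x d) * (?st d t)\<^sup>2)
            + (\<Sum>s\<in>{1..<t}. \<Sum>d\<in>{1..D}. hess s t (col T x d) * ?st d s * ?st d t))" .
  show ?thesis
    unfolding 1 sum_subtractf[symmetric]
  proof (rule sum.cong[OF refl])
    fix t assume t: "t \<in> {1..T}"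
    have lt: "0 < ell t" by (rule ell[OF t])
    have E3: "(\<Sum>d\<in>{1..D}. hess s t (col T x d) * ?st d s * ?st d t)
      = (if k s = 0 \<or> k t = 0 then 0 else sqrt (ell s * ell t) / real D
             * (\<Sum>d\<in>{1..D}. hess s t (col T x d) * (U s d (k s) * U t d (k t))))" for s
    proof (cases "k s = 0 \<or> k t = 0")
      case False
      have sq: "sqrt (ell s / real D) * sqrt (ell t / real D) = sqrt (ell s * ell t) / real D"
        by (simp add: real_sqrt_mult real_sqrt_divide)
      have "(\<Sum>d\<in>{1..D}. hess s t (col T x d) * ?st d s * ?st d t)
        = (\<Sum>d\<in>{1..D}. (sqrt (ell s / real D) * sqrt (ell t / real D)) * (hess s t (col T x d) * (U s d (k s) * U t d (k t))))"
        using False by (intro sum.cong refl) (simp add: step_def)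
      then show ?thesis using False unfolding sq sum_distrib_left[symmetric] by simp
    qed (auto simp: step_def)
    show "(\<Sum>d\<in>{1..D}. score t (col T x d) * ?st d t)
            + (\<Sum>d\<in>{1..D}. (1/2) * hess t t (col T x d) * (?st d t)\<^sup>2)
            + (\<Sum>s\<in>{1..<t}. \<Sum>d\<in>{1..D}. hess s t (col T x d) * ?st d s * ?st d t)
        - (if k t = 0 then 0 else gauss_ratio T D ell p (weight D x) U t (k t))
      = expansion_error D ell x U k t"
    proof (cases "k t = 0")
      case True
      then show ?thesis by (simp add: step_def expansion_error_def)
    next
      case False
      let ?A = "avg T D (\<lambda>z. (score t z)\<^sup>2) x"
      have "(\<Sum>d\<in>{1..D}. score t (col T x d) * ?st d t)
        = (\<Sum>d\<in>{1..D}. (sqrt (real D) * sqrt (ell t / real D)) * sqrt ?A * (weight D x t d * U t d (k t)))"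
        using False by (intro sum.cong refl) (simp add: step_def score_eq_weight[of _ D])
      also have "\<dots> = sqrt (ell t) * sqrt ?A * wsum D (weight D x) U t (k t)"
        using D by (simp add: wsum_def sum_distrib_left real_sqrt_mult[symmetric])
      finally have E1: "(\<Sum>d\<in>{1..D}. score t (col T x d) * ?st d t) = sqrt (ell t) * sqrt ?A * wsum D (weight D x) U t (k t)" .
      have "(\<Sum>d\<in>{1..D}. (1/2) * hess t t (col T x d) * (?st d t)\<^sup>2)
        = (\<Sum>d\<in>{1..D}. (1/2) * ell t / real D * (hess t t (col T x d) * (U t d (k t))\<^sup>2))"
        using False lt by (intro sum.cong refl) (simp add: step_def power_mult_distrib)
      also have "\<dots> = (1/2) * ell t / real D * (\<Sum>d\<in>{1..D}. hess t t (col T x d) * (U t d (k t))\<^sup>2)"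
        by (simp only: sum_distrib_left)
      \<comment> \<open>The squared noise is split into its mean 1 and a centred part.\<close>
      also have "\<dots> = (1/2) * ell t * avg T D (hess t t) x
          + (1/2) * ell t / real D * (\<Sum>d\<in>{1..D}. hess t t (col T x d) * ((U t d (k t))\<^sup>2 - 1))"
        by (simp add: avg_def right_diff_distrib sum_subtractf)
      finally have E2: "(\<Sum>d\<in>{1..D}. (1/2) * hess t t (col T x d) * (?st d t)\<^sup>2) = (1/2) * ell t * avg T D (hess t t) x
          + (1/2) * ell t / real D * (\<Sum>d\<in>{1..D}. hess t t (col T x d) * ((U t d (k t))\<^sup>2 - 1))" .
      show ?thesis
        unfolding E1 E2 E3 expansion_error_def using False lt fisher_nonneg[of t]
        by (simp add: gauss_ratio_def real_sqrt_mult algebra_simps)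
    qed
  qed
qed

text \<open>A single displacement has third absolute moment at most 4 times the cube of
  \<open>sqrt (ell t / D)\<close>; summing over \<open>D\<close> components leaves the order
  D^(-1/2).\<close>

lemma remainder_bound:
  assumes k: "k \<in> indices T N" and D: "D \<ge> 1" and ell: "\<And>t. t \<in> {1..T} \<Longrightarrow> 0 < ell t"
    and L: "0 \<le> L" "\<And>s u x y. s \<in> {1..T} \<Longrightarrow> u \<in> {1..T} \<Longrightarrow> x \<in> Rn T \<Longrightarrow> y \<in> Rn T \<Longrightarrow>
       \<bar>hess s u x - hess s u y\<bar> \<le> L * (\<Sum>i\<in>{1..T}. \<bar>x i - y i\<bar>)"
  shows "L1_le (noise_law T D N) (\<lambda>U. log_ratio T D ell p x U k - quad_expansion D ell x U k)
    (4 * L * real T ^ 3 * (\<Sum>t\<in>{1..T}. sqrt (ell t) ^ 3) * rate D)"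
proof (rule L1_le_dominated)
  interpret P: prob_space "noise_law T D N" by (rule prob_noise_law)
  let ?st = "step D ell"
  have step_m: "(\<lambda>U. ?st U k d t) \<in> borel_measurable (noise_law T D N)" if "d \<in> {1..D}" "t \<in> {1..T}" for d t
    using measurable_noise[OF that(2,1) indices_range[OF k that(2)]]
    by (cases "k t = 0") (auto simp: step_def)
  show "(\<lambda>U. log_ratio T D ell p x U k - quad_expansion D ell x U k)
     \<in> borel_measurable (noise_law T D N)"
    unfolding quad_expansion_def
    by (intro borel_measurable_diff measurable_log_ratio[OF k] borel_measurable_sum borel_measurable_add
        borel_measurable_times borel_measurable_const borel_measurable_power step_m) auto
  have one: "L1_le (noise_law T D N) (\<lambda>U. \<bar>?st U k d t\<bar> ^ 3) (4 * sqrt (ell t) ^ 3 / (real D * sqrt (real D)))"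
    if d: "d \<in> {1..D}" and t: "t \<in> {1..T}" for d t
  proof (cases "k t = 0")
    case True
    then show ?thesis using ell[OF t] by (simp add: step_def L1_le_zero)
  next
    case False
    have cube: "sqrt (ell t / real D) ^ 3 = sqrt (ell t) ^ 3 / (real D * sqrt (real D))"
      by (simp add: real_sqrt_divide power_divide power3_eq_cube)
    have "L1_le (noise_law T D N) (\<lambda>U. \<bar>U t d (k t)\<bar> ^ 3) 4"
      by (rule L1_le_noise[OF t d noise1_cube[OF indices_range[OF k t False]]])
    then have "L1_le (noise_law T D N) (\<lambda>U. sqrt (ell t / real D) ^ 3 * \<bar>U t d (k t)\<bar> ^ 3) (\<bar>sqrt (ell t / real D) ^ 3\<bar> * 4)"
      by (rule L1_le_cmult)
    then show ?thesis
      using False ell[OF t] by (simp add: step_def abs_mult power_mult_distrib cube mult.commute)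
  qed
  \<comment> \<open>\<open>L\<close> bounds the Taylor remainder by the cube of the l1 displacement;
    \<open>T^3\<close> is the price for passing from that cube to a sum of cubes.\<close>
  define c where "c = L * real T ^ 3"
  have "L1_le (noise_law T D N) (\<lambda>U. \<Sum>d\<in>{1..D}. c * (\<Sum>t\<in>{1..T}. \<bar>?st U k d t\<bar> ^ 3))
      (\<Sum>d\<in>{1..D}. \<bar>c\<bar> * (\<Sum>t\<in>{1..T}. 4 * sqrt (ell t) ^ 3 / (real D * sqrt (real D))))"
    by (intro L1_le_sum L1_le_cmult one)
  moreover have "(\<Sum>d\<in>{1..D}. \<bar>c\<bar> * (\<Sum>t\<in>{1..T}. 4 * sqrt (ell t) ^ 3 / (real D * sqrt (real D))))
      \<le> 4 * L * real T ^ 3 * (\<Sum>t\<in>{1..T}. sqrt (ell t) ^ 3) * rate D"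
  proof -
    have c0: "0 \<le> c" using L by (simp add: c_def)
    have "(\<Sum>t\<in>{1..T}. 4 * sqrt (ell t) ^ 3 / (real D * sqrt (real D))) = 4 * (\<Sum>t\<in>{1..T}. sqrt (ell t) ^ 3) / (real D * sqrt (real D))"
      by (simp add: sum_divide_distrib sum_distrib_left)
    then have "(\<Sum>d\<in>{1..D}. \<bar>c\<bar> * (\<Sum>t\<in>{1..T}. 4 * sqrt (ell t) ^ 3 / (real D * sqrt (real D))))
      = (4 * c * (\<Sum>t\<in>{1..T}. sqrt (ell t) ^ 3)) * (1 / sqrt (real D))"
      using c0 D by simp
    also have "\<dots> \<le> (4 * c * (\<Sum>t\<in>{1..T}. sqrt (ell t) ^ 3)) * rate D"
      using c0 ell by (intro mult_left_mono rate_ge mult_nonneg_nonneg sum_nonneg) (auto intro: less_imp_le)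
    finally show ?thesis by (simp add: c_def mult.assoc)
  qed
  ultimately show "L1_le (noise_law T D N) (\<lambda>U. \<Sum>d\<in>{1..D}. c * (\<Sum>t\<in>{1..T}. \<bar>?st U k d t\<bar> ^ 3))
      (4 * L * real T ^ 3 * (\<Sum>t\<in>{1..T}. sqrt (ell t) ^ 3) * rate D)"
    by (rule L1_le_mono)
  fix U
  let ?R = "\<lambda>d. log_p p (prop_col T D ell x U k d) - log_p p (col T x d)
      - (\<Sum>t\<in>{1..T}. score t (col T x d) * ?st U k d t + (1/2) * hess t t (col T x d) * (?st U k d t)\<^sup>2
            + (\<Sum>s\<in>{1..<t}. hess s t (col T x d) * ?st U k d s * ?st U k d t))"
  have "\<bar>?R d\<bar> \<le> c * (\<Sum>t\<in>{1..T}. \<bar>?st U k d t\<bar> ^ 3)" for d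
  proof -
    let ?y = "prop_col T D ell x U k d" and ?x = "col T x d"
    have "\<bar>log_p p ?y - log_p p ?x - (\<Sum>t\<in>{1..T}. score t ?x * (?y t - ?x t) + (1/2) * hess t t ?x * (?y t - ?x t)\<^sup>2
            + (\<Sum>s\<in>{1..<t}. hess s t ?x * (?y s - ?x s) * (?y t - ?x t)))\<bar> \<le> L * (\<Sum>i\<in>{1..T}. \<bar>?y i - ?x i\<bar>) ^ 3"
      by (rule coordinatewise_taylor[where h=hess, OF _ _ L(2) L(1) col_Rn prop_col_Rn])
         (intro DERIV_log_p(1) DERIV_score(1) p_pos Rn_upd; assumption)+
    also have "(\<Sum>t\<in>{1..T}. score t ?x * (?y t - ?x t) + (1/2) * hess t t ?x * (?y t - ?x t)\<^sup>2
            + (\<Sum>s\<in>{1..<t}. hess s t ?x * (?y s - ?x s) * (?y t - ?x t)))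
       = (\<Sum>t\<in>{1..T}. score t ?x * ?st U k d t + (1/2) * hess t t ?x * (?st U k d t)\<^sup>2
            + (\<Sum>s\<in>{1..<t}. hess s t ?x * ?st U k d s * ?st U k d t))"
      by (intro sum.cong refl arg_cong2[where f="(+)"]) (simp_all add: prop_col_minus_col)
    also have "(\<Sum>i\<in>{1..T}. \<bar>?y i - ?x i\<bar>) = (\<Sum>i\<in>{1..T}. \<bar>?st U k d i\<bar>)"
      by (intro sum.cong refl) (simp add: prop_col_minus_col)
    also have "L * (\<Sum>i\<in>{1..T}. \<bar>?st U k d i\<bar>) ^ 3 \<le> L * (real T ^ 3 * (\<Sum>i\<in>{1..T}. \<bar>?st U k d i\<bar> ^ 3))"
      by (intro mult_left_mono sum_cube_le L) auto
    finally show ?thesis by (simp add: c_def mult.assoc)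
  qed
  then have "(\<Sum>d\<in>{1..D}. \<bar>?R d\<bar>) \<le> (\<Sum>d\<in>{1..D}. c * (\<Sum>t\<in>{1..T}. \<bar>?st U k d t\<bar> ^ 3))"
    by (intro sum_mono)
  then have "\<bar>\<Sum>d\<in>{1..D}. ?R d\<bar> \<le> \<bar>\<Sum>d\<in>{1..D}. c * (\<Sum>t\<in>{1..T}. \<bar>?st U k d t\<bar> ^ 3)\<bar>"
    using sum_abs[of ?R "{1..D}"] by linarith
  then show "\<bar>log_ratio T D ell p x U k - quad_expansion D ell x U k\<bar>
     \<le> \<bar>\<Sum>d\<in>{1..D}. c * (\<Sum>t\<in>{1..T}. \<bar>?st U k d t\<bar> ^ 3)\<bar>"
    by (simp only: log_ratio_def quad_expansion_def sum_subtractf)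
qed

text \<open>The constant precedes all quantifiers, which gives the uniformity: \<open>x\<close>
  enters only through the tolerances guaranteed by \<open>good D\<close> and through second
  derivatives bounded by \<open>C\<close> with Lipschitz constant \<open>L\<close>.\<close>

lemma log_ratio_approx:
  assumes N: "N \<ge> 1" and ell: "\<And>t. t \<in> {1..T} \<Longrightarrow> 0 < ell t"
  shows "\<exists>K\<ge>0. \<forall>D\<ge>1. \<forall>x\<in>good D. \<forall>k\<in>indices T N.
    L1_le (noise_law T D N) (\<lambda>U. log_ratio T D ell p x U k
      - (\<Sum>t\<in>{1..T}. if k t = 0 then 0 else gauss_ratio T D ell p (weight D x) U t (k t))) (K * rate D)"
proof -
  obtain C L where C: "0 \<le> C" "\<And>s u x. s \<in> {1..T} \<Longrightarrow> u \<in> {1..T} \<Longrightarrow> x \<in> Rn T \<Longrightarrow> \<bar>hess s u x\<bar> \<le> C"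
    and L: "0 \<le> L" "\<And>s u x y. s \<in> {1..T} \<Longrightarrow> u \<in> {1..T} \<Longrightarrow> x \<in> Rn T \<Longrightarrow> y \<in> Rn T \<Longrightarrow>
       \<bar>hess s u x - hess s u y\<bar> \<le> L * (\<Sum>i\<in>{1..T}. \<bar>x i - y i\<bar>)"
    by (rule bound_Lip_exist) blast
  \<comment> \<open>\<open>K1\<close>, \<open>K2\<close>, \<open>K3\<close> belong to the three
    summands of \<open>expansion_error\<close>, \<open>KR\<close> to the Taylor remainder. In
    \<open>K2\<close> the first term is the drift error and the one with \<open>C * sqrt 2\<close>
    the fluctuation.\<close>
  define K1 where "K1 t = sqrt (ell t)" for t
  define K2 where "K2 t = (1/2) * ell t + (1/2) * ell t * (C * sqrt 2)" for t
  define K3 where "K3 s t = sqrt (ell s * ell t) * C" for s t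
  define KR where "KR = 4 * L * real T ^ 3 * (\<Sum>t\<in>{1..T}. sqrt (ell t) ^ 3)"
  define K where "K = (\<Sum>t\<in>{1..T}. K1 t + K2 t + (\<Sum>s\<in>{1..<t}. K3 s t)) + KR"
  have K_nonneg: "0 \<le> K1 t" "0 \<le> K2 t" "s \<in> {1..<t} \<Longrightarrow> 0 \<le> K3 s t" if "t \<in> {1..T}" for s t
    using C ell[OF that] ell[of s] that by (auto simp: K1_def K2_def K3_def less_imp_le)
  have "0 \<le> KR" unfolding KR_def using L ell by (intro mult_nonneg_nonneg sum_nonneg) (auto intro: less_imp_le)
  then have K0: "0 \<le> K" unfolding K_def using K_nonneg
    by (intro add_nonneg_nonneg sum_nonneg) auto
  have "L1_le (noise_law T D N) (\<lambda>U. log_ratio T D ell p x U k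
      - (\<Sum>t\<in>{1..T}. if k t = 0 then 0 else gauss_ratio T D ell p (weight D x) U t (k t))) (K * rate D)"
    if D: "D \<ge> 1" and x: "x \<in> good D" and k: "k \<in> indices T N" for D x k
  proof -
    interpret P: prob_space "noise_law T D N" by (rule prob_noise_law)
    let ?A = "\<lambda>t. avg T D (\<lambda>z. (score t z)\<^sup>2) x"
    have r0: "0 \<le> rate D" by (rule rate_ge)
    have good: "\<bar>?A t - fisher T p t\<bar> \<le> tol D" "\<bar>avg T D (hess t t) x + fisher T p t\<bar> \<le> tol D" if "t \<in> {1..T}" for t
      using x that by (force simp: good_def)+
    have A0: "0 \<le> ?A t" for t unfolding avg_def by (intro divide_nonneg_nonneg sum_nonneg) auto
    have E1: "L1_le (noise_law T D N) (\<lambda>U. if k t = 0 then 0 else sqrt (ell t) * (sqrt (?A t) - sqrt (fisher T p t))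
             * wsum D (weight D x) U t (k t)) (K1 t * rate D)" if t: "t \<in> {1..T}" for t
    proof (cases "k t = 0")
      case False
      have "\<bar>sqrt (?A t) - sqrt (fisher T p t)\<bar> \<le> sqrt (tol D)"
        using good[OF t] by (intro order_trans[OF abs_sqrt_diff_le[OF A0 fisher_nonneg]]) simp
      then have "\<bar>sqrt (ell t) * (sqrt (?A t) - sqrt (fisher T p t))\<bar> * 1 \<le> K1 t * rate D"
        unfolding abs_mult K1_def using rate_ge(1)[of D] ell[OF t] by (simp add: mult_left_mono)
      with L1_le_cmult[OF L1_le_wsum[where a="weight D x", OF N t weight_norm[OF D] indices_range[OF k t False]],
          of "sqrt (ell t) * (sqrt (?A t) - sqrt (fisher T p t))"]
      show ?thesis using False by (auto intro: L1_le_mono)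
    qed (use K_nonneg[OF t] r0 in \<open>simp add: L1_le_zero\<close>)
    \<comment> \<open>The prefactor \<open>1 / D\<close> meets a standard deviation of order
      \<open>sqrt D\<close>.\<close>
    have scale: "c / real D * sqrt (real D * (C\<^sup>2 * v)) = c * (C * sqrt v) * (1 / sqrt (real D))" for c v
    proof -
      have "real D = sqrt (real D) * sqrt (real D)" by simp
      then show ?thesis using C D
        by (simp add: real_sqrt_mult field_simps)
    qed
    have E2: "L1_le (noise_law T D N) (\<lambda>U. if k t = 0 then 0 else (1/2) * ell t * (avg T D (hess t t) x + fisher T p t)
             + (1/2) * ell t / real D * (\<Sum>d\<in>{1..D}. hess t t (col T x d) * ((U t d (k t))\<^sup>2 - 1))) (K2 t * rate D)"
      if t: "t \<in> {1..T}" for t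
    proof (cases "k t = 0")
      case False
      have lt: "0 < ell t" by (rule ell[OF t])
      have "L1_le (noise_law T D N) (\<lambda>U. (1/2) * ell t * (avg T D (hess t t) x + fisher T p t)
             + (1/2) * ell t / real D * (\<Sum>d\<in>{1..D}. hess t t (col T x d) * ((U t d (k t))\<^sup>2 - 1)))
          ((1/2) * ell t * rate D + \<bar>(1/2) * ell t / real D\<bar> * sqrt (real D * (C\<^sup>2 * 2)))"
      proof (intro L1_le_add P.L1_le_const L1_le_cmult L1_le_noise_square_sum t indices_range[OF k t False] C(2) col_Rn)
        show "\<bar>(1/2) * ell t * (avg T D (hess t t) x + fisher T p t)\<bar> \<le> (1/2) * ell t * rate D"
          unfolding abs_mult using lt good(2)[OF t] rate_ge(2)[of D] by (intro mult_mono) auto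
      qed
      moreover have "\<bar>(1/2) * ell t / real D\<bar> * sqrt (real D * (C\<^sup>2 * 2)) \<le> (1/2) * ell t * (C * sqrt 2) * rate D"
      proof -
        have "\<bar>(1/2) * ell t / real D\<bar> * sqrt (real D * (C\<^sup>2 * 2)) = ((1/2) * ell t) / real D * sqrt (real D * (C\<^sup>2 * 2))"
          using lt by simp
        also have "\<dots> = (1/2) * ell t * (C * sqrt 2) * (1 / sqrt (real D))" by (rule scale)
        also have "\<dots> \<le> (1/2) * ell t * (C * sqrt 2) * rate D"
          using C lt by (intro mult_left_mono rate_ge) auto
        finally show ?thesis .
      qed
      ultimately show ?thesis
        using False by (simp add: K2_def distrib_right) (erule L1_le_mono, simp)
    qed (use K_nonneg[OF t] r0 in \<open>simp add: L1_le_zero\<close>)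
    have E3: "L1_le (noise_law T D N) (\<lambda>U. if k s = 0 \<or> k t = 0 then 0 else sqrt (ell s * ell t) / real D
             * (\<Sum>d\<in>{1..D}. hess s t (col T x d) * (U s d (k s) * U t d (k t)))) (K3 s t * rate D)"
      if t: "t \<in> {1..T}" and s: "s \<in> {1..<t}" for s t
    proof (cases "k s = 0 \<or> k t = 0")
      case False
      have s': "s \<in> {1..T}" "s \<noteq> t" using s t by auto
      have lst: "0 \<le> ell s * ell t" using ell[OF t] ell[OF s'(1)] by simp
      have "L1_le (noise_law T D N) (\<lambda>U. sqrt (ell s * ell t) / real D
             * (\<Sum>d\<in>{1..D}. hess s t (col T x d) * (U s d (k s) * U t d (k t))))
          (\<bar>sqrt (ell s * ell t) / real D\<bar> * sqrt (real D * (C\<^sup>2 * 1)))"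
        using False by (intro L1_le_cmult L1_le_noise_product_sum t s' indices_range[OF k] C(2) col_Rn) auto
      moreover have "\<bar>sqrt (ell s * ell t) / real D\<bar> * sqrt (real D * (C\<^sup>2 * 1)) \<le> K3 s t * rate D"
      proof -
        have "\<bar>sqrt (ell s * ell t) / real D\<bar> * sqrt (real D * (C\<^sup>2 * 1)) = sqrt (ell s * ell t) * (C * sqrt 1) * (1 / sqrt (real D))"
          using lst scale[of "sqrt (ell s * ell t)" 1] by simp
        also have "\<dots> \<le> sqrt (ell s * ell t) * (C * sqrt 1) * rate D"
          using C lst by (intro mult_left_mono rate_ge) auto
        finally show ?thesis by (simp add: K3_def)
      qed
      ultimately show ?thesis using False by (auto intro: L1_le_mono)
    qed (use K_nonneg(3)[OF t s] r0 in \<open>auto intro: L1_le_zero\<close>)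
    let ?g = "\<lambda>U. \<Sum>t\<in>{1..T}. if k t = 0 then 0 else gauss_ratio T D ell p (weight D x) U t (k t)"
    have "(\<lambda>U. quad_expansion D ell x U k - ?g U) = (\<lambda>U. \<Sum>t\<in>{1..T}. expansion_error D ell x U k t)"
      by (rule ext, rule log_ratio_expansion[OF k D ell])
    then have main: "L1_le (noise_law T D N) (\<lambda>U. quad_expansion D ell x U k - ?g U)
        (\<Sum>t\<in>{1..T}. K1 t * rate D + K2 t * rate D + (\<Sum>s\<in>{1..<t}. K3 s t * rate D))"
      by (simp only: expansion_error_def) (intro L1_le_add L1_le_sum E1 E2 E3)
    have "L1_le (noise_law T D N) (\<lambda>U. (quad_expansion D ell x U k - ?g U) + (log_ratio T D ell p x U k - quad_expansion D ell x U k))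
        ((\<Sum>t\<in>{1..T}. K1 t * rate D + K2 t * rate D + (\<Sum>s\<in>{1..<t}. K3 s t * rate D)) + KR * rate D)"
      unfolding KR_def by (intro L1_le_add main remainder_bound k D ell L)
    moreover have "(\<Sum>t\<in>{1..T}. K1 t * rate D + K2 t * rate D + (\<Sum>s\<in>{1..<t}. K3 s t * rate D)) + KR * rate D = K * rate D"
      by (simp add: K_def distrib_right sum_distrib_right)
    ultimately show ?thesis by simp
  qed
  with K0 show ?thesis by blast
qed

end

section \<open>Convergence of the selection law\<close>

text \<open>By distributivity, a product of one softmax per time is the softmax over whole paths of
  a sum of one-time exponents. Independent selection is thus the case of a log-ratio without
  interaction between times.\<close>

lemma prod_Psi_eq_softmax:
  assumes k: "k \<in> indices T N"
  shows "(\<Prod>t\<in>{1..T}. Psi N (k t) (v t))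
    = exp (\<Sum>t\<in>{1..T}. if k t = 0 then 0 else v t (k t))
      / (\<Sum>l\<in>indices T N. exp (\<Sum>t\<in>{1..T}. if l t = 0 then 0 else v t (l t)))"
proof -
  define w where "w t m = (if m = 0 then 0 else v t m)" for t m
  have split: "{0..N} = insert 0 {1..N}" by (auto simp: One_nat_def)
  have Psi: "Psi N m (v t) = exp (w t m) / (\<Sum>n\<in>{0..N}. exp (w t n))" for m t
  proof -
    have "(\<Sum>n\<in>{0..N}. exp (w t n)) = 1 + (\<Sum>n\<in>{1..N}. exp (v t n))"
      unfolding split by (subst sum.insert) (auto simp: w_def intro!: sum.cong)
    then show ?thesis by (simp add: Psi_def w_def)
  qed
  have "(\<Prod>t\<in>{1..T}. \<Sum>n\<in>{0..N}. exp (w t n)) = (\<Sum>l\<in>indices T N. \<Prod>t\<in>{1..T}. exp (w t (l t)))"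
    unfolding indices_def by (rule prod_sum_PiE) auto
  then show ?thesis
    by (simp add: Psi prod_dividef exp_sum w_def)
qed

lemma Psi_nonneg: "0 \<le> Psi N m h"
  unfolding Psi_def by (intro divide_nonneg_nonneg add_nonneg_nonneg sum_nonneg) auto

lemma sum_Psi:
  shows "(\<Sum>m\<in>{0..N}. Psi N m h) = 1"
    and "(\<Sum>m\<in>{1..N}. Psi N m h) = (\<Sum>m\<in>{1..N}. exp (h m)) / (1 + (\<Sum>m\<in>{1..N}. exp (h m)))"
proof -
  have split: "{0..N} = insert 0 {1..N}" by (auto simp: One_nat_def)
  show 1: "(\<Sum>m\<in>{1..N}. Psi N m h) = (\<Sum>m\<in>{1..N}. exp (h m)) / (1 + (\<Sum>m\<in>{1..N}. exp (h m)))"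
    unfolding sum_divide_distrib by (intro sum.cong refl) (auto simp: Psi_def)
  define S where "S = (\<Sum>m\<in>{1..N}. exp (h m))"
  have "0 \<le> S" unfolding S_def by (intro sum_nonneg) auto
  moreover have "(\<Sum>m\<in>{0..N}. Psi N m h) = 1 / (1 + S) + S / (1 + S)"
    unfolding split by (subst sum.insert) (auto simp only: 1 S_def, auto simp: Psi_def)
  ultimately show "(\<Sum>m\<in>{0..N}. Psi N m h) = 1"
    by (simp add: add_divide_distrib[symmetric])
qed

lemma Psi_le_1: "m \<in> {0..N} \<Longrightarrow> Psi N m h \<le> 1"
  using member_le_sum[of m "{0..N}" "\<lambda>m. Psi N m h"] Psi_nonneg sum_Psi(1)[of N h] by auto

text \<open>Acceptance at \<open>t\<close> describes a box of index vectors, so the sum factors, and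
  each other time contributes the total mass 1.\<close>

lemma sum_prod_Psi_accept:
  assumes t: "t \<in> {1..T}"
  shows "(\<Sum>k | k \<in> indices T N \<and> k t \<noteq> 0. \<Prod>s\<in>{1..T}. Psi N (k s) (V s))
    = (\<Sum>m\<in>{1..N}. exp (V t m)) / (1 + (\<Sum>m\<in>{1..N}. exp (V t m)))"
proof -
  define B where "B s = (if s = t then {1..N} else {0..N})" for s
  have "{k. k \<in> indices T N \<and> k t \<noteq> 0} = PiE {1..T} B"
    using t by (auto simp: indices_def PiE_iff B_def One_nat_def Suc_le_eq extensional_def split: if_splits)
  then have "(\<Sum>k | k \<in> indices T N \<and> k t \<noteq> 0. \<Prod>s\<in>{1..T}. Psi N (k s) (V s))
    = (\<Prod>s\<in>{1..T}. \<Sum>m\<in>B s. Psi N m (V s))"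
    using prod_sum_PiE[of "{1..T}" B "\<lambda>s m. Psi N m (V s)"] by (simp add: B_def)
  also have "\<dots> = (\<Prod>s\<in>{1..T}. if s = t then \<Sum>m\<in>{1..N}. Psi N m (V t) else 1)"
    by (intro prod.cong refl) (simp add: B_def sum_Psi(1))
  also have "\<dots> = (\<Sum>m\<in>{1..N}. Psi N m (V t))" using t by simp
  finally show ?thesis by (simp add: sum_Psi(2))
qed

text \<open>The left-hand side is \<open>1 / (1 + 1/S)\<close> with \<open>S = \<Sum> exp (h m)\<close>; the inequality between the
  harmonic and the arithmetic mean bounds \<open>1/S\<close> by \<open>Y\<close>, and \<open>1 / (1 + Y)\<close> lies above its tangent at \<open>c\<close>.\<close>

lemma acceptance_tangent_bound:
  fixes h :: "nat \<Rightarrow> real"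
  assumes N: "N \<ge> 1" and c: "0 \<le> c"
  defines "Y \<equiv> (\<Sum>m\<in>{1..N}. exp (- h m)) / (real N)\<^sup>2"
  shows "1 / (1 + c) - (Y - c) / (1 + c)\<^sup>2 \<le> (\<Sum>m\<in>{1..N}. exp (h m)) / (1 + (\<Sum>m\<in>{1..N}. exp (h m)))"
proof -
  define S where "S = (\<Sum>m\<in>{1..N}. exp (h m))"
  have S: "0 < S" unfolding S_def using N by (intro sum_pos) auto
  have Y: "0 < Y" unfolding Y_def using N by (intro divide_pos_pos sum_pos) auto
  \<comment> \<open>Cauchy-Schwarz for factors with product 1: the left-hand side is
    \<open>N^2\<close>.\<close>
  have "(\<Sum>m\<in>{1..N}. exp (h m / 2) * exp (- h m / 2))\<^sup>2
      \<le> (\<Sum>m\<in>{1..N}. (exp (h m / 2))\<^sup>2) * (\<Sum>m\<in>{1..N}. (exp (- h m / 2))\<^sup>2)"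
    by (rule Cauchy_Schwarz_ineq_sum)
  then have "(real N)\<^sup>2 \<le> S * (\<Sum>m\<in>{1..N}. exp (- h m))"
    by (simp add: S_def exp_add[symmetric] flip: exp_double)
  then have "1 / S \<le> Y"
    using S N unfolding Y_def by (simp add: field_simps)
  then have "1 / (1 + Y) \<le> 1 / (1 + 1 / S)"
    using S Y by (intro divide_left_mono mult_pos_pos add_pos_pos) auto
  also have "\<dots> = S / (1 + S)" using S by (simp add: field_simps)
  finally have 1: "1 / (1 + Y) \<le> S / (1 + S)" .
  \<comment> \<open>Convexity in explicit form: the gap to the tangent is a square over a positive
    denominator.\<close>
  have "1 / (1 + Y) - (1 / (1 + c) - (Y - c) / (1 + c)\<^sup>2) = (Y - c)\<^sup>2 / ((1 + Y) * (1 + c)\<^sup>2)"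
  proof -
    have nz: "1 + Y \<noteq> 0" "1 + c \<noteq> 0" using Y c by auto
    then show ?thesis by (simp add: divide_simps) (simp add: power2_eq_square algebra_simps)
  qed
  moreover have "0 \<le> (Y - c)\<^sup>2 / ((1 + Y) * (1 + c)\<^sup>2)" using Y by simp
  ultimately show ?thesis using 1 unfolding S_def[symmetric] by linarith
qed

text \<open>In \<open>ennreal\<close> the supremum over an empty \<open>F D\<close> is 0 and no
  boundedness has to be shown for it to exist.\<close>

lemma SUP_ennreal_tendsto_0:
  fixes g :: "nat \<Rightarrow> 'a \<Rightarrow> real"
  assumes le: "\<And>D x. D \<ge> 1 \<Longrightarrow> x \<in> F D \<Longrightarrow> g D x \<le> B D" and B: "B \<longlonglongrightarrow> 0"
  shows "(\<lambda>D. SUP x\<in>F D. ennreal (g D x)) \<longlonglongrightarrow> 0"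
proof (rule tendsto_sandwich[OF _ _ tendsto_const])
  show "(\<lambda>D. ennreal (B D)) \<longlonglongrightarrow> 0"
    using tendsto_ennrealI[OF B] by simp
  show "\<forall>\<^sub>F D in sequentially. (SUP x\<in>F D. ennreal (g D x)) \<le> ennreal (B D)"
    by (rule eventually_sequentiallyI[of 1]) (auto intro!: SUP_least ennreal_leI le)
qed simp

section \<open>The limiting noise law\<close>

lemma prob_limit_noise_law: "prob_space (limit_noise_law T N ell p)"
  unfolding limit_noise_law_def by (intro prob_space_PiM prob_space_mvnormal)

lemma measurable_Psi:
  assumes "k \<in> indices T N" "t \<in> {1..T}"
  shows "(\<lambda>V. Psi N (k t) (V t)) \<in> borel_measurable (\<Pi>\<^sub>M t\<in>{1..T}. \<Pi>\<^sub>M n\<in>{1..N}. borel)"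
proof -
  have m: "(\<lambda>V. exp (V t n)) \<in> borel_measurable (\<Pi>\<^sub>M t\<in>{1..T}. \<Pi>\<^sub>M n\<in>{1..N}. (borel :: real measure))" if "n \<in> {1..N}" for n
    by (intro measurable_compose[OF measurable_PiM_component2[OF assms(2) that]]) simp
  show ?thesis
    using m[OF indices_range[OF assms]] m unfolding Psi_def
    by (cases "k t = 0") (auto intro!: borel_measurable_divide borel_measurable_add borel_measurable_sum)
qed

lemma sets_limit_noise_law: "sets (limit_noise_law T N ell p) = sets (\<Pi>\<^sub>M t\<in>{1..T}. \<Pi>\<^sub>M n\<in>{1..N}. borel)"
  unfolding limit_noise_law_def by (intro sets_PiM_cong) auto

lemma integrable_prod_Psi:
  assumes k: "k \<in> indices T N"
  shows "integrable (limit_noise_law T N ell p) (\<lambda>V. \<Prod>t\<in>{1..T}. Psi N (k t) (V t))"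
proof -
  interpret prob_space "limit_noise_law T N ell p" by (rule prob_limit_noise_law)
  have "\<bar>\<Prod>t\<in>{1..T}. Psi N (k t) (V t)\<bar> \<le> 1" for V
    using k by (auto simp: abs_prod Psi_nonneg indices_def PiE_iff intro!: prod_le_1 Psi_le_1)
  then show ?thesis
    by (intro integrable_const_bound[of _ 1] AE_I2)
       (auto intro!: borel_measurable_prod measurable_Psi k simp: measurable_cong_sets[OF sets_limit_noise_law refl])
qed

context smooth_target
begin

text \<open>The weights depend on \<open>x\<close>, but only their unit norm affects the law; for
  every \<open>x\<close> and every \<open>D \<ge> 1\<close> the coupled vector has exactly the
  limiting law.\<close>

lemma distr_gauss_ratio:
  assumes N: "N \<ge> 1" and D: "D \<ge> 1" and ell: "\<And>t. t \<in> {1..T} \<Longrightarrow> 0 < ell t"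
  shows "distr (noise_law T D N) (\<Pi>\<^sub>M t\<in>{1..T}. \<Pi>\<^sub>M n\<in>{1..N}. borel)
      (\<lambda>U. \<lambda>t\<in>{1..T}. \<lambda>n\<in>{1..N}. gauss_ratio T D ell p (weight D x) U t n) = limit_noise_law T N ell p"
    and "(\<lambda>U. \<lambda>t\<in>{1..T}. \<lambda>n\<in>{1..N}. gauss_ratio T D ell p (weight D x) U t n)
      \<in> measurable (noise_law T D N) (\<Pi>\<^sub>M t\<in>{1..T}. \<Pi>\<^sub>M n\<in>{1..N}. borel)"
proof -
  let ?B = "\<Pi>\<^sub>M n\<in>{1..N}. (borel :: real measure)" and ?P = "\<Pi>\<^sub>M d\<in>{1..D}. noise1 N"
  define c where "c t = ell t * fisher T p t" for t
  define g where "g t = (\<lambda>V. \<lambda>n\<in>{1..N}. \<Sum>d\<in>{1..D}. weight D x t d * V d n)" for t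
  define aff where "aff t = (\<lambda>u. \<lambda>n\<in>{1..N}. - (1/2) * c t + sqrt (c t) * u n)" for t :: nat
  have g: "g t \<in> measurable ?P ?B" for t
    unfolding g_def
  proof (intro measurable_restrict borel_measurable_sum borel_measurable_times borel_measurable_const)
    fix n d assume *: "n \<in> {1..N}" "d \<in> {1..D}"
    then have "(\<lambda>u. u n) \<in> borel_measurable (noise1 N)" by measurable
    then show "(\<lambda>V. V d n) \<in> borel_measurable ?P"
      by (rule measurable_compose[OF measurable_component_singleton[OF *(2)]])
  qed
  have aff: "aff t \<in> measurable ?B ?B" for t
    unfolding aff_def by measurable
  have f: "(\<lambda>V. aff t (g t V)) \<in> measurable ?P ?B" for t
    by (rule measurable_compose[OF g aff])
  have comp: "distr ?P ?B (\<lambda>V. aff t (g t V))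
      = mvnormal {1..N} (\<lambda>_. - (1/2) * ell t * fisher T p t) (\<lambda>i j. ell t * fisher T p t * Sigma_mat i j)"
    if t: "t \<in> {1..T}" for t
  proof -
    have c0: "0 \<le> c t" using ell[OF t] fisher_nonneg[of t] by (simp add: c_def)
    have "distr ?P ?B (\<lambda>V. aff t (g t V)) = distr (distr ?P ?B (g t)) ?B (aff t)"
      by (subst distr_distr[OF aff g]) (simp add: comp_def)
    also have "distr ?P ?B (g t) = noise1 N"
      unfolding g_def by (rule distr_weighted_sum_noise1[OF N finite_atLeastAtMost weight_norm[OF D]])
    also have "distr (noise1 N) ?B (aff t) = mvnormal {1..N} (\<lambda>_. - (1/2) * c t) (\<lambda>i j. c t * Sigma_mat i j)"
      unfolding aff_def by (rule mvnormal_scaled_eq_distr_noise1[OF N c0, symmetric])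
    finally show ?thesis by (simp add: c_def mult.assoc)
  qed
  have eq: "(\<lambda>U. \<lambda>t\<in>{1..T}. \<lambda>n\<in>{1..N}. gauss_ratio T D ell p (weight D x) U t n) = (\<lambda>U. \<lambda>t\<in>{1..T}. aff t (g t (U t)))"
    by (auto simp: fun_eq_iff restrict_def aff_def g_def gauss_ratio_def wsum_def c_def)
  have pP: "prob_space ?P" by (intro prob_space_PiM prob_space_mvnormal)
  show "distr (noise_law T D N) (\<Pi>\<^sub>M t\<in>{1..T}. ?B)
      (\<lambda>U. \<lambda>t\<in>{1..T}. \<lambda>n\<in>{1..N}. gauss_ratio T D ell p (weight D x) U t n) = limit_noise_law T N ell p"
    unfolding eq noise_law_def limit_noise_law_def
    by (subst distr_PiM_componentwise[OF finite_atLeastAtMost pP f]) (intro PiM_cong refl comp)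
  show "(\<lambda>U. \<lambda>t\<in>{1..T}. \<lambda>n\<in>{1..N}. gauss_ratio T D ell p (weight D x) U t n)
      \<in> measurable (noise_law T D N) (\<Pi>\<^sub>M t\<in>{1..T}. ?B)"
    unfolding eq noise_law_def by (rule measurable_PiM_map[OF f])
qed

lemma ehmm_select_facts:
  assumes k: "k \<in> indices T N"
  shows "0 \<le> ehmm_select T D N ell p x U k"
    and "integrable (noise_law T D N) (\<lambda>U. ehmm_select T D N ell p x U k)"
proof -
  interpret P: prob_space "noise_law T D N" by (rule prob_noise_law)
  show nn: "0 \<le> ehmm_select T D N ell p x U k" for U
    unfolding ehmm_select_eq_softmax by (intro divide_nonneg_nonneg sum_nonneg) auto
  have le: "ehmm_select T D N ell p x U k \<le> 1" for U
  proof -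
    have "exp (log_ratio T D ell p x U k) \<le> (\<Sum>l\<in>indices T N. exp (log_ratio T D ell p x U l))"
      using k by (intro member_le_sum) auto
    then show ?thesis unfolding ehmm_select_eq_softmax
      by (intro divide_le_eq_1[THEN iffD2]) (auto intro!: sum_pos k)
  qed
  have m: "(\<lambda>U. ehmm_select T D N ell p x U k) \<in> borel_measurable (noise_law T D N)"
    unfolding ehmm_select_eq_softmax
    by (intro borel_measurable_divide borel_measurable_sum measurable_compose[OF measurable_log_ratio borel_measurable_exp] k)
  show "integrable (noise_law T D N) (\<lambda>U. ehmm_select T D N ell p x U k)"
    using nn le m by (intro P.integrable_const_bound[of _ 1]) auto
qed

text \<open>Both integrals become expectations on the noise space of the softmax of two exponent
  families that are close in L1. The constant collects the Lipschitz factor 2 and the number of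
  index vectors.\<close>

lemma selection_probability_converges:
  assumes N: "N \<ge> 1" and ell: "\<And>t. t \<in> {1..T} \<Longrightarrow> 0 < ell t"
  shows "\<exists>K. \<forall>D\<ge>1. \<forall>x\<in>good D. \<forall>k\<in>indices T N.
    \<bar>(\<integral>U. ehmm_select T D N ell p x U k \<partial>noise_law T D N)
      - (\<integral>V. (\<Prod>t\<in>{1..T}. Psi N (k t) (V t)) \<partial>limit_noise_law T N ell p)\<bar> \<le> K * rate D"
proof -
  obtain K where K: "\<And>D x k. D \<ge> 1 \<Longrightarrow> x \<in> good D \<Longrightarrow> k \<in> indices T N \<Longrightarrow>
    L1_le (noise_law T D N) (\<lambda>U. log_ratio T D ell p x U k
      - (\<Sum>t\<in>{1..T}. if k t = 0 then 0 else gauss_ratio T D ell p (weight D x) U t (k t))) (K * rate D)"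
    using log_ratio_approx[where ell=ell, OF N ell] by blast
  have "\<bar>(\<integral>U. ehmm_select T D N ell p x U k \<partial>noise_law T D N)
      - (\<integral>V. (\<Prod>t\<in>{1..T}. Psi N (k t) (V t)) \<partial>limit_noise_law T N ell p)\<bar>
      \<le> 2 * real (card (indices T N)) * K * rate D"
    if D: "D \<ge> 1" and x: "x \<in> good D" and k: "k \<in> indices T N" for D x k
  proof -
    interpret P: prob_space "noise_law T D N" by (rule prob_noise_law)
    let ?I = "indices T N"
    let ?H = "\<lambda>U l. log_ratio T D ell p x U l"
    let ?H' = "\<lambda>U l. \<Sum>t\<in>{1..T}. if l t = 0 then 0 else gauss_ratio T D ell p (weight D x) U t (l t)"
    let ?X = "\<lambda>U. \<lambda>t\<in>{1..T}. \<lambda>n\<in>{1..N}. gauss_ratio T D ell p (weight D x) U t n"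
    let ?q = "\<lambda>V. \<Prod>t\<in>{1..T}. Psi N (k t) (V t)"
    have X1: "limit_noise_law T N ell p = distr (noise_law T D N) (\<Pi>\<^sub>M t\<in>{1..T}. \<Pi>\<^sub>M n\<in>{1..N}. borel) ?X"
      by (rule distr_gauss_ratio(1)[OF N D ell, symmetric])
    have X2: "?X \<in> measurable (noise_law T D N) (\<Pi>\<^sub>M t\<in>{1..T}. \<Pi>\<^sub>M n\<in>{1..N}. borel)"
      by (rule distr_gauss_ratio(2)[OF N D ell])
    have qm: "?q \<in> borel_measurable (\<Pi>\<^sub>M t\<in>{1..T}. \<Pi>\<^sub>M n\<in>{1..N}. borel)"
      by (intro borel_measurable_prod measurable_Psi k)
    \<comment> \<open>At the coupled vector the limiting selection probability is the softmax of
      \<open>?H'\<close>, so it can be compared with that of the update for each noise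
      value.\<close>
    have q: "?q (?X U) = exp (?H' U k) / (\<Sum>l\<in>?I. exp (?H' U l))" for U
    proof -
      have rw: "(\<Sum>t\<in>{1..T}. if l t = 0 then 0 else ?X U t (l t)) = ?H' U l" if "l \<in> ?I" for l
        using indices_range[OF that] by (intro sum.cong refl) auto
      show ?thesis unfolding prod_Psi_eq_softmax[OF k] by (simp add: rw k cong: sum.cong)
    qed
    have e1: "(\<integral>V. ?q V \<partial>limit_noise_law T N ell p) = (\<integral>U. ?q (?X U) \<partial>noise_law T D N)"
      unfolding X1 by (rule integral_distr[OF X2 qm])
    have i1: "integrable (noise_law T D N) (\<lambda>U. ?q (?X U))"
      using integrable_prod_Psi[OF k, of ell p] unfolding X1 integrable_distr_eq[OF X2 qm] .
    have i2: "integrable (noise_law T D N) (\<lambda>U. ehmm_select T D N ell p x U k)"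
      by (rule ehmm_select_facts(2)[OF k])
    have L: "L1_le (noise_law T D N) (\<lambda>U. ?H U l - ?H' U l) (K * rate D)" if "l \<in> ?I" for l
      by (rule K[OF D x that])
    have i3: "integrable (noise_law T D N) (\<lambda>U. \<bar>?H U l - ?H' U l\<bar>)" if "l \<in> ?I" for l
      using L1_leD(1)[OF L[OF that]] by (rule integrable_abs)
    have "\<bar>(\<integral>U. ehmm_select T D N ell p x U k \<partial>noise_law T D N) - (\<integral>V. ?q V \<partial>limit_noise_law T N ell p)\<bar>
      = \<bar>\<integral>U. ehmm_select T D N ell p x U k - ?q (?X U) \<partial>noise_law T D N\<bar>"
      unfolding e1 using i1 i2 by simp
    also have "\<dots> \<le> (\<integral>U. \<bar>ehmm_select T D N ell p x U k - ?q (?X U)\<bar> \<partial>noise_law T D N)"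
      by (rule integral_abs_bound)
    also have "\<dots> \<le> (\<integral>U. 2 * (\<Sum>l\<in>?I. \<bar>?H U l - ?H' U l\<bar>) \<partial>noise_law T D N)"
    proof (rule integral_mono)
      show "integrable (noise_law T D N) (\<lambda>U. \<bar>ehmm_select T D N ell p x U k - ?q (?X U)\<bar>)"
        using i1 i2 by simp
      show "integrable (noise_law T D N) (\<lambda>U. 2 * (\<Sum>l\<in>?I. \<bar>?H U l - ?H' U l\<bar>))"
        by (intro integrable_mult_right Bochner_Integration.integrable_sum i3)
      show "\<bar>ehmm_select T D N ell p x U k - ?q (?X U)\<bar> \<le> 2 * (\<Sum>l\<in>?I. \<bar>?H U l - ?H' U l\<bar>)" for U
        unfolding q ehmm_select_eq_softmax by (rule softmax_Lipschitz[OF finite_indices k])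
    qed
    also have "\<dots> = 2 * (\<Sum>l\<in>?I. \<integral>U. \<bar>?H U l - ?H' U l\<bar> \<partial>noise_law T D N)"
      using i3 by (simp add: Bochner_Integration.integral_sum)
    also have "\<dots> \<le> 2 * (\<Sum>l\<in>?I. K * rate D)"
      by (intro mult_left_mono sum_mono L1_leD(2)[OF L]) auto
    finally show ?thesis by simp
  qed
  then show ?thesis by blast
qed

text \<open>The tangent is taken at the mean of \<open>Y\<close>, so its linear part integrates to 0
  and only \<open>1 / (1 + m)\<close> remains.\<close>

lemma limit_acceptance_lower_bound:
  assumes N: "N \<ge> 1" and ell: "\<And>t. t \<in> {1..T} \<Longrightarrow> 0 < ell t" and t: "t \<in> {1..T}"
  shows "inverse (1 + exp (ell t * fisher T p t) / real N) \<le> accept_prob (limit_ehmm T N ell p) t"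
proof -
  let ?L = "limit_noise_law T N ell p" and ?B = "\<Pi>\<^sub>M n\<in>{1..N}. (borel :: real measure)"
  define c where "c = ell t * fisher T p t"
  \<comment> \<open>The mean of \<open>Y\<close>: \<open>N\<close> summands of expectation
    \<open>exp c\<close>, divided by \<open>N^2\<close>.\<close>
  define m where "m = exp c / real N"
  have c0: "0 \<le> c" using ell[OF t] fisher_nonneg[of t] by (simp add: c_def)
  have m0: "0 \<le> m" by (simp add: m_def)
  interpret L: prob_space ?L by (rule prob_limit_noise_law)
  interpret n1: prob_space "noise1 N" by (rule prob_space_mvnormal)
  let ?mv = "\<lambda>t. mvnormal {1..N} (\<lambda>_. - (1/2) * ell t * fisher T p t) (\<lambda>i j. ell t * fisher T p t * Sigma_mat i j)"
  let ?r = "\<lambda>h. (\<Sum>m\<in>{1..N}. exp (h m)) / (1 + (\<Sum>m\<in>{1..N}. exp (h m :: real)))"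
  let ?aff = "\<lambda>u. \<lambda>n\<in>{1..N}. - (1/2) * c + sqrt c * u n"
  have expm: "(\<lambda>h. exp (h n)) \<in> borel_measurable ?B" if "n \<in> {1..N}" for n
    using that by measurable
  have r: "?r \<in> borel_measurable ?B"
    using expm by (intro borel_measurable_divide borel_measurable_add borel_measurable_sum borel_measurable_const) auto
  have aff: "?aff \<in> measurable (noise1 N) ?B"
  proof (rule measurable_restrict)
    fix n assume "n \<in> {1..N}"
    then show "(\<lambda>u. - (1/2) * c + sqrt c * u n) \<in> borel_measurable (noise1 N)" by measurable
  qed
  have "accept_prob (limit_ehmm T N ell p) t
    = (\<Sum>k | k \<in> indices T N \<and> k t \<noteq> 0. \<integral>V. (\<Prod>s\<in>{1..T}. Psi N (k s) (V s)) \<partial>?L)"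
    unfolding limit_ehmm_def
    by (rule accept_prob_select_law[OF prob_limit_noise_law integrable_prod_Psi]) (auto intro: prod_nonneg Psi_nonneg)
  also have "\<dots> = (\<integral>V. (\<Sum>k | k \<in> indices T N \<and> k t \<noteq> 0. \<Prod>s\<in>{1..T}. Psi N (k s) (V s)) \<partial>?L)"
    by (rule Bochner_Integration.integral_sum[symmetric]) (auto intro: integrable_prod_Psi)
  also have "\<dots> = (\<integral>V. ?r (V t) \<partial>?L)"
    by (simp only: sum_prod_Psi_accept[OF t])
  also have "\<dots> = (\<integral>h. ?r h \<partial>?mv t)"
    unfolding limit_noise_law_def
    by (rule integral_PiM_component(1)[where M="?mv" and g="?r", OF prob_space_mvnormal t])
       (simp add: measurable_cong_sets[OF sets_mvnormal refl] r)
  also have "?mv t = distr (noise1 N) ?B ?aff"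
    using mvnormal_scaled_eq_distr_noise1[OF N c0, of "- (1/2) * c"] by (simp add: c_def mult.assoc)
  also have "(\<integral>h. ?r h \<partial>distr (noise1 N) ?B ?aff) = (\<integral>u. ?r (?aff u) \<partial>noise1 N)"
    by (rule integral_distr[OF aff r])
  finally have acc: "accept_prob (limit_ehmm T N ell p) t = (\<integral>u. ?r (?aff u) \<partial>noise1 N)" .
  let ?Y = "\<lambda>u. (\<Sum>n\<in>{1..N}. exp (- ?aff u n)) / (real N)\<^sup>2"
  have Yn: "exp (- ?aff u n) = exp (c / 2) * exp ((- sqrt c) * u n)" if "n \<in> {1..N}" for u n
    using that by (simp add: exp_add[symmetric])
  \<comment> \<open>The negative of a limiting coordinate is normal with mean \<open>c / 2\<close>
    and variance \<open>c\<close>, so the expectation of its exponential is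
    \<open>exp (c / 2 + c / 2)\<close>.\<close>
  have iYn: "integrable (noise1 N) (\<lambda>u. exp (- ?aff u n))" if "n \<in> {1..N}" for n
    unfolding Yn[OF that] using noise1_moments(7)[OF that, of "- sqrt c"] by simp
  have eYn: "(\<integral>u. exp (- ?aff u n) \<partial>noise1 N) = exp c" if "n \<in> {1..N}" for n
  proof -
    have "(\<integral>u. exp (- ?aff u n) \<partial>noise1 N) = exp (c / 2) * exp ((- sqrt c)\<^sup>2 / 2)"
      unfolding Yn[OF that] using noise1_moments(6)[OF that, of "- sqrt c"] by simp
    then show ?thesis using c0 by (simp add: exp_add[symmetric])
  qed
  have iY: "integrable (noise1 N) ?Y"
    by (intro integrable_divide_zero Bochner_Integration.integrable_sum iYn) auto
  have "(\<integral>u. ?Y u \<partial>noise1 N) = (\<Sum>n\<in>{1..N}. exp c) / (real N)\<^sup>2"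
    using iYn eYn by (simp only: integral_divide_zero) (subst Bochner_Integration.integral_sum, auto)
  then have eY: "(\<integral>u. ?Y u \<partial>noise1 N) = m"
    using N by (simp add: m_def power2_eq_square)
  have ir: "integrable (noise1 N) (\<lambda>u. ?r (?aff u))"
  proof (rule n1.integrable_const_bound[of _ 1])
    show "(\<lambda>u. ?r (?aff u)) \<in> borel_measurable (noise1 N)" by (rule measurable_compose[OF aff r])
    show "AE u in noise1 N. norm (?r (?aff u)) \<le> 1"
    proof (rule AE_I2)
      fix u
      have "0 \<le> (\<Sum>m\<in>{1..N}. exp (?aff u m))" by (intro sum_nonneg) auto
      then show "norm (?r (?aff u)) \<le> 1" by (simp only: real_norm_def abs_divide) (simp add: divide_le_eq_1)
    qed
  qed
  have "inverse (1 + m) = 1 / (1 + m) - (m - m) / (1 + m)\<^sup>2" by (simp add: inverse_eq_divide)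
  also have "\<dots> = (\<integral>u. 1 / (1 + m) - (?Y u - m) / (1 + m)\<^sup>2 \<partial>noise1 N)"
    using iY eY by (simp add: n1.prob_space)
  also have "\<dots> \<le> (\<integral>u. ?r (?aff u) \<partial>noise1 N)"
    by (intro integral_mono ir acceptance_tangent_bound N m0) (use iY in simp)
  finally show ?thesis unfolding acc m_def c_def .
qed

end

section \<open>The density of the model, and the conclusion\<close>

lemma fk_density_nonneg:
  assumes "T \<ge> 1" and "fk_model T m1 m G"
  shows "0 \<le> fk_density T m1 m G x"
proof -
  have "0 \<le> fk_unnorm T m1 m G x" for x
    using assms unfolding fk_unnorm_def fk_model_def
    by (intro mult_nonneg_nonneg prod_nonneg ballI) (auto intro: less_imp_le)
  then show ?thesis unfolding fk_density_def by (intro divide_nonneg_nonneg Bochner_Integration.integral_nonneg)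
qed

lemma measurable_fk_density:
  assumes "T \<ge> 1" and model: "fk_model T m1 m G"
  shows "fk_density T m1 m G \<in> borel_measurable (\<Pi>\<^sub>M t\<in>{1..T}. lborel)"
proof -
  let ?P = "\<Pi>\<^sub>M t\<in>{1..T}. (lborel :: real measure)"
  have c: "(\<lambda>x. x t) \<in> borel_measurable ?P" if "t \<in> {1..T}" for t
    using measurable_component_singleton[OF that, of "\<lambda>_. lborel"] by simp
  have m1: "(\<lambda>x. m1 (x 1)) \<in> borel_measurable ?P"
    using model assms by (intro measurable_compose[OF c]) (auto simp: fk_model_def)
  have G: "(\<lambda>x. G t (x t)) \<in> borel_measurable ?P" if "t \<in> {1..T}" for t
    using model that by (intro measurable_compose[OF c]) (auto simp: fk_model_def)
  have m: "(\<lambda>x. m t (x (t - 1)) (x t)) \<in> borel_measurable ?P" if t: "t \<in> {2..T}" for t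
  proof -
    have "t - 1 \<in> {1..T}" "t \<in> {1..T}" using t by auto
    then have "(\<lambda>x. (x (t - 1), x t)) \<in> measurable ?P (borel \<Otimes>\<^sub>M borel)"
      by (intro measurable_Pair c)
    moreover have "(\<lambda>(x, y). m t x y) \<in> borel_measurable (borel \<Otimes>\<^sub>M borel)"
      using model t by (auto simp: fk_model_def)
    ultimately show ?thesis using measurable_compose by fastforce
  qed
  show ?thesis
    unfolding fk_density_def[abs_def] fk_unnorm_def
    using assms by (intro borel_measurable_divide borel_measurable_times borel_measurable_prod m1 G m borel_measurable_const) auto
qed

theorem proposition3p3:
  fixes T N :: nat and ell :: "nat \<Rightarrow> real"
    and m1 :: "real \<Rightarrow> real" and m :: "nat \<Rightarrow> real \<Rightarrow> real \<Rightarrow> real" and G :: "nat \<Rightarrow> real \<Rightarrow> real"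
    and p :: "(nat \<Rightarrow> real) \<Rightarrow> real"
  assumes "T \<ge> 1" and "N \<ge> 1"
    and "\<And>t. t \<in> {1..T} \<Longrightarrow> ell t > 0"
    and model: "fk_model T m1 m G"
    and p: "p = fk_density T m1 m G"
    and prob: "prob_space (pi_measure T p)"
    and C2: "C_k T 2 p"
    \<comment> \<open>\<open>log \<pi>\<^sub>T\<close> is only meaningful where \<open>\<pi>\<^sub>T > 0\<close>; positivity on all of \<open>\<real>\<^sup>T\<close> is not assumed.\<close>
    and "\<And>s u. s \<in> {1..T} \<Longrightarrow> u \<in> {1..T} \<Longrightarrow>
           Lipschitz_Rn T {x \<in> Rn T. p x > 0} (pderiv_at s (pderiv_at u (log_p p)))"
    and "\<And>s u. s \<in> {1..T} \<Longrightarrow> u \<in> {1..T} \<Longrightarrow>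
           bounded (pderiv_at s (pderiv_at u (log_p p)) ` {x \<in> Rn T. p x > 0})"
    and "\<And>u. u \<in> {1..T} \<Longrightarrow> integrable (pi_measure T p) (\<lambda>x. \<bar>pderiv_at u (log_p p) x\<bar> ^ 4)"
  shows "(\<exists>F :: nat \<Rightarrow> (nat \<Rightarrow> nat \<Rightarrow> real) set.
            (\<forall>D. F D \<in> sets (\<Pi>\<^sub>M t\<in>{1..T}. \<Pi>\<^sub>M d\<in>{1..D}. (borel :: real measure))) \<and>
            (\<lambda>D. measure (target_measure T D p) (F D)) \<longlonglongrightarrow> 1 \<and>
            (\<lambda>D. SUP x\<in>F D. ennreal (tv_dist (K_law T N (rw_ehmm T D N ell p x))
                                              (K_law T N (limit_ehmm T N ell p)))) \<longlonglongrightarrow> 0 \<and>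
            (\<forall>t\<in>{1..T}.
               (\<lambda>D. SUP x\<in>F D. ennreal \<bar>accept_prob (rw_ehmm T D N ell p x) t
                                         - accept_prob (limit_ehmm T N ell p) t\<bar>) \<longlonglongrightarrow> 0)) \<and>
         (\<forall>t\<in>{1..T}.
            accept_prob (limit_ehmm T N ell p) t \<ge> inverse (1 + exp (ell t * fisher T p t) / real N) \<and>
            inverse (1 + exp (ell t * fisher T p t) / real N) > 0)"
proof -
  have nonneg: "0 \<le> p x" for x unfolding p by (rule fk_density_nonneg[OF assms(1) model])
  have meas: "p \<in> borel_measurable (\<Pi>\<^sub>M t\<in>{1..T}. lborel)"
    unfolding p by (rule measurable_fk_density[OF assms(1) model])
  interpret smooth_target T p
    by (rule smooth_target.intro) (fact meas nonneg prob C2 assms)+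
  obtain K where K: "\<And>D x k. D \<ge> 1 \<Longrightarrow> x \<in> good D \<Longrightarrow> k \<in> indices T N \<Longrightarrow>
    \<bar>(\<integral>U. ehmm_select T D N ell p x U k \<partial>noise_law T D N)
      - (\<integral>V. (\<Prod>t\<in>{1..T}. Psi N (k t) (V t)) \<partial>limit_noise_law T N ell p)\<bar> \<le> K * rate D"
    using selection_probability_converges[where ell=ell, OF assms(2,3)] by blast
  \<comment> \<open>The index-wise bound summed over all index vectors. It depends neither on
    \<open>x\<close> nor on \<open>t\<close>, and one null sequence controls both total variation
    and acceptance probabilities.\<close>
  define B where "B D = real (card (indices T N)) * (K * rate D)" for D
  have B: "B \<longlonglongrightarrow> 0"
    unfolding B_def[abs_def] by (intro tendsto_mult_right_zero rate_tendsto_0)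
  have Psi0: "0 \<le> (\<Prod>t\<in>{1..T}. Psi N (k t) (V t))" for k V
    by (intro prod_nonneg ballI Psi_nonneg)
  have tv: "tv_dist (K_law T N (rw_ehmm T D N ell p x)) (K_law T N (limit_ehmm T N ell p)) \<le> B D"
    if "D \<ge> 1" "x \<in> good D" for D x
    unfolding rw_ehmm_def limit_ehmm_def B_def
    by (rule tv_dist_K_law_le[OF prob_noise_law ehmm_select_facts(2) ehmm_select_facts(1)
          prob_limit_noise_law integrable_prod_Psi Psi0 K[OF that]])
  have acc: "\<bar>accept_prob (rw_ehmm T D N ell p x) t - accept_prob (limit_ehmm T N ell p) t\<bar> \<le> B D"
    if "D \<ge> 1" "x \<in> good D" for D x t
    unfolding rw_ehmm_def limit_ehmm_def B_def
    by (rule accept_prob_diff_le[OF prob_noise_law ehmm_select_facts(2) ehmm_select_facts(1)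
          prob_limit_noise_law integrable_prod_Psi Psi0 K[OF that]])
  have pos: "0 < inverse (1 + exp (ell t * fisher T p t) / real N)" for t
    by (simp add: add_pos_nonneg)
  show ?thesis
    by (intro conjI exI[of _ good] allI ballI sets_good measure_good_tendsto_1
        SUP_ennreal_tendsto_0[OF tv B] SUP_ennreal_tendsto_0[OF acc B]
        limit_acceptance_lower_bound[where ell=ell, OF assms(2,3)] pos)
qed

end
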